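(* Let $N\ge1$, let $\widehat D$ be the vertex algebra of (convergent) chiral differential operators in $N$ variables, with its canonical structure of a conformal vertex algebra given by the Virasoro field $L(z)=a^i(z)b^i(z)'$ (sum over $i$). Let $g=(g^1,\dots,g^N)$ be a germ of invertible holomorphic coordinate change at the origin of $\mathbb{C}^N$, and let $\tilde g=(g,h(g))$ be the automorphism of the vertex algebra $\widehat D$ given on the generating fields by $$b^i(z)\mapsto g^i(b)(z),\qquad a^i(z)\mapsto a^j\phi^{ji}(g)(z)+b^k(z)'\,h(g)^{ki}(z),$$ where $\phi(g)=((\partial g)^{-1})^t$, $\partial g=(\partial_ig^j)$, and $$h(g)=\tfrac12\,(\phi(g)^t)^{-1}\psi(g),\qquad \psi^{ij}(g)=\partial_r\phi^{pi}(g)\,\partial_p\phi^{rj}(g).$$ Then under the automorphism $\tilde g$ the Virasoro field $L(z)$ is transformed as follows: $$L(z)^{\sim}=L(z)-\frac12\bigl(\mathrm{Tr}\,\log\,\partial g(b(z))\bigr)'',$$ where the tilde denotes the result of transformation under $\tilde g$.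
   Context: Summation over repeated indices is understood; $'$ denotes $d/dz$ and $\partial_i=\partial/\partial b^i$. $\widehat O$ is the algebra of power series in $b^1,\dots,b^N$ convergent in some neighbourhood of the origin. $D$ is the free bosonic vertex algebra generated by fields $b^i(z)$ of conformal weight $0$ and $a^i(z)$ of conformal weight $1$ ($i=1,\dots,N$), with OPE $a^i(z)b^j(w)\sim\delta_{ij}/(z-w)$ and all other OPE trivial. Its weight zero component is $O=\mathbb{C}[b^1_0,\dots,b^N_0]$. Put $\widehat D=\widehat O\otimes_OD$, with the vertex algebra structure extending that of $D$ in which the field of $f\in\widehat O$ is $f(b(z))=\sum_\alpha\frac1{\alpha!}\partial^\alpha f(b_0)(b(z)-b_0)^\alpha$. The product in $L(z)=a^i(z)b^i(z)'$ is normally ordered. A germ of coordinate change is a tuple $g=(g^1,\dots,g^N)$ with $g^i\in\widehat O$, $g(0)=0$, and nondegenerate Jacobian matrix $\partial g$. Expressions like $a^j\phi^{ji}(z)$ denote the field of the state $a^j_{-1}\phi^{ji}$. $L(z)^\sim$ is the image of the field $L(z)$ under $\tilde g$, i.e. the field of the image under $\tilde g$ of the state $a^i_{-1}b^i_{-1}\mathbf 1$. Here $\mathrm{Tr}\log\partial g=\log\det\partial g$, and $(\cdot)''$ is the second derivative in $z$ of the corresponding field (insensitive to the choice of branch of the logarithm). *)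

theory Defs
  imports "HOL-Analysis.Analysis" "HOL-Library.Poly_Mapping"
begin

section \<open>Convergent power series in several variables\<close>

text \<open>A power series in the variables \<open>b\<^sup>i\<close>, \<open>i :: 'n\<close>, is given by its coefficients, indexed by the
  exponents \<open>\<alpha> :: 'n \<Rightarrow> nat\<close>. The finite type \<open>'n\<close> plays the role of \<open>{1..N}\<close>.\<close>

definition mdeg :: "('n::finite \<Rightarrow> nat) \<Rightarrow> nat" where
  "mdeg \<alpha> = (\<Sum>i\<in>UNIV. \<alpha> i)"

definition mfact :: "('n::finite \<Rightarrow> nat) \<Rightarrow> nat" where
  "mfact \<alpha> = (\<Prod>i\<in>UNIV. fact (\<alpha> i))"

definition converges_near_0 :: "(('n::finite \<Rightarrow> nat) \<Rightarrow> complex) \<Rightarrow> bool" where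
  "converges_near_0 f \<longleftrightarrow> (\<exists>r>0. \<forall>x::complex^'n. norm x < r \<longrightarrow>
     (\<lambda>\<alpha>. f \<alpha> * (\<Prod>i\<in>UNIV. x $ i ^ \<alpha> i)) summable_on UNIV)"

definition weight_le :: "real \<Rightarrow> real \<Rightarrow> (('n::finite \<Rightarrow> nat) \<Rightarrow> complex) \<Rightarrow> bool" where
  "weight_le s c f \<longleftrightarrow> (\<forall>F. finite F \<longrightarrow> (\<Sum>\<alpha>\<in>F. norm (f \<alpha>) * s ^ mdeg \<alpha>) \<le> c)"

lemma mdeg_add: "mdeg (\<lambda>i. \<alpha> i + \<beta> i) = mdeg \<alpha> + mdeg \<beta>"
  by (simp add: mdeg_def sum.distrib)

lemma weight_leD:
  assumes "weight_le s c f" "s > 0"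
  shows "norm (f \<alpha>) \<le> c * (1/s) ^ mdeg \<alpha>"
proof -
  have "(\<Sum>\<alpha>\<in>{\<alpha>}. norm (f \<alpha>) * s ^ mdeg \<alpha>) \<le> c"
    using assms(1) unfolding weight_le_def by blast
  thus ?thesis using assms(2) by (simp add: field_simps power_divide)
qed

lemma weight_le_nonneg: "weight_le s c f \<Longrightarrow> 0 \<le> c"
  unfolding weight_le_def by (metis finite.emptyI sum.empty)

lemma sum_half_power: "(\<Sum>k\<le>n. (1/2::real) ^ k) \<le> 2"
proof -
  have "(\<Sum>k\<le>n. (1/2::real) ^ k) = 2 - (1/2)^n"
    by (induction n) (auto simp: field_simps)
  thus ?thesis by simp
qed

lemma sum_half_mdeg:
  assumes "finite (F :: ('n::finite \<Rightarrow> nat) set)"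
  shows "(\<Sum>\<alpha>\<in>F. (1/2::real) ^ mdeg \<alpha>) \<le> 2 ^ CARD('n)"
proof -
  obtain K where K: "\<And>\<alpha> i. \<alpha> \<in> F \<Longrightarrow> \<alpha> i \<le> K"
  proof
    fix \<alpha> i assume "\<alpha> \<in> F"
    have "\<alpha> i \<le> mdeg \<alpha>" unfolding mdeg_def by (rule member_le_sum) auto
    also have "\<dots> \<le> (\<Sum>\<alpha>\<in>F. mdeg \<alpha>)" using \<open>\<alpha> \<in> F\<close> assms by (intro member_le_sum) auto
    finally show "\<alpha> i \<le> (\<Sum>\<alpha>\<in>F. mdeg \<alpha>)" .
  qed
  have "(\<Sum>\<alpha>\<in>F. (1/2::real) ^ mdeg \<alpha>) = (\<Sum>\<alpha>\<in>F. \<Prod>i\<in>UNIV. (1/2::real) ^ \<alpha> i)"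
    by (simp add: mdeg_def power_sum)
  also have "\<dots> \<le> (\<Sum>\<alpha>\<in>PiE (UNIV::'n set) (\<lambda>_. {..K}). \<Prod>i\<in>UNIV. (1/2::real) ^ \<alpha> i)"
    by (rule sum_mono2) (auto simp: K prod_nonneg intro!: finite_PiE)
  also have "\<dots> = (\<Prod>i\<in>(UNIV::'n set). \<Sum>k\<le>K. (1/2::real) ^ k)"
    by (rule prod_sum_PiE [symmetric]) auto
  also have "\<dots> \<le> (\<Prod>i\<in>(UNIV::'n set). 2)"
    by (intro prod_mono) (auto intro!: sum_nonneg sum_half_power)
  finally show ?thesis by simp
qed

lemma weight_leI:
  fixes f :: "('n::finite \<Rightarrow> nat) \<Rightarrow> complex"
  assumes bd: "\<And>\<alpha>. norm (f \<alpha>) \<le> C * R ^ mdeg \<alpha>" and "R > 0"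
  shows "weight_le (1/(2*R)) (C * 2 ^ CARD('n)) f"
  unfolding weight_le_def
proof (intro allI impI)
  fix F :: "('n \<Rightarrow> nat) set" assume F: "finite F"
  have C: "C \<ge> 0" using bd[of "\<lambda>_. 0"] norm_ge_zero[of "f (\<lambda>_. 0)"]
    by (simp add: mdeg_def order.trans [OF norm_ge_zero])
  have "(\<Sum>\<alpha>\<in>F. norm (f \<alpha>) * (1/(2*R)) ^ mdeg \<alpha>) \<le> (\<Sum>\<alpha>\<in>F. C * (1/2) ^ mdeg \<alpha>)"
  proof (rule sum_mono)
    fix \<alpha>
    have "norm (f \<alpha>) * (1/(2*R)) ^ mdeg \<alpha> \<le> C * R ^ mdeg \<alpha> * (1/(2*R)) ^ mdeg \<alpha>"
      using bd[of \<alpha>] \<open>R > 0\<close> by (intro mult_right_mono) auto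
    also have "\<dots> = C * (1/2) ^ mdeg \<alpha>"
      using \<open>R > 0\<close> by (simp add: power_divide power_mult_distrib)
    finally show "norm (f \<alpha>) * (1/(2*R)) ^ mdeg \<alpha> \<le> C * (1/2) ^ mdeg \<alpha>" .
  qed
  also have "\<dots> \<le> C * 2 ^ CARD('n)"
    using sum_half_mdeg[OF F] C by (simp add: sum_distrib_left [symmetric] mult_left_mono)
  finally show "(\<Sum>\<alpha>\<in>F. norm (f \<alpha>) * (1/(2*R)) ^ mdeg \<alpha>) \<le> C * 2 ^ CARD('n)" .
qed

lemma converges_near_0_iff_weight:
  "converges_near_0 f \<longleftrightarrow> (\<exists>s>0. \<exists>c. weight_le s c f)"
proof
  assume "converges_near_0 f"
  then obtain r where r: "r > 0" and
    sm: "\<And>x::complex^'a. norm x < r \<Longrightarrow> (\<lambda>\<alpha>. f \<alpha> * (\<Prod>i\<in>UNIV. x $ i ^ \<alpha> i)) summable_on UNIV"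
    unfolding converges_near_0_def by blast
  define s where "s = r / (2 * real CARD('a))"
  define x where "x = ((\<chi> i. of_real s) :: complex^'a)"
  have s: "s > 0" using r by (simp add: s_def)
  have "norm x \<le> (\<Sum>i\<in>UNIV. norm (x $ i))" unfolding norm_vec_def by (rule L2_set_le_sum) simp
  also have "\<dots> = (\<Sum>i\<in>(UNIV::'a set). s)" using s by (simp add: x_def)
  also have "\<dots> = r / 2" by (simp add: s_def)
  also have "\<dots> < r" using r by simp
  finally have "(\<lambda>\<alpha>. f \<alpha> * (\<Prod>i\<in>UNIV. x $ i ^ \<alpha> i)) summable_on UNIV" by (rule sm)
  hence "(\<lambda>\<alpha>. norm (f \<alpha> * (\<Prod>i\<in>UNIV. x $ i ^ \<alpha> i))) summable_on UNIV"
    by (simp add: summable_on_iff_abs_summable_on_complex)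
  hence "bdd_above (sum (\<lambda>\<alpha>. norm (f \<alpha> * (\<Prod>i\<in>UNIV. x $ i ^ \<alpha> i))) ` {F. F \<subseteq> UNIV \<and> finite F})"
    by (simp only: abs_summable_iff_bdd_above)
  then obtain c where c: "\<And>F. finite F \<Longrightarrow> (\<Sum>\<alpha>\<in>F. norm (f \<alpha> * (\<Prod>i\<in>UNIV. x $ i ^ \<alpha> i))) \<le> c"
    unfolding bdd_above_def by blast
  have "norm (f \<alpha> * (\<Prod>i\<in>UNIV. x $ i ^ \<alpha> i)) = norm (f \<alpha>) * s ^ mdeg \<alpha>" for \<alpha>
    using s by (simp add: norm_mult x_def norm_power mdeg_def power_sum flip: prod_norm)
  with c have "weight_le s c f" unfolding weight_le_def by simp
  with s show "\<exists>s>0. \<exists>c. weight_le s c f" by blast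
next
  assume "\<exists>s>0. \<exists>c. weight_le s c f"
  then obtain s c where s: "s > 0" and c: "weight_le s c f" by blast
  have "(\<lambda>\<alpha>. f \<alpha> * (\<Prod>i\<in>UNIV. x $ i ^ \<alpha> i)) summable_on UNIV" if x: "norm x < s" for x :: "complex^'a"
  proof (rule abs_summable_summable, unfold abs_summable_iff_bdd_above bdd_above_def, intro exI ballI)
    fix y assume "y \<in> sum (\<lambda>\<alpha>. norm (f \<alpha> * (\<Prod>i\<in>UNIV. x $ i ^ \<alpha> i))) ` {F. F \<subseteq> UNIV \<and> finite F}"
    then obtain F where F: "finite F" and y: "y = (\<Sum>\<alpha>\<in>F. norm (f \<alpha> * (\<Prod>i\<in>UNIV. x $ i ^ \<alpha> i)))"
      by blast
    have "y \<le> (\<Sum>\<alpha>\<in>F. norm (f \<alpha>) * s ^ mdeg \<alpha>)"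
      unfolding y
    proof (rule sum_mono)
      fix \<alpha>
      have "norm (\<Prod>i\<in>UNIV. x $ i ^ \<alpha> i) = (\<Prod>i\<in>UNIV. norm (x $ i) ^ \<alpha> i)"
        by (simp add: norm_power flip: prod_norm)
      also have "\<dots> \<le> (\<Prod>i\<in>UNIV. s ^ \<alpha> i)"
      proof (intro prod_mono conjI power_mono)
        show "norm (x $ i) \<le> s" for i
          using Finite_Cartesian_Product.norm_nth_le[of x i] x by linarith
      qed auto
      also have "\<dots> = s ^ mdeg \<alpha>" by (simp add: mdeg_def power_sum)
      finally show "norm (f \<alpha> * (\<Prod>i\<in>UNIV. x $ i ^ \<alpha> i)) \<le> norm (f \<alpha>) * s ^ mdeg \<alpha>"
        by (simp add: norm_mult mult_left_mono)
    qed
    also have "\<dots> \<le> c" using c F unfolding weight_le_def by blast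
    finally show "y \<le> c" .
  qed
  with s show "converges_near_0 f" unfolding converges_near_0_def by blast
qed

lemma converges_near_0I:
  assumes "\<And>\<alpha>. norm (f \<alpha>) \<le> C * R ^ mdeg \<alpha>" and "R > 0"
  shows "converges_near_0 f"
  using weight_leI[OF assms] assms(2) unfolding converges_near_0_iff_weight
  by (intro exI conjI) auto

lemma converges_near_0E:
  assumes "converges_near_0 f"
  obtains C R where "C \<ge> 0" "R > 0" "\<And>\<alpha>. norm (f \<alpha>) \<le> C * R ^ mdeg \<alpha>"
proof -
  obtain s c where s: "s > 0" and c: "weight_le s c f"
    using assms converges_near_0_iff_weight by blast
  show ?thesis
    by (rule that[of c "1/s"]) (use s weight_le_nonneg[OF c] weight_leD[OF c s] in auto)
qed

lemma converges_near_0_finite: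
  assumes "finite {\<alpha>. f \<alpha> \<noteq> 0}"
  shows "converges_near_0 f"
proof (rule converges_near_0I)
  fix \<alpha>
  show "norm (f \<alpha>) \<le> (\<Sum>\<alpha>\<in>{\<alpha>. f \<alpha> \<noteq> 0}. norm (f \<alpha>)) * 1 ^ mdeg \<alpha>"
  proof (cases "f \<alpha> = 0")
    case True thus ?thesis by (simp add: sum_nonneg)
  next
    case False thus ?thesis using assms
      by (auto intro!: member_le_sum)
  qed
qed auto

lemma weight_le_mono:
  assumes "weight_le s c f" "0 \<le> t" "t \<le> s"
  shows "weight_le t c f"
  unfolding weight_le_def
proof (intro allI impI)
  fix F :: "('a \<Rightarrow> nat) set" assume F: "finite F"
  have "(\<Sum>\<alpha>\<in>F. norm (f \<alpha>) * t ^ mdeg \<alpha>) \<le> (\<Sum>\<alpha>\<in>F. norm (f \<alpha>) * s ^ mdeg \<alpha>)"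
    using assms by (intro sum_mono mult_left_mono power_mono) auto
  also have "\<dots> \<le> c" using assms F unfolding weight_le_def by blast
  finally show "(\<Sum>\<alpha>\<in>F. norm (f \<alpha>) * t ^ mdeg \<alpha>) \<le> c" .
qed

definition msplits :: "('n::finite \<Rightarrow> nat) \<Rightarrow> (('n \<Rightarrow> nat) \<times> ('n \<Rightarrow> nat)) set" where
  "msplits \<alpha> = {(\<beta>, \<gamma>). (\<lambda>i. \<beta> i + \<gamma> i) = \<alpha>}"

lemma finite_le_fun: "finite {\<beta>. \<forall>i. \<beta> i \<le> (\<alpha> i :: nat)}" for \<alpha> :: "'n::finite \<Rightarrow> nat"
  by (rule finite_subset[OF _ finite_PiE[of UNIV "\<lambda>i. {..\<alpha> i}"]]) auto

lemma finite_msplits [simp]: "finite (msplits \<alpha>)"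
  by (rule finite_subset[OF _ finite_cartesian_product[OF finite_le_fun[of \<alpha>] finite_le_fun[of \<alpha>]]])
     (auto simp: msplits_def)

definition conv_mult ::
    "(('n::finite \<Rightarrow> nat) \<Rightarrow> complex) \<Rightarrow> (('n \<Rightarrow> nat) \<Rightarrow> complex) \<Rightarrow> ('n \<Rightarrow> nat) \<Rightarrow> complex" where
  "conv_mult f g \<alpha> = (\<Sum>(\<beta>, \<gamma>)\<in>msplits \<alpha>. f \<beta> * g \<gamma>)"

lemma weight_le_mult:
  assumes f: "weight_le s c f" and g: "weight_le s d g" and s: "s > 0"
  shows "weight_le s (c * d) (conv_mult f g)"
  unfolding weight_le_def
proof (intro allI impI)
  fix F :: "('a \<Rightarrow> nat) set" assume F: "finite F"
  define P where "P = (\<Union>\<alpha>\<in>F. msplits \<alpha>)"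
  have P: "finite P" using F by (simp add: P_def)
  have "(\<Sum>\<alpha>\<in>F. norm (conv_mult f g \<alpha>) * s ^ mdeg \<alpha>)
      \<le> (\<Sum>\<alpha>\<in>F. \<Sum>(\<beta>, \<gamma>)\<in>msplits \<alpha>. (norm (f \<beta>) * s ^ mdeg \<beta>) * (norm (g \<gamma>) * s ^ mdeg \<gamma>))"
  proof (rule sum_mono)
    fix \<alpha>
    have "norm (conv_mult f g \<alpha>) * s ^ mdeg \<alpha> \<le> (\<Sum>(\<beta>, \<gamma>)\<in>msplits \<alpha>. norm (f \<beta> * g \<gamma>)) * s ^ mdeg \<alpha>"
      unfolding conv_mult_def case_prod_unfold
      using s by (intro mult_right_mono norm_sum) auto
    also have "\<dots> = (\<Sum>(\<beta>, \<gamma>)\<in>msplits \<alpha>. (norm (f \<beta>) * s ^ mdeg \<beta>) * (norm (g \<gamma>) * s ^ mdeg \<gamma>))"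
      unfolding sum_distrib_right case_prod_unfold
      by (rule sum.cong) (auto simp: msplits_def mdeg_add norm_mult power_add)
    finally show "norm (conv_mult f g \<alpha>) * s ^ mdeg \<alpha> \<le> \<dots>" .
  qed
  also have "\<dots> = (\<Sum>(\<beta>, \<gamma>)\<in>P. (norm (f \<beta>) * s ^ mdeg \<beta>) * (norm (g \<gamma>) * s ^ mdeg \<gamma>))"
    unfolding P_def using F
    by (intro sum.UNION_disjoint [symmetric] ballI finite_msplits) (auto simp: msplits_def)
  also have "\<dots> \<le> (\<Sum>(\<beta>, \<gamma>)\<in>fst ` P \<times> snd ` P. (norm (f \<beta>) * s ^ mdeg \<beta>) * (norm (g \<gamma>) * s ^ mdeg \<gamma>))"
    using P s by (intro sum_mono2) (auto simp: image_iff, force+)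
  also have "\<dots> = (\<Sum>\<beta>\<in>fst ` P. norm (f \<beta>) * s ^ mdeg \<beta>) * (\<Sum>\<gamma>\<in>snd ` P. norm (g \<gamma>) * s ^ mdeg \<gamma>)"
    by (simp add: sum_product sum.cartesian_product)
  also have "\<dots> \<le> c * d"
    using f g P s weight_le_nonneg[OF f] unfolding weight_le_def
    by (intro mult_mono) (auto intro!: sum_nonneg)
  finally show "(\<Sum>\<alpha>\<in>F. norm (conv_mult f g \<alpha>) * s ^ mdeg \<alpha>) \<le> c * d" .
qed

lemma converges_near_0_mult:
  assumes "converges_near_0 f" "converges_near_0 g"
  shows "converges_near_0 (conv_mult f g)"
proof -
  obtain s c where s: "s > 0" and c: "weight_le s c f"
    using assms(1) converges_near_0_iff_weight by blast
  obtain t d where t: "t > 0" and d: "weight_le t d g"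
    using assms(2) converges_near_0_iff_weight by blast
  have "weight_le (min s t) (c * d) (conv_mult f g)"
    using s t by (intro weight_le_mult weight_le_mono[OF c] weight_le_mono[OF d]) auto
  moreover have "min s t > 0" using s t by simp
  ultimately show ?thesis unfolding converges_near_0_iff_weight by blast
qed

lemma converges_near_0_add:
  assumes "converges_near_0 f" "converges_near_0 g"
  shows "converges_near_0 (\<lambda>\<alpha>. f \<alpha> + g \<alpha>)"
  using assms unfolding converges_near_0_def
proof (elim exE conjE)
  fix r t assume *: "r > 0" "t > 0" and
    "\<forall>x::complex^'a. norm x < r \<longrightarrow> (\<lambda>\<alpha>. f \<alpha> * (\<Prod>i\<in>UNIV. x $ i ^ \<alpha> i)) summable_on UNIV"
    "\<forall>x::complex^'a. norm x < t \<longrightarrow> (\<lambda>\<alpha>. g \<alpha> * (\<Prod>i\<in>UNIV. x $ i ^ \<alpha> i)) summable_on UNIV"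
  thus "\<exists>r>0. \<forall>x::complex^'a. norm x < r \<longrightarrow>
      (\<lambda>\<alpha>. (f \<alpha> + g \<alpha>) * (\<Prod>i\<in>UNIV. x $ i ^ \<alpha> i)) summable_on UNIV"
    by (intro exI[of _ "min r t"]) (auto simp: ring_distribs intro!: summable_on_add)
qed

lemma converges_near_0_cmult:
  assumes "converges_near_0 f"
  shows "converges_near_0 (\<lambda>\<alpha>. c * f \<alpha>)"
proof -
  obtain C R where "R > 0" "\<And>\<alpha>. norm (f \<alpha>) \<le> C * R ^ mdeg \<alpha>"
    using converges_near_0E[OF assms] by metis
  thus ?thesis
    by (intro converges_near_0I[of _ "norm c * C" R])
       (auto simp: norm_mult mult.assoc intro!: mult_left_mono)
qed

typedef (overloaded) ('n::finite) cps = "{f :: ('n \<Rightarrow> nat) \<Rightarrow> complex. converges_near_0 f}"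
  morphisms coeff Abs_cps
  by (rule exI[of _ "\<lambda>_. 0"]) (auto intro: converges_near_0_finite)

setup_lifting type_definition_cps

lemma converges_coeff: "converges_near_0 (coeff f)"
  using coeff[of f] by simp

lemma cps_eqI: "(\<And>\<alpha>. coeff f \<alpha> = coeff g \<alpha>) \<Longrightarrow> f = g"
  by (metis coeff_inject ext)

lift_definition const_cps :: "complex \<Rightarrow> ('n::finite) cps" is
  "\<lambda>c \<alpha>. if \<alpha> = (\<lambda>_. 0) then c else 0"
  by (rule converges_near_0_finite) (auto intro: finite_subset[of _ "{\<lambda>_. 0}"])

text \<open>The coordinate \<open>b\<^sup>i\<close>.\<close>

lift_definition var_cps :: "'n \<Rightarrow> ('n::finite) cps" is
  "\<lambda>i \<alpha>. if \<alpha> = (\<lambda>j. if j = i then 1 else 0) then 1 else 0"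
  by (rule converges_near_0_finite) (rule finite_subset, auto)

instantiation cps :: (finite) comm_ring_1
begin

lift_definition zero_cps :: "'a cps" is "\<lambda>_. 0"
  by (auto intro: converges_near_0_finite)

lift_definition one_cps :: "'a cps" is "\<lambda>\<alpha>. if \<alpha> = (\<lambda>_. 0) then 1 else 0"
  by (rule converges_near_0_finite) (auto intro: finite_subset[of _ "{\<lambda>_. 0}"])

lift_definition plus_cps :: "'a cps \<Rightarrow> 'a cps \<Rightarrow> 'a cps" is "\<lambda>f g \<alpha>. f \<alpha> + g \<alpha>"
  by (rule converges_near_0_add)

lift_definition uminus_cps :: "'a cps \<Rightarrow> 'a cps" is "\<lambda>f \<alpha>. - f \<alpha>"
  using converges_near_0_cmult[of _ "-1"] by simp

lift_definition minus_cps :: "'a cps \<Rightarrow> 'a cps \<Rightarrow> 'a cps" is "\<lambda>f g \<alpha>. f \<alpha> - g \<alpha>"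
  using converges_near_0_add[OF _ converges_near_0_cmult[of _ "-1"]] by simp

lift_definition times_cps :: "'a cps \<Rightarrow> 'a cps \<Rightarrow> 'a cps" is conv_mult
  by (rule converges_near_0_mult)

instance
proof
  fix f g h :: "'a cps"
  show "f + g + h = f + (g + h)" "f + g = g + f" "0 + f = f" "- f + f = 0" "f - g = f + - g"
    by (transfer; simp add: fun_eq_iff)+
  have "coeff 0 \<noteq> coeff (1 :: 'a cps)"
    by transfer (auto simp: fun_eq_iff)
  thus "(0 :: 'a cps) \<noteq> 1" by auto
  show "(f + g) * h = f * h + g * h"
    by transfer (auto simp: fun_eq_iff conv_mult_def ring_distribs sum.distrib case_prod_unfold)
  show "f * g = g * f"
  proof (transfer, rule ext)
    fix f g :: "('a \<Rightarrow> nat) \<Rightarrow> complex" and \<alpha>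
    show "conv_mult f g \<alpha> = conv_mult g f \<alpha>"
      unfolding conv_mult_def
      by (rule sum.reindex_bij_witness[of _ prod.swap prod.swap]) (auto simp: msplits_def add.commute)
  qed
  show "1 * f = f"
  proof (transfer, rule ext)
    fix f :: "('a \<Rightarrow> nat) \<Rightarrow> complex" and \<alpha>
    have "conv_mult (\<lambda>\<alpha>. if \<alpha> = (\<lambda>_. 0) then 1 else 0) f \<alpha>
        = (\<Sum>(\<beta>, \<gamma>)\<in>{((\<lambda>_. 0) :: 'a \<Rightarrow> nat, \<alpha>)}. f \<gamma>)"
      unfolding conv_mult_def case_prod_unfold
      by (rule sum.mono_neutral_cong_right) (simp, auto simp: msplits_def fun_eq_iff)
    thus "conv_mult (\<lambda>\<alpha>. if \<alpha> = (\<lambda>_. 0) then 1 else 0) f \<alpha> = f \<alpha>" by simp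
  qed
  show "f * g * h = f * (g * h)"
  proof (transfer, rule ext)
    fix f g h :: "('a \<Rightarrow> nat) \<Rightarrow> complex" and \<alpha>
    have "conv_mult (conv_mult f g) h \<alpha> =
        (\<Sum>(p, q)\<in>Sigma (msplits \<alpha>) (\<lambda>p. msplits (fst p)). f (fst q) * g (snd q) * h (snd p))"
      by (simp add: conv_mult_def case_prod_unfold sum_distrib_right sum.Sigma)
    also have "\<dots> = (\<Sum>(p, q)\<in>Sigma (msplits \<alpha>) (\<lambda>p. msplits (snd p)). f (fst p) * (g (fst q) * h (snd q)))"
      by (rule sum.reindex_bij_witness[of _
            "\<lambda>(p, q). ((\<lambda>i. fst p i + fst q i, snd q), (fst p, fst q))"
            "\<lambda>(p, q). ((fst q, \<lambda>i. snd q i + snd p i), (snd q, snd p))"])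
         (auto simp: msplits_def add.assoc mult.assoc)
    also have "\<dots> = conv_mult f (conv_mult g h) \<alpha>"
      by (simp add: conv_mult_def case_prod_unfold sum_distrib_left sum.Sigma)
    finally show "conv_mult (conv_mult f g) h \<alpha> = conv_mult f (conv_mult g h) \<alpha>" .
  qed
qed

end

lift_definition mderiv_cps :: "('n \<Rightarrow> nat) \<Rightarrow> ('n::finite) cps \<Rightarrow> 'n cps" is
  "\<lambda>\<alpha> f \<beta>. (\<Prod>i\<in>UNIV. fact (\<beta> i + \<alpha> i) / fact (\<beta> i)) * f (\<lambda>i. \<beta> i + \<alpha> i)"
proof -
  fix \<alpha> :: "'n \<Rightarrow> nat" and f :: "('n \<Rightarrow> nat) \<Rightarrow> complex"
  assume "converges_near_0 f"
  then obtain C R where C: "C \<ge> 0" and R: "R > 0" and f: "\<And>\<alpha>. norm (f \<alpha>) \<le> C * R ^ mdeg \<alpha>"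
    using converges_near_0E by metis
  show "converges_near_0 (\<lambda>\<beta>. (\<Prod>i\<in>UNIV. fact (\<beta> i + \<alpha> i) / fact (\<beta> i)) * f (\<lambda>i. \<beta> i + \<alpha> i))"
  proof (rule converges_near_0I[of _ "real (mfact \<alpha>) * 2 ^ mdeg \<alpha> * C * R ^ mdeg \<alpha>" "2 * R"])
    fix \<beta> :: "'n \<Rightarrow> nat"
    have "norm (\<Prod>i\<in>UNIV. fact (\<beta> i + \<alpha> i) / fact (\<beta> i) :: complex)
        = (\<Prod>i\<in>UNIV. fact (\<beta> i + \<alpha> i) / fact (\<beta> i) :: real)"
      by (simp add: norm_divide norm_fact flip: prod_norm)
    also have "\<dots> \<le> (\<Prod>i\<in>UNIV. fact (\<alpha> i) * 2 ^ (\<beta> i + \<alpha> i))"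
    proof (intro prod_mono conjI)
      fix i
      have "(fact (\<beta> i + \<alpha> i) / fact (\<beta> i) :: real) = fact (\<alpha> i) * real ((\<beta> i + \<alpha> i) choose \<beta> i)"
        by (simp add: binomial_fact)
      also have "\<dots> \<le> fact (\<alpha> i) * 2 ^ (\<beta> i + \<alpha> i)"
      proof (rule mult_left_mono)
        have "(\<beta> i + \<alpha> i) choose \<beta> i \<le> 2 ^ (\<beta> i + \<alpha> i)" by (rule binomial_le_pow2)
        thus "real ((\<beta> i + \<alpha> i) choose \<beta> i) \<le> 2 ^ (\<beta> i + \<alpha> i)"
          by (metis of_nat_le_iff of_nat_numeral of_nat_power)
      qed simp
      finally show "(fact (\<beta> i + \<alpha> i) / fact (\<beta> i) :: real) \<le> fact (\<alpha> i) * 2 ^ (\<beta> i + \<alpha> i)" .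
    qed simp
    also have "\<dots> = real (mfact \<alpha>) * 2 ^ (mdeg \<beta> + mdeg \<alpha>)"
      by (simp add: prod.distrib mfact_def mdeg_def power_add power_sum)
    finally have 1: "norm (\<Prod>i\<in>UNIV. fact (\<beta> i + \<alpha> i) / fact (\<beta> i) :: complex)
        \<le> real (mfact \<alpha>) * 2 ^ (mdeg \<beta> + mdeg \<alpha>)" .
    have "norm ((\<Prod>i\<in>UNIV. fact (\<beta> i + \<alpha> i) / fact (\<beta> i)) * f (\<lambda>i. \<beta> i + \<alpha> i))
        \<le> (real (mfact \<alpha>) * 2 ^ (mdeg \<beta> + mdeg \<alpha>)) * (C * R ^ (mdeg \<beta> + mdeg \<alpha>))"
      unfolding norm_mult
      by (intro mult_mono 1) (use f[of "\<lambda>i. \<beta> i + \<alpha> i"] in \<open>auto simp: mdeg_add\<close>)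
    also have "\<dots> = real (mfact \<alpha>) * 2 ^ mdeg \<alpha> * C * R ^ mdeg \<alpha> * (2 * R) ^ mdeg \<beta>"
      by (simp add: power_add power_mult_distrib)
    finally show "norm ((\<Prod>i\<in>UNIV. fact (\<beta> i + \<alpha> i) / fact (\<beta> i)) * f (\<lambda>i. \<beta> i + \<alpha> i)) \<le> \<dots>" .
  qed (use R in auto)
qed

definition pderiv_cps :: "'n \<Rightarrow> ('n::finite) cps \<Rightarrow> 'n cps" where
  "pderiv_cps i = mderiv_cps (\<lambda>j. if j = i then 1 else 0)"

lemma coeff_0 [simp]: "coeff 0 \<alpha> = 0"
  by transfer simp

lemma coeff_1: "coeff 1 \<alpha> = (if \<alpha> = (\<lambda>_. 0) then 1 else 0)"
  by transfer simp

lemma coeff_add [simp]: "coeff (f + g) \<alpha> = coeff f \<alpha> + coeff g \<alpha>"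
  by transfer simp

lemma coeff_uminus [simp]: "coeff (- f) \<alpha> = - coeff f \<alpha>"
  by transfer simp

lemma coeff_diff [simp]: "coeff (f - g) \<alpha> = coeff f \<alpha> - coeff g \<alpha>"
  by transfer simp

lemma coeff_mult: "coeff (f * g) \<alpha> = (\<Sum>(\<beta>, \<gamma>)\<in>msplits \<alpha>. coeff f \<beta> * coeff g \<gamma>)"
  by transfer (simp add: conv_mult_def)

lemma coeff_mult_0: "coeff (f * g) (\<lambda>_. 0) = coeff f (\<lambda>_. 0) * coeff g (\<lambda>_. 0)"
proof -
  have "msplits (\<lambda>_::'a. 0) = {(\<lambda>_. 0, \<lambda>_. 0)}"
    by (auto simp: msplits_def fun_eq_iff)
  thus ?thesis by (simp add: coeff_mult)
qed

lemma coeff_const: "coeff (const_cps c) \<alpha> = (if \<alpha> = (\<lambda>_. 0) then c else 0)"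
  by transfer simp

definition ln_coeff :: "('n::finite) cps \<Rightarrow> ('n \<Rightarrow> nat) \<Rightarrow> complex" where
  "ln_coeff f \<alpha> =
     (let c = coeff f (\<lambda>_. 0); u = const_cps (1 / c) * f - 1
      in if \<alpha> = (\<lambda>_. 0) then Ln c
         else (\<Sum>k=1..mdeg \<alpha>. (-1) ^ (k + 1) / of_nat k * coeff (u ^ k) \<alpha>))"

lemma weight_le_const:
  assumes "\<And>\<alpha>. \<alpha> \<noteq> (\<lambda>_. 0) \<Longrightarrow> f \<alpha> = 0" "norm (f (\<lambda>_. 0)) \<le> 1"
  shows "weight_le s 1 f"
  unfolding weight_le_def
proof (intro allI impI)
  fix F :: "('a \<Rightarrow> nat) set" assume F: "finite F"
  have "(\<Sum>\<alpha>\<in>F. norm (f \<alpha>) * s ^ mdeg \<alpha>) = (\<Sum>\<alpha>\<in>F \<inter> {\<lambda>_. 0}. norm (f \<alpha>) * s ^ mdeg \<alpha>)"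
    using F assms(1) by (intro sum.mono_neutral_right) auto
  also have "\<dots> \<le> 1"
    using assms(2) by (cases "(\<lambda>_. 0) \<in> F") (auto simp: mdeg_def)
  finally show "(\<Sum>\<alpha>\<in>F. norm (f \<alpha>) * s ^ mdeg \<alpha>) \<le> 1" .
qed

lemma converges_ln_coeff: "converges_near_0 (ln_coeff f)"
proof -
  define c where "c = coeff f (\<lambda>_. 0)"
  define u where "u = const_cps (1 / c) * f - 1"
  obtain s where s: "s > 0" and u: "weight_le s 1 (coeff u)"
  proof (cases "c = 0")
    case True
    hence "u = - 1" unfolding u_def
      by (intro cps_eqI) (simp add: coeff_mult coeff_const)
    hence "weight_le 1 1 (coeff u)"
      by (intro weight_le_const) (auto simp: coeff_1)
    thus ?thesis using that[of 1] by simp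
  next
    case False
    hence u0: "coeff u (\<lambda>_. 0) = 0"
      by (simp add: u_def coeff_mult_0 coeff_const coeff_1 c_def)
    obtain t d where t: "t > 0" and d: "weight_le t d (coeff u)"
      using converges_coeff[of u] converges_near_0_iff_weight by blast
    have d0: "d \<ge> 0" by (rule weight_le_nonneg[OF d])
    define s where "s = t / (d + 1)"
    have s: "s > 0" using t d0 by (simp add: s_def)
    have st: "s \<le> t" using t d0 by (simp add: s_def field_simps)
    have "weight_le s 1 (coeff u)"
      unfolding weight_le_def
    proof (intro allI impI)
      fix F :: "('a \<Rightarrow> nat) set" assume F: "finite F"
      have "(\<Sum>\<alpha>\<in>F. norm (coeff u \<alpha>) * s ^ mdeg \<alpha>)
          \<le> (\<Sum>\<alpha>\<in>F. (s / t) * (norm (coeff u \<alpha>) * t ^ mdeg \<alpha>))"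
      proof (rule sum_mono)
        fix \<alpha> :: "'a \<Rightarrow> nat"
        show "norm (coeff u \<alpha>) * s ^ mdeg \<alpha> \<le> (s / t) * (norm (coeff u \<alpha>) * t ^ mdeg \<alpha>)"
        proof (cases "mdeg \<alpha>")
          case 0
          hence "\<alpha> = (\<lambda>_. 0)" by (auto simp: mdeg_def fun_eq_iff)
          with u0 show ?thesis by simp
        next
          case (Suc k)
          have "norm (coeff u \<alpha>) * s ^ Suc k \<le> norm (coeff u \<alpha>) * (s * t ^ k)"
            using s st by (auto intro!: mult_left_mono power_mono)
          thus ?thesis using t Suc by (simp add: mult_ac)
        qed
      qed
      also have "\<dots> = (s / t) * (\<Sum>\<alpha>\<in>F. norm (coeff u \<alpha>) * t ^ mdeg \<alpha>)"
        by (simp add: sum_distrib_left)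
      also have "\<dots> \<le> (s / t) * d"
        using d F s t unfolding weight_le_def by (intro mult_left_mono) auto
      also have "\<dots> \<le> 1" using t d0 by (simp add: s_def divide_le_eq)
      finally show "(\<Sum>\<alpha>\<in>F. norm (coeff u \<alpha>) * s ^ mdeg \<alpha>) \<le> 1" .
    qed
    with s show ?thesis by (rule that)
  qed
  have pow: "weight_le s 1 (coeff (u ^ k))" for k
  proof (induction k)
    case 0
    show ?case by (simp, rule weight_le_const) (auto simp: coeff_1)
  next
    case (Suc k)
    from weight_le_mult[OF u Suc s] show ?case by (simp add: times_cps.rep_eq)
  qed
  show ?thesis
  proof (rule converges_near_0I)
    show "2 / s > 0" using s by simp
    fix \<alpha> :: "'a \<Rightarrow> nat"
    show "norm (ln_coeff f \<alpha>) \<le> (norm (Ln c) + 1) * (2 / s) ^ mdeg \<alpha>"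
    proof (cases "\<alpha> = (\<lambda>_. 0)")
      case True
      thus ?thesis by (simp add: ln_coeff_def Let_def c_def mdeg_def)
    next
      case False
      have "norm (ln_coeff f \<alpha>)
          = norm (\<Sum>k=1..mdeg \<alpha>. (-1) ^ (k + 1) / of_nat k * coeff (u ^ k) \<alpha>)"
        using False by (simp add: ln_coeff_def Let_def c_def u_def)
      also have "\<dots> \<le> (\<Sum>k=1..mdeg \<alpha>. (1/s) ^ mdeg \<alpha>)"
      proof (rule sum_norm_le)
        fix k assume k: "k \<in> {1..mdeg \<alpha>}"
        have "norm ((-1) ^ (k + 1) / of_nat k * coeff (u ^ k) \<alpha>) = norm (coeff (u ^ k) \<alpha>) / real k"
          by (simp add: norm_mult norm_divide norm_power)
        also have "\<dots> \<le> norm (coeff (u ^ k) \<alpha>) / 1"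
          using k by (intro divide_left_mono) auto
        also have "\<dots> \<le> (1/s) ^ mdeg \<alpha>"
          using weight_leD[OF pow s, of k \<alpha>] by simp
        finally show "norm ((-1) ^ (k + 1) / of_nat k * coeff (u ^ k) \<alpha>) \<le> (1/s) ^ mdeg \<alpha>" .
      qed
      also have "\<dots> = real (mdeg \<alpha>) * (1/s) ^ mdeg \<alpha>" by simp
      also have "\<dots> \<le> 2 ^ mdeg \<alpha> * (1/s) ^ mdeg \<alpha>"
        using s of_nat_less_two_power[of "mdeg \<alpha>", where ?'a = real]
        by (intro mult_right_mono) auto
      also have "\<dots> = 1 * (2 / s) ^ mdeg \<alpha>" by (simp add: power_divide)
      also have "\<dots> \<le> (norm (Ln c) + 1) * (2 / s) ^ mdeg \<alpha>"
        using s by (intro mult_right_mono) auto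
      finally show ?thesis .
    qed
  qed
qed

text \<open>The logarithm of a series \<open>f\<close> with \<open>c = f(0) \<noteq> 0\<close>, as
  \<open>Ln c + \<Sum>k\<ge>1. (-1)\<^sup>k\<^sup>+\<^sup>1/k \<cdot> (f/c - 1)\<^sup>k\<close>, where only \<open>k \<le> \<bar>\<alpha>\<bar>\<close> contributes to the coefficient
  at \<open>\<alpha> \<noteq> 0\<close>. The other branches differ by a constant.\<close>

definition ln_cps :: "('n::finite) cps \<Rightarrow> 'n cps" where
  "ln_cps f = Abs_cps (ln_coeff f)"

lemma coeff_ln_cps: "coeff (ln_cps f) = ln_coeff f"
  by (simp add: ln_cps_def Abs_cps_inverse converges_ln_coeff)


section \<open>The vertex algebra of convergent chiral differential operators\<close>

text \<open>\<open>Amode i k\<close> and \<open>Bmode i k\<close> stand for the creation operators \<open>a\<^sup>i\<close> and \<open>b\<^sup>i\<close> with index \<open>-(k+1)\<close>.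
  The remaining ones, \<open>b\<^sup>i\<close> with index \<open>0\<close>, act as the coordinates of
  the coefficient ring, so the space is the polynomial ring in the \<open>Amode i k\<close>, \<open>Bmode i k\<close> over \<open>'n cps\<close>.
  The vacuum is \<open>1\<close>.\<close>

datatype 'n mode = Amode 'n nat | Bmode 'n nat

type_synonym 'n cdo = "('n mode \<Rightarrow>\<^sub>0 nat) \<Rightarrow>\<^sub>0 'n cps"

definition mvar :: "'n mode \<Rightarrow> ('n::finite) cdo" where
  "mvar x = Poly_Mapping.single (Poly_Mapping.single x 1) 1"

definition fn :: "('n::finite) cps \<Rightarrow> 'n cdo" where
  "fn f = Poly_Mapping.single 0 f"

definition scl :: "complex \<Rightarrow> ('n::finite) cdo \<Rightarrow> 'n cdo" where
  "scl c v = fn (const_cps c) * v"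

definition dvar :: "'n mode \<Rightarrow> ('n::finite) cdo \<Rightarrow> 'n cdo" where
  "dvar x v = (\<Sum>m\<in>Poly_Mapping.keys v.
     Poly_Mapping.single (m - Poly_Mapping.single x 1)
       (of_nat (Poly_Mapping.lookup m x) * Poly_Mapping.lookup v m))"

text \<open>The Fock representation, with
  \<open>a\<^sup>i(z) = \<Sum>n. a\<^sup>i\<^sub>n z\<^sup>-\<^sup>n\<^sup>-\<^sup>1\<close>, \<open>b\<^sup>i(z) = \<Sum>n. b\<^sup>i\<^sub>n z\<^sup>-\<^sup>n\<close> and \<open>[a\<^sup>i\<^sub>m, b\<^sup>j\<^sub>n] = \<delta>\<^sub>i\<^sub>j \<delta>\<^sub>m\<^sub>+\<^sub>n\<^sub>,\<^sub>0\<close>,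
  which is the OPE \<open>a\<^sup>i(z) b\<^sup>j(w) \<sim> \<delta>\<^sub>i\<^sub>j/(z - w)\<close>.\<close>

definition a_mode :: "'n \<Rightarrow> int \<Rightarrow> ('n::finite) cdo \<Rightarrow> 'n cdo" where
  "a_mode i n v =
     (if n < 0 then mvar (Amode i (nat (- n - 1))) * v
      else if n = 0 then Poly_Mapping.map (pderiv_cps i) v
      else dvar (Bmode i (nat (n - 1))) v)"

definition b_mode :: "'n \<Rightarrow> int \<Rightarrow> ('n::finite) cdo \<Rightarrow> 'n cdo" where
  "b_mode i n v =
     (if n < 0 then mvar (Bmode i (nat (- n - 1))) * v
      else if n = 0 then fn (var_cps i) * v
      else - dvar (Amode i (nat (n - 1))) v)"

text \<open>A field \<open>X(z) = \<Sum>n. X\<^sub>(\<^sub>n\<^sub>) z\<^sup>-\<^sup>n\<^sup>-\<^sup>1\<close> is represented by \<open>n \<mapsto> X\<^sub>(\<^sub>n\<^sub>)\<close>, for generating fields of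
  any conformal weight. The sums below are finite on each vector, which is the case in which
  \<^const>\<open>Sum_any\<close> is the sum.\<close>

type_synonym 'n vfield = "int \<Rightarrow> 'n cdo \<Rightarrow> 'n cdo"

definition a_field :: "'n \<Rightarrow> ('n::finite) vfield" where
  "a_field i n = a_mode i n"

definition b_field :: "'n \<Rightarrow> ('n::finite) vfield" where
  "b_field i n = b_mode i (n + 1)"

definition id_field :: "('n::finite) vfield" where
  "id_field n v = (if n = -1 then v else 0)"

definition deriv_field :: "('n::finite) vfield \<Rightarrow> 'n vfield" where
  "deriv_field X n v = scl (- of_int n) (X (n - 1) v)"

definition scl_field :: "complex \<Rightarrow> ('n::finite) vfield \<Rightarrow> 'n vfield" where
  "scl_field c X n v = scl c (X n v)"

text \<open>The product \<open>X(z) Y(z)\<close>, for fields \<open>X\<close> and \<open>Y\<close> with commuting coefficients.\<close>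

definition mult_field :: "('n::finite) vfield \<Rightarrow> 'n vfield \<Rightarrow> 'n vfield" where
  "mult_field X Y n v = Sum_any (\<lambda>j::int. X j (Y (n - 1 - j) v))"

text \<open>The normally ordered product \<open>X(z)\<^sub>- Y(z) + Y(z) X(z)\<^sub>+\<close>, where \<open>X(z)\<^sub>+\<close> is the part with \<open>n \<ge> 0\<close>.\<close>

definition nop :: "('n::finite) vfield \<Rightarrow> 'n vfield \<Rightarrow> 'n vfield" where
  "nop X Y n v = Sum_any (\<lambda>k::nat. X (- 1 - int k) (Y (n + int k) v) + Y (n - 1 - int k) (X (int k) v))"

text \<open>A list with prescribed multiplicities. It is used to multiply commuting fields only, so the
  choice of the order is immaterial.\<close>

definition list_of :: "('a \<Rightarrow> nat) \<Rightarrow> 'a list" where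
  "list_of c = (SOME xs. \<forall>x. count_list xs x = c x)"

text \<open>\<open>b\<^sup>i(z) - b\<^sup>i\<^sub>0\<close>, its multi-index powers, and \<open>f(b(z))\<close>, i.e.
  \<open>\<Sum>\<alpha>. 1/\<alpha>! \<cdot> \<partial>\<^sup>\<alpha>f(b\<^sub>0) (b(z) - b\<^sub>0)\<^sup>\<alpha>\<close>.\<close>

definition b_shift :: "'n \<Rightarrow> ('n::finite) vfield" where
  "b_shift i n v = (if n = -1 then 0 else b_field i n v)"

definition b_shift_power :: "('n \<Rightarrow> nat) \<Rightarrow> ('n::finite) vfield" where
  "b_shift_power \<alpha> = foldr (\<lambda>i. mult_field (b_shift i)) (list_of \<alpha>) id_field"

definition fn_field :: "('n::finite) cps \<Rightarrow> 'n vfield" where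
  "fn_field f n v =
     Sum_any (\<lambda>\<alpha>. scl (1 / of_nat (mfact \<alpha>)) (fn (mderiv_cps \<alpha> f) * b_shift_power \<alpha> n v))"

text \<open>The state-field correspondence. The field of \<open>Amode i k\<close> is \<open>1/k! \<cdot> \<partial>\<^sup>k a\<^sup>i(z)\<close>, that of \<open>Bmode i k\<close> is
  \<open>1/(k+1)! \<cdot> \<partial>\<^sup>k\<^sup>+\<^sup>1 b\<^sup>i(z)\<close>, and the field of a monomial is the (right nested) normally ordered
  product of the fields of its factors.\<close>

fun mode_field :: "'n mode \<Rightarrow> ('n::finite) vfield" where
  "mode_field (Amode i k) = scl_field (1 / fact k) ((deriv_field ^^ k) (a_field i))"
| "mode_field (Bmode i k) = scl_field (1 / fact (k + 1)) ((deriv_field ^^ (k + 1)) (b_field i))"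

definition monom_field :: "('n mode \<Rightarrow>\<^sub>0 nat) \<Rightarrow> ('n::finite) cps \<Rightarrow> 'n vfield" where
  "monom_field m f =
     foldr (\<lambda>(i, k). nop (mode_field (Amode i k))) (list_of (\<lambda>(i, k). Poly_Mapping.lookup m (Amode i k)))
       (foldr (\<lambda>(i, k). nop (mode_field (Bmode i k))) (list_of (\<lambda>(i, k). Poly_Mapping.lookup m (Bmode i k)))
         (fn_field f))"

definition state_field :: "('n::finite) cdo \<Rightarrow> 'n vfield" where
  "state_field v n w = (\<Sum>m\<in>Poly_Mapping.keys v. monom_field m (Poly_Mapping.lookup v m) n w)"

definition vertex_automorphism :: "(('n::finite) cdo \<Rightarrow> 'n cdo) \<Rightarrow> bool" where
  "vertex_automorphism T \<longleftrightarrow>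
     bij T \<and> (\<forall>u v. T (u + v) = T u + T v) \<and> (\<forall>c v. T (scl c v) = scl c (T v)) \<and>
     T 1 = 1 \<and> (\<forall>u n v. T (state_field u n v) = state_field (T u) n (T v))"

definition virasoro_state :: "('n::finite) cdo" where
  "virasoro_state = (\<Sum>i\<in>UNIV. mvar (Amode i 0) * mvar (Bmode i 0))"

definition virasoro_field :: "('n::finite) vfield" where
  "virasoro_field n v = (\<Sum>i\<in>UNIV. nop (a_field i) (deriv_field (b_field i)) n v)"


section \<open>Coordinate changes\<close>

definition jac :: "('n::finite) cps ^ 'n \<Rightarrow> 'n cps ^ 'n ^ 'n" where
  "jac g = (\<chi> i j. pderiv_cps i (g $ j))"

definition coordinate_change :: "('n::finite) cps ^ 'n \<Rightarrow> bool" where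
  "coordinate_change g \<longleftrightarrow> (\<forall>i. coeff (g $ i) (\<lambda>_. 0) = 0) \<and>
     det (\<chi> i j. coeff (jac g $ i $ j) (\<lambda>_. 0)) \<noteq> 0"

definition phi :: "('n::finite) cps ^ 'n \<Rightarrow> 'n cps ^ 'n ^ 'n" where
  "phi g = transpose (matrix_inv (jac g))"

definition psi :: "('n::finite) cps ^ 'n \<Rightarrow> 'n cps ^ 'n ^ 'n" where
  "psi g = (\<chi> i j. \<Sum>r\<in>UNIV. \<Sum>p\<in>UNIV.
     pderiv_cps r (phi g $ p $ i) * pderiv_cps p (phi g $ r $ j))"

definition hmat :: "('n::finite) cps ^ 'n \<Rightarrow> 'n cps ^ 'n ^ 'n" where
  "hmat g = (\<chi> i j. const_cps (1/2) * (matrix_inv (transpose (phi g)) ** psi g) $ i $ j)"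

text \<open>\<open>T\<close> is the automorphism \<open>(g, h(g))\<close>, prescribed on the states \<open>b\<^sup>i\<^sub>0\<one>\<close> and \<open>a\<^sup>i\<^sub>-\<^sub>1\<one>\<close>.\<close>

definition lifts_coordinate_change ::
    "('n::finite) cps ^ 'n \<Rightarrow> ('n cdo \<Rightarrow> 'n cdo) \<Rightarrow> bool" where
  "lifts_coordinate_change g T \<longleftrightarrow> vertex_automorphism T \<and>
     (\<forall>i. T (fn (var_cps i)) = fn (g $ i)) \<and>
     (\<forall>i. T (mvar (Amode i 0)) =
        (\<Sum>j\<in>UNIV. mvar (Amode j 0) * fn (phi g $ j $ i)) + (\<Sum>k\<in>UNIV. mvar (Bmode k 0) * fn (hmat g $ k $ i)))"

end

theory Submission
  imports Defs
begin

text \<open>An automorphism is determined on \<open>a\<^sup>i\<^sub>-\<^sub>1 b\<^sup>i\<^sub>-\<^sub>1\<one>\<close> by its values on the generators, since this state is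
  obtained from \<open>a\<^sup>i\<^sub>-\<^sub>1\<one>\<close> and \<open>b\<^sup>i\<^sub>0\<one>\<close> by products \<open>u\<^sub>(\<^sub>n\<^sub>)v\<close>. Evaluating these products in the Fock space, the
  image of \<open>\<Sum>a\<^sup>i\<^sub>-\<^sub>1 b\<^sup>i\<^sub>-\<^sub>1\<one>\<close> is this state itself plus a term linear in \<open>b\<^sub>-\<^sub>2\<close> and a term quadratic in \<open>b\<^sub>-\<^sub>1\<close>.
  By Jacobi's formula for the derivative of \<open>det \<partial>g\<close>, the linear term is that of \<open>-\<onehalf>(log det \<partial>g)''\<close>, and
  \<open>h(g)\<close> is exactly what makes the quadratic terms agree.

  To pass from states to fields one needs the chain rule
  \<open>f(b(z))' = \<Sum>b\<^sup>k(z)' (\<partial>\<^sub>kf)(b(z))\<close>, which is proved by differentiating the Taylor sums of \<open>f\<close>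
  in a commutative differential ring of fields containing all \<open>b\<^sup>i(z)\<close> and \<open>f(b(z))\<close>.\<close>


section \<open>Derivations and determinants\<close>

text \<open>The obstacle is that \<open>fn_field f\<close> is an infinite sum, finite only on each
  vector, so it cannot be differentiated or added like a finite sum. A filtration of the Fock space,
  combined with the order in z, gives the fields built from b(z) a notion of approximation: a field
  of arbitrarily high order is 0, and Taylor polynomials approximate \<open>fn_field f\<close> to
  any order. Commutativity of these fields needs no computation, because their coefficients lie in
  the bicommutant of a commuting set of operators. The correction terms come from contractions. In
  the normally ordered product of a^j(z) and \<phi>(b(z)), applied to the image of b^i_{-1}, the
  mode a^j_1 removes a variable b^j_{-1} and leaves the coefficient of z^2 in \<phi>(b(z)), which
  contains half of a second derivative. The mode a^j_0 differentiates the coefficients \<partial>g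
  and yields a quadratic term P where only P/2 is wanted; h(g) contributes the missing -P/2.\<close>

locale derivation = additive D for D :: "'a::comm_ring_1 \<Rightarrow> 'a" +
  assumes mult: "D (x * y) = D x * y + x * D y"
begin

lemma one [simp]: "D 1 = 0"
  using mult[of 1 1] by simp

lemma power: "D (x ^ k) = of_nat k * x ^ (k - 1) * D x"
proof (induction k)
  case (Suc k)
  thus ?case by (cases k) (simp_all add: mult algebra_simps)
qed (simp add: zero)

lemma prod:
  "finite I \<Longrightarrow> D (prod f I) = (\<Sum>k\<in>I. D (f k) * prod f (I - {k}))"
proof (induction I rule: finite_induct)
  case (insert a I)
  have "insert a I - {k} = insert a (I - {k})" if "k \<in> I" for k
    using that insert by auto
  hence "(\<Sum>k\<in>I. D (f k) * prod f (insert a I - {k})) = f a * (\<Sum>k\<in>I. D (f k) * prod f (I - {k}))"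
    using insert by (auto simp: sum_distrib_left intro!: sum.cong)
  moreover have "insert a I - {a} = I" using insert by auto
  ultimately show ?case using insert by (simp add: mult)
qed (simp_all add: zero)

lemma of_int [simp]: "D (of_int k) = 0"
proof -
  have "D (of_nat m) = 0" for m by (induction m) (simp_all add: add zero)
  thus ?thesis by (cases k rule: int_cases2) (simp_all add: minus)
qed

text \<open>Each product in the permutation expansion has exactly one factor from row k. The Leibniz
  rule therefore yields one term per row, and collecting by rows gives determinants with a single
  differentiated row.\<close>

lemma det:
  fixes A :: "'a^'n^'n"
  shows "D (det A) = (\<Sum>k\<in>UNIV. det (\<chi> i. if i = k then (\<chi> j. D (A $ k $ j)) else A $ i))"
proof -
  have "(\<Prod>i\<in>UNIV. (if i = k then (\<chi> j. D (A $ k $ j)) else A $ i) $ p i)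
      = D (A $ k $ p k) * (\<Prod>i\<in>UNIV - {k}. A $ i $ p i)" for p :: "'n \<Rightarrow> 'n" and k
    by (subst prod.remove[of _ k]) (auto intro!: prod.cong)
  hence "(\<Sum>k\<in>UNIV. det (\<chi> i. if i = k then (\<chi> j. D (A $ k $ j)) else A $ i))
     = (\<Sum>k\<in>UNIV. \<Sum>p | p permutes UNIV. of_int (sign p) * (D (A $ k $ p k) * (\<Prod>i\<in>UNIV - {k}. A $ i $ p i)))"
    by (simp add: det_def)
  also have "\<dots> = (\<Sum>p | p permutes UNIV. \<Sum>k\<in>UNIV. of_int (sign p) * (D (A $ k $ p k) * (\<Prod>i\<in>UNIV - {k}. A $ i $ p i)))"
    by (rule sum.swap)
  also have "\<dots> = D (det A)"
    by (simp add: det_def sum mult prod sum_distrib_left)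
  finally show ?thesis ..
qed

end

text \<open>By linearity in row k, every row other than row k contributes a determinant with two
  equal rows. This serves both Jacobi's formula and Cramer's rule below.\<close>

lemma det_row_combination:
  fixes A :: "'a::comm_ring_1^'n^'n"
  shows "det (\<chi> i. if i = k then (\<Sum>l\<in>UNIV. c l *s A $ l) else A $ i) = c k * det A"
proof -
  have "det (\<chi> i. if i = k then A $ l else A $ i) = (if l = k then det A else 0)" for l
  proof (cases "l = k")
    case True
    hence "(\<chi> i. if i = k then A $ l else A $ i) = A" by (simp add: vec_eq_iff)
    with True show ?thesis by simp
  next
    case False
    thus ?thesis by (auto intro!: det_identical_rows[of k l] simp: row_def)
  qed
  thus ?thesis
    by (simp add: det_linear_row_sum det_row_mul if_distrib[of "\<lambda>x. _ * x"] cong: if_cong)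
qed

text \<open>Jacobi's formula. A left inverse B expands each differentiated row in the rows of A,
  since D(A) = D(A) B A; by \<open>det_row_combination\<close> only the diagonal entries of D(A) B
  survive.\<close>

lemma (in derivation) det_log:
  fixes A B :: "'a^'n^'n"
  assumes "B ** A = mat 1"
  shows "D (det A) = det A * (\<Sum>k\<in>UNIV. \<Sum>j\<in>UNIV. D (A $ k $ j) * B $ j $ k)"
proof -
  have rows: "(\<chi> j. D (A $ k $ j)) = (\<Sum>l\<in>UNIV. (\<Sum>j\<in>UNIV. D (A $ k $ j) * B $ j $ l) *s A $ l)" for k
  proof (subst vec_eq_iff, intro allI)
    fix m
    have "(\<Sum>l\<in>UNIV. (\<Sum>j\<in>UNIV. D (A $ k $ j) * B $ j $ l) *s A $ l) $ m
       = (\<Sum>l\<in>UNIV. \<Sum>j\<in>UNIV. D (A $ k $ j) * (B $ j $ l * A $ l $ m))"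
      by (simp add: sum_distrib_right mult.assoc)
    also have "\<dots> = (\<Sum>j\<in>UNIV. D (A $ k $ j) * (B ** A) $ j $ m)"
      by (subst sum.swap) (simp add: matrix_matrix_mult_def sum_distrib_left)
    also have "\<dots> = D (A $ k $ m)"
      by (simp add: assms mat_def if_distrib[of "\<lambda>x. _ * x"] cong: if_cong)
    finally show "(\<chi> j. D (A $ k $ j)) $ m = (\<Sum>l\<in>UNIV. (\<Sum>j\<in>UNIV. D (A $ k $ j) * B $ j $ l) *s A $ l) $ m" by simp
  qed
  show ?thesis
    by (simp only: det rows det_row_combination) (simp add: sum_distrib_left mult.commute)
qed

lemma right_inverse_of_det_unit:
  fixes A :: "'a::comm_ring_1^'n^'n"
  assumes "det A * u = 1"
  shows "\<exists>B. A ** B = mat 1"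
proof
  \<comment> \<open>\<open>C j k\<close> is the cofactor at (j, k). Expanding along row j with the
    entries of row l gives a determinant with row j replaced by row l, hence \<open>det A\<close> or
    0.\<close>
  define C where "C = (\<lambda>j k. det (\<chi> i. if i = j then axis k 1 else A $ i))"
  have "(\<Sum>k\<in>UNIV. A $ l $ k * C j k) = (if l = j then det A else 0)" for l j
  proof -
    have "(\<Sum>k\<in>UNIV. A $ l $ k * C j k) = det (\<chi> i. if i = j then (\<Sum>k\<in>UNIV. A $ l $ k *s axis k 1) else A $ i)"
      by (simp add: C_def det_linear_row_sum det_row_mul cong: if_cong)
    also have "(\<Sum>k\<in>UNIV. A $ l $ k *s axis k 1) = (\<Sum>m\<in>UNIV. (if m = l then 1 else 0) *s A $ m)"
      by (simp add: vec_eq_iff axis_def if_distrib[of "\<lambda>x. _ * x"] if_distrib[of "\<lambda>x. x * _"] cong: if_cong)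
    finally show ?thesis by (simp only: det_row_combination) auto
  qed
  thus "A ** (\<chi> k j. u * C j k) = mat 1"
    using assms
    by (auto simp: vec_eq_iff matrix_matrix_mult_def mat_def mult.left_commute mult.commute simp flip: sum_distrib_left)
qed

text \<open>Applied to the transpose, Cramer's rule also gives a left inverse, and a left and a
  right inverse coincide.\<close>

lemma invertible_of_det_unit:
  fixes A :: "'a::comm_ring_1^'n^'n"
  assumes "det A * u = 1"
  shows "invertible A"
proof -
  obtain B C where "A ** B = mat 1" "transpose A ** C = mat 1"
    using right_inverse_of_det_unit[OF assms] right_inverse_of_det_unit[of "transpose A" u] assms
    by auto
  hence "A ** B = mat 1" "transpose C ** A = mat 1"
    by (simp, metis matrix_transpose_mul transpose_mat transpose_transpose)
  thus ?thesis
    unfolding invertible_def by (metis matrix_mul_assoc matrix_mul_lid matrix_mul_rid)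
qed

lemma matrix_inv_both:
  assumes "invertible A"
  shows "A ** matrix_inv A = mat 1 \<and> matrix_inv A ** A = mat 1"
  using assms unfolding invertible_def matrix_inv_def by (rule someI_ex)


section \<open>Calculus of convergent power series\<close>

lemma coeff_mderiv:
  "coeff (mderiv_cps \<alpha> f) \<beta> = (\<Prod>i\<in>UNIV. fact (\<beta> i + \<alpha> i) / fact (\<beta> i)) * coeff f (\<lambda>i. \<beta> i + \<alpha> i)"
  by transfer simp

lemma coeff_pderiv: "coeff (pderiv_cps i f) \<alpha> = of_nat (Suc (\<alpha> i)) * coeff f (\<alpha>(i := Suc (\<alpha> i)))"
proof -
  have "(\<Prod>j\<in>UNIV. fact (\<alpha> j + (if j = i then 1 else 0)) / fact (\<alpha> j) :: complex)
      = (\<Prod>j\<in>UNIV. if j = i then of_nat (Suc (\<alpha> j)) else 1)"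
    by (rule prod.cong) (auto simp: field_simps)
  moreover have "(\<lambda>j. \<alpha> j + (if j = i then 1 else 0)) = \<alpha>(i := Suc (\<alpha> i))"
    by auto
  ultimately show ?thesis by (simp add: pderiv_cps_def coeff_mderiv)
qed

lemma mderiv_0: "mderiv_cps (\<lambda>_. 0) f = f"
  by (rule cps_eqI) (simp add: coeff_mderiv)

lemma mderiv_Suc: "mderiv_cps (\<alpha>(i := Suc (\<alpha> i))) f = mderiv_cps \<alpha> (pderiv_cps i f)"
proof (rule cps_eqI)
  fix \<beta>
  have "(\<Prod>j\<in>UNIV. fact (\<beta> j + (\<alpha>(i := Suc (\<alpha> i))) j) / fact (\<beta> j) :: complex)
      = (\<Prod>j\<in>UNIV. (if j = i then of_nat (Suc (\<beta> j + \<alpha> j)) else 1) * (fact (\<beta> j + \<alpha> j) / fact (\<beta> j)))"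
    by (rule prod.cong) (auto simp: field_simps)
  moreover have "(\<lambda>j. \<beta> j + (\<alpha>(i := Suc (\<alpha> i))) j) = (\<lambda>j. \<beta> j + \<alpha> j)(i := Suc (\<beta> i + \<alpha> i))"
    by auto
  ultimately show "coeff (mderiv_cps (\<alpha>(i := Suc (\<alpha> i))) f) \<beta> = coeff (mderiv_cps \<alpha> (pderiv_cps i f)) \<beta>"
    by (simp only: coeff_mderiv coeff_pderiv prod.distrib) simp
qed

lemma mderiv_add: "mderiv_cps \<alpha> (f + g) = mderiv_cps \<alpha> f + mderiv_cps \<alpha> g"
  by (rule cps_eqI) (simp add: coeff_mderiv algebra_simps)

lemma mderiv_1: "\<alpha> \<noteq> (\<lambda>_. 0) \<Longrightarrow> mderiv_cps \<alpha> 1 = 0"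
  by (rule cps_eqI) (auto simp: coeff_mderiv coeff_1 fun_eq_iff)

lemma pderiv_var: "pderiv_cps k (var_cps i) = (if k = i then 1 else 0)"
proof (rule cps_eqI)
  fix \<alpha> :: "'a \<Rightarrow> nat"
  have "\<alpha>(k := Suc (\<alpha> k)) = (\<lambda>j. if j = i then 1 else 0) \<longleftrightarrow> k = i \<and> \<alpha> = (\<lambda>_. 0)"
    by (auto simp: fun_eq_iff split: if_splits)
  moreover have "coeff (var_cps i) \<beta> = (if \<beta> = (\<lambda>j. if j = i then 1 else 0) then 1 else 0)" for \<beta>
    by transfer simp
  ultimately show "coeff (pderiv_cps k (var_cps i)) \<alpha> = coeff (if k = i then 1 else 0) \<alpha>"
    by (auto simp: coeff_pderiv coeff_1)
qed

lemma pderiv_commute: "pderiv_cps i (pderiv_cps j f) = pderiv_cps j (pderiv_cps i f)"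
  by (cases "i = j") (auto intro!: cps_eqI simp: coeff_pderiv fun_upd_twist)

lemma sum_msplits_swap: "(\<Sum>(\<beta>, \<gamma>)\<in>msplits \<alpha>. h \<beta> \<gamma>) = (\<Sum>(\<beta>, \<gamma>)\<in>msplits \<alpha>. h \<gamma> \<beta>)"
  by (rule sum.reindex_bij_witness[of _ prod.swap prod.swap]) (auto simp: msplits_def add.commute)

text \<open>The factor \<open>of_nat (\<beta> i)\<close> removes the splittings with
  \<open>\<beta> i = 0\<close>; the others arise from splittings of \<alpha> by raising the first
  component at i. This gives one half of the Leibniz rule, and the swapped version gives the
  other.\<close>

lemma sum_msplits_Suc:
  fixes h :: "('n::finite \<Rightarrow> nat) \<Rightarrow> ('n \<Rightarrow> nat) \<Rightarrow> 'a::semiring_1"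
  shows "(\<Sum>(\<beta>, \<gamma>)\<in>msplits (\<alpha>(i := Suc (\<alpha> i))). of_nat (\<beta> i) * h \<beta> \<gamma>)
    = (\<Sum>(\<beta>, \<gamma>)\<in>msplits \<alpha>. of_nat (Suc (\<beta> i)) * h (\<beta>(i := Suc (\<beta> i))) \<gamma>)"
proof -
  have "(\<Sum>(\<beta>, \<gamma>)\<in>msplits (\<alpha>(i := Suc (\<alpha> i))). of_nat (\<beta> i) * h \<beta> \<gamma>)
     = (\<Sum>(\<beta>, \<gamma>)\<in>{(\<beta>, \<gamma>)\<in>msplits (\<alpha>(i := Suc (\<alpha> i))). \<beta> i \<noteq> 0}. of_nat (\<beta> i) * h \<beta> \<gamma>)"
    by (rule sum.mono_neutral_right) (auto intro!: gr0I)
  also have "\<dots> = (\<Sum>(\<beta>, \<gamma>)\<in>msplits \<alpha>. of_nat (Suc (\<beta> i)) * h (\<beta>(i := Suc (\<beta> i))) \<gamma>)"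
    by (rule sum.reindex_bij_witness[of _ "\<lambda>(\<beta>, \<gamma>). (\<beta>(i := Suc (\<beta> i)), \<gamma>)" "\<lambda>(\<beta>, \<gamma>). (\<beta>(i := \<beta> i - 1), \<gamma>)"])
       (auto simp: msplits_def fun_eq_iff simp del: of_nat_Suc split: if_splits)
  finally show ?thesis .
qed

lemma pderiv_mult: "pderiv_cps i (f * g) = pderiv_cps i f * g + f * pderiv_cps i g"
proof (rule cps_eqI)
  fix \<alpha> :: "'a \<Rightarrow> nat"
  let ?\<alpha> = "\<alpha>(i := Suc (\<alpha> i))"
  \<comment> \<open>The factor \<open>Suc (\<alpha> i)\<close> produced by the derivative is
    \<beta>_i + \<gamma>_i for every splitting, so the sum divides into two.\<close>
  have "coeff (pderiv_cps i (f * g)) \<alpha>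
      = (\<Sum>(\<beta>, \<gamma>)\<in>msplits ?\<alpha>. of_nat (\<beta> i) * (coeff f \<beta> * coeff g \<gamma>))
        + (\<Sum>(\<beta>, \<gamma>)\<in>msplits ?\<alpha>. of_nat (\<gamma> i) * (coeff f \<beta> * coeff g \<gamma>))"
    unfolding coeff_pderiv coeff_mult sum_distrib_left sum.distrib [symmetric] case_prod_unfold
  proof (rule sum.cong, goal_cases)
    case (2 p)
    hence "fst p i + snd p i = Suc (\<alpha> i)" by (auto simp: msplits_def dest: fun_cong[of _ _ i])
    thus ?case by (metis distrib_right of_nat_add)
  qed simp
  also have "(\<Sum>(\<beta>, \<gamma>)\<in>msplits ?\<alpha>. of_nat (\<gamma> i) * (coeff f \<beta> * coeff g \<gamma>))
      = (\<Sum>(\<beta>, \<gamma>)\<in>msplits ?\<alpha>. of_nat (\<beta> i) * (coeff f \<gamma> * coeff g \<beta>))"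
    by (rule sum_msplits_swap)
  also have "\<dots> = (\<Sum>(\<beta>, \<gamma>)\<in>msplits \<alpha>. of_nat (Suc (\<beta> i)) * (coeff f \<gamma> * coeff g (\<beta>(i := Suc (\<beta> i)))))"
    by (rule sum_msplits_Suc)
  also have "\<dots> = (\<Sum>(\<beta>, \<gamma>)\<in>msplits \<alpha>. of_nat (Suc (\<gamma> i)) * (coeff f \<beta> * coeff g (\<gamma>(i := Suc (\<gamma> i)))))"
    by (rule sum_msplits_swap)
  also have "(\<Sum>(\<beta>, \<gamma>)\<in>msplits ?\<alpha>. of_nat (\<beta> i) * (coeff f \<beta> * coeff g \<gamma>))
      = (\<Sum>(\<beta>, \<gamma>)\<in>msplits \<alpha>. of_nat (Suc (\<beta> i)) * (coeff f (\<beta>(i := Suc (\<beta> i))) * coeff g \<gamma>))"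
    by (rule sum_msplits_Suc)
  finally show "coeff (pderiv_cps i (f * g)) \<alpha> = coeff (pderiv_cps i f * g + f * pderiv_cps i g) \<alpha>"
    by (simp only: coeff_add coeff_mult coeff_pderiv) (simp only: mult_ac)
qed

interpretation pderiv: derivation "pderiv_cps i"
  by unfold_locales (auto intro: cps_eqI simp: coeff_pderiv algebra_simps pderiv_mult)

lemma coeff_const_mult: "coeff (const_cps c * f) \<alpha> = c * coeff f \<alpha>"
proof -
  have "coeff (const_cps c * f) \<alpha> = (\<Sum>(\<beta>, \<gamma>)\<in>{(\<lambda>_::'a. 0 :: nat, \<alpha>)}. c * coeff f \<gamma>)"
    unfolding coeff_mult case_prod_unfold
    by (rule sum.mono_neutral_cong_right) (simp, auto simp: msplits_def fun_eq_iff coeff_const)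
  thus ?thesis by simp
qed

lemma const_cps_add: "const_cps (c + d) = const_cps c + const_cps d"
  by (rule cps_eqI) (simp add: coeff_const)

lemma const_cps_mult: "const_cps (c * d) = const_cps c * const_cps d"
  by (rule cps_eqI) (simp add: coeff_const_mult, simp add: coeff_const)

lemma const_cps_1: "const_cps 1 = 1"
  by (rule cps_eqI) (simp add: coeff_const coeff_1)

lemma const_cps_0: "const_cps 0 = 0"
  by (rule cps_eqI) (simp add: coeff_const)

lemma const_cps_uminus: "const_cps (- c) = - const_cps c"
  by (rule cps_eqI) (simp add: coeff_const)

lemma const_cps_of_nat: "const_cps (of_nat k) = of_nat k"
  by (induction k) (simp_all add: const_cps_add const_cps_1 const_cps_0)

lemma pderiv_const [simp]: "pderiv_cps i (const_cps c) = 0"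
  by (rule cps_eqI) (auto simp: coeff_pderiv coeff_const fun_eq_iff)

section \<open>Power series without constant term, units and the logarithm\<close>

lemma coeff_sum: "coeff (sum f A) \<alpha> = (\<Sum>x\<in>A. coeff (f x) \<alpha>)"
  by (induction A rule: infinite_finite_induct) auto

text \<open>Allows an infinite series to be replaced by a partial sum when a single coefficient of a
  product is compared.\<close>

lemma coeff_mult_cong:
  assumes "\<And>\<beta>. mdeg \<beta> \<le> mdeg \<alpha> \<Longrightarrow> coeff f \<beta> = coeff g \<beta>"
  shows "coeff (f * h) \<alpha> = coeff (g * h) \<alpha>"
  unfolding coeff_mult using assms
  by (intro sum.cong) (auto simp: msplits_def mdeg_add)

lemma mdeg_eq_0_iff: "mdeg \<alpha> = 0 \<longleftrightarrow> \<alpha> = (\<lambda>_. 0)"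
  by (simp add: mdeg_def fun_eq_iff)

lemma coeff_power_eq_0:
  assumes "coeff u (\<lambda>_. 0) = 0" "mdeg \<alpha> < k"
  shows "coeff (u ^ k) \<alpha> = 0"
  using assms(2)
proof (induction k arbitrary: \<alpha>)
  case (Suc k)
  have "coeff u \<beta> * coeff (u ^ k) \<gamma> = 0" if "(\<lambda>i. \<beta> i + \<gamma> i) = \<alpha>" for \<beta> \<gamma>
  proof (cases "\<beta> = (\<lambda>_. 0)")
    case False
    hence "mdeg \<beta> > 0" by (metis mdeg_eq_0_iff gr0I)
    with that Suc.prems have "mdeg \<gamma> < k" by (auto simp: mdeg_add)
    thus ?thesis by (simp add: Suc.IH)
  qed (simp add: assms)
  thus ?case by (auto simp: coeff_mult msplits_def intro!: sum.neutral)
qed simp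

lemma weight_le_power:
  assumes "weight_le s 1 (coeff u)" "s > 0"
  shows "weight_le s 1 (coeff (u ^ k))"
proof (induction k)
  case 0
  show ?case by (simp, rule weight_le_const) (auto simp: coeff_1)
next
  case (Suc k)
  from weight_le_mult[OF assms(1) Suc assms(2)] show ?case by (simp add: times_cps.rep_eq)
qed

text \<open>Shrinking the radius multiplies a coefficient by at least one power of the shrinking
  factor, because u has no constant term. Weight 1 then bounds all powers of u uniformly.\<close>

lemma ex_weight_le_1:
  assumes u: "coeff (u :: ('n::finite) cps) (\<lambda>_. 0) = 0"
  shows "\<exists>s>0. weight_le s 1 (coeff u)"
proof -
  obtain C R where C: "C \<ge> 0" and R: "R > 0" and b: "\<And>\<alpha>. norm (coeff u \<alpha>) \<le> C * R ^ mdeg \<alpha>"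
    using converges_near_0E[OF converges_coeff] by metis
  \<comment> \<open>The factor \<open>2 ^ CARD('n)\<close> compensates the one lost in
    \<open>weight_leI\<close>. Since K is at least 1, one power of K also dominates C in every
    positive degree.\<close>
  define K :: real where "K = 2 ^ CARD('n) * (C + 1)"
  have K: "K > 0" using C by (simp add: K_def)
  have K1: "K \<ge> 1"
    using mult_mono[of 1 "2 ^ CARD('n)" 1 "C + 1"] C by (simp add: K_def)
  have "norm (coeff u \<alpha>) \<le> 1 / 2 ^ CARD('n) * (K * R) ^ mdeg \<alpha>" for \<alpha>
  proof (cases "mdeg \<alpha>")
    case 0
    hence "\<alpha> = (\<lambda>_. 0)" by (simp add: mdeg_eq_0_iff)
    with u show ?thesis using K R by simp
  next
    case (Suc m)
    have "C \<le> K / 2 ^ CARD('n)" by (simp add: K_def)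
    also have "\<dots> \<le> K ^ mdeg \<alpha> / 2 ^ CARD('n)"
      using K1 Suc by (intro divide_right_mono) (auto intro: self_le_power)
    finally have "C * R ^ mdeg \<alpha> \<le> K ^ mdeg \<alpha> / 2 ^ CARD('n) * R ^ mdeg \<alpha>"
      using R by (intro mult_right_mono) auto
    with b[of \<alpha>] show ?thesis by (simp add: power_mult_distrib)
  qed
  from weight_leI[OF this] K R have "weight_le (1 / (2 * (K * R))) 1 (coeff u)" by simp
  moreover have "1 / (2 * (K * R)) > 0" using K R by simp
  ultimately show ?thesis by blast
qed

text \<open>The inverse is the geometric series. At \<alpha> only the powers up to
  \<open>mdeg \<alpha>\<close> contribute, so the coefficients are finite sums, and the telescoping
  remainder has too high a degree to be seen.\<close>

lemma one_minus_unit: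
  fixes u :: "('n::finite) cps"
  assumes u: "coeff u (\<lambda>_. 0) = 0"
  shows "\<exists>h. (1 - u) * h = 1"
proof -
  define c where "c = (\<lambda>\<alpha>. \<Sum>k\<le>mdeg \<alpha>. coeff (u ^ k) \<alpha>)"
  obtain s where s: "s > 0" "weight_le s 1 (coeff u)" using ex_weight_le_1[OF u] by blast
  have "converges_near_0 c"
  proof (rule converges_near_0I)
    show "2 / s > 0" using s by simp
    fix \<alpha>
    have "norm (c \<alpha>) \<le> (\<Sum>k\<le>mdeg \<alpha>. (1/s) ^ mdeg \<alpha>)"
      unfolding c_def
      using weight_leD[OF weight_le_power[OF s(2,1)] s(1)] by (intro sum_norm_le) auto
    also have "\<dots> = real (Suc (mdeg \<alpha>)) * (1/s) ^ mdeg \<alpha>" by simp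
    \<comment> \<open>The number of summands grows with the degree; halving the radius absorbs
      it.\<close>
    also have "\<dots> \<le> 2 ^ mdeg \<alpha> * (1/s) ^ mdeg \<alpha>"
    proof (rule mult_right_mono)
      have "Suc (mdeg \<alpha>) \<le> 2 ^ mdeg \<alpha>" by (simp add: Suc_leI)
      thus "real (Suc (mdeg \<alpha>)) \<le> 2 ^ mdeg \<alpha>" by (metis of_nat_le_iff of_nat_numeral of_nat_power)
    qed (use s in simp)
    finally show "norm (c \<alpha>) \<le> 1 * (2 / s) ^ mdeg \<alpha>" by (simp add: power_divide)
  qed
  hence h: "coeff (Abs_cps c) = c" by (simp add: Abs_cps_inverse)
  have "(1 - u) * Abs_cps c = 1"
  proof (rule cps_eqI)
    fix \<alpha> :: "'n \<Rightarrow> nat"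
    have "coeff (Abs_cps c * (1 - u)) \<alpha> = coeff ((\<Sum>k\<le>mdeg \<alpha>. u ^ k) * (1 - u)) \<alpha>"
    proof (rule coeff_mult_cong)
      fix \<beta> :: "'n \<Rightarrow> nat" assume "mdeg \<beta> \<le> mdeg \<alpha>"
      thus "coeff (Abs_cps c) \<beta> = coeff (\<Sum>k\<le>mdeg \<alpha>. u ^ k) \<beta>"
        unfolding h coeff_sum unfolding c_def
        by (intro sum.mono_neutral_left) (auto intro!: coeff_power_eq_0[OF u])
    qed
    also have "(\<Sum>k\<le>mdeg \<alpha>. u ^ k) * (1 - u) = 1 - u ^ Suc (mdeg \<alpha>)"
      using one_diff_power_eq[of u "Suc (mdeg \<alpha>)"] by (simp add: lessThan_Suc_atMost mult.commute)
    also have "coeff \<dots> \<alpha> = coeff 1 \<alpha>" 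
      using coeff_power_eq_0[OF u, of \<alpha> "Suc (mdeg \<alpha>)"] by (simp del: power_Suc)
    finally show "coeff ((1 - u) * Abs_cps c) \<alpha> = coeff 1 \<alpha>" by (simp add: mult.commute)
  qed
  thus ?thesis by blast
qed

lemma cps_unit:
  assumes f: "coeff f (\<lambda>_. 0) \<noteq> 0"
  shows "\<exists>h. f * h = 1"
proof -
  define c where "c = coeff f (\<lambda>_. 0)"
  have "coeff (1 - const_cps (1 / c) * f) (\<lambda>_. 0) = 0"
    using f by (simp add: c_def coeff_const_mult coeff_1)
  then obtain h where "const_cps (1 / c) * f * h = 1"
    using one_minus_unit by fastforce
  hence "f * (const_cps (1 / c) * h) = 1" by (simp add: mult_ac)
  thus ?thesis by blast
qed

text \<open>With f = c(1 + u), the derivative of the logarithmic series is the geometric series in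
  -u times the derivative of u, and multiplying by 1 + u telescopes.\<close>

lemma pderiv_ln:
  fixes f :: "('n::finite) cps"
  assumes f: "coeff f (\<lambda>_. 0) \<noteq> 0"
  shows "pderiv_cps i (ln_cps f) * f = pderiv_cps i f"
proof -
  define c where "c = coeff f (\<lambda>_. 0)"
  define u where "u = const_cps (1 / c) * f - 1"
  have c: "c \<noteq> 0" using f by (simp add: c_def)
  have u0: "coeff u (\<lambda>_. 0) = 0" using c by (simp add: u_def coeff_const_mult coeff_1 c_def)
  have fu: "f = const_cps c * (1 + u)"
    using c by (simp add: u_def mult.assoc [symmetric] const_cps_mult [symmetric] const_cps_1)
  \<comment> \<open>N may be any bound on the degree, because higher powers of u vanish at this
    coefficient. Hence one N serves all \<beta> that enter a coefficient of the product
    below.\<close>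
  have ln: "coeff (pderiv_cps i (ln_cps f)) \<beta> = coeff ((\<Sum>k\<le>N. (- u) ^ k) * pderiv_cps i u) \<beta>"
    if N: "mdeg \<beta> \<le> N" for \<beta> N
  proof -
    let ?\<beta> = "\<beta>(i := Suc (\<beta> i))"
    have md: "mdeg ?\<beta> = Suc (mdeg \<beta>)"
      unfolding mdeg_def by (subst (1 2) sum.remove[of _ i]) auto
    have "?\<beta> \<noteq> (\<lambda>_. 0)" by (metis fun_upd_same nat.distinct(1))
    hence "ln_coeff f ?\<beta> = (\<Sum>k=1..mdeg ?\<beta>. (-1) ^ (k + 1) / of_nat k * coeff (u ^ k) ?\<beta>)"
      unfolding ln_coeff_def Let_def u_def c_def by (rule if_not_P)
    hence "coeff (pderiv_cps i (ln_cps f)) \<beta>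
        = (\<Sum>k=1..Suc (mdeg \<beta>). (-1) ^ (k + 1) / of_nat k * (of_nat (Suc (\<beta> i)) * coeff (u ^ k) ?\<beta>))"
      by (simp only: coeff_pderiv coeff_ln_cps md sum_distrib_left mult_ac)
    also have "\<dots> = (\<Sum>k=1..Suc N. (-1) ^ (k + 1) / of_nat k * (of_nat (Suc (\<beta> i)) * coeff (u ^ k) ?\<beta>))"
      using N coeff_power_eq_0[OF u0, of ?\<beta>] unfolding md
      by (intro sum.mono_neutral_left) auto
    also have "\<dots> = (\<Sum>k=1..Suc N. coeff ((- u) ^ (k - 1) * pderiv_cps i u) \<beta>)"
    proof (rule sum.cong)
      fix k assume k: "k \<in> {1..Suc N}"
      have "of_nat (Suc (\<beta> i)) * coeff (u ^ k) ?\<beta> = of_nat k * coeff (u ^ (k - 1) * pderiv_cps i u) \<beta>"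
        by (simp add: coeff_pderiv [symmetric] pderiv.power mult.assoc flip: const_cps_of_nat del: of_nat_Suc)
           (simp add: coeff_const_mult)
      moreover have "(- u) ^ (k - 1) * pderiv_cps i u = const_cps ((-1) ^ (k + 1)) * (u ^ (k - 1) * pderiv_cps i u)"
        using k by (cases k; cases "even k") (auto simp: const_cps_uminus const_cps_1 power_minus[of u])
      ultimately show "(-1) ^ (k + 1) / of_nat k * (of_nat (Suc (\<beta> i)) * coeff (u ^ k) ?\<beta>)
           = coeff ((- u) ^ (k - 1) * pderiv_cps i u) \<beta>"
        using k by (simp only: coeff_const_mult) simp
    qed simp
    also have "\<dots> = (\<Sum>k\<le>N. coeff ((- u) ^ k * pderiv_cps i u) \<beta>)"
      by (rule sum.reindex_bij_witness[of _ Suc "\<lambda>k. k - 1"]) auto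
    finally show ?thesis by (simp add: sum_distrib_right coeff_sum)
  qed
  have "pderiv_cps i (ln_cps f) * (1 + u) = pderiv_cps i u"
  proof (rule cps_eqI)
    fix \<alpha> :: "'n \<Rightarrow> nat"
    let ?N = "mdeg \<alpha>"
    have "coeff (pderiv_cps i (ln_cps f) * (1 + u)) \<alpha> = coeff (((\<Sum>k\<le>?N. (- u) ^ k) * pderiv_cps i u) * (1 + u)) \<alpha>"
      by (rule coeff_mult_cong) (rule ln)
    also have "((\<Sum>k\<le>?N. (- u) ^ k) * pderiv_cps i u) * (1 + u) = (1 - (- u) ^ Suc ?N) * pderiv_cps i u"
      using one_diff_power_eq[of "- u" "Suc ?N"] by (simp add: lessThan_Suc_atMost mult_ac)
    also have "coeff \<dots> \<alpha> = coeff (1 * pderiv_cps i u) \<alpha>"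
      using coeff_power_eq_0[of "- u" _ "Suc ?N"] u0
      by (intro coeff_mult_cong) (simp del: power_Suc)
    finally show "coeff (pderiv_cps i (ln_cps f) * (1 + u)) \<alpha> = coeff (pderiv_cps i u) \<alpha>" by simp
  qed
  hence "pderiv_cps i (ln_cps f) * f = const_cps c * pderiv_cps i u"
    by (subst (2) fu) (simp add: mult_ac)
  also have "\<dots> = pderiv_cps i f"
    by (subst fu) (simp add: pderiv.mult pderiv.add)
  finally show ?thesis .
qed


section \<open>Operators on the Fock space\<close>

lemma additiveD: "Modules.additive F \<Longrightarrow> F (u + v) = F u + F v"
  by (rule Modules.additive.add)

lemma additive_comp: "Modules.additive F \<Longrightarrow> Modules.additive G \<Longrightarrow> Modules.additive (\<lambda>v. F (G v))"
  by (simp add: Modules.additive_def)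

lemma additive_mult_left: "Modules.additive (\<lambda>v. c * (v :: 'a::ring))"
  by (simp add: Modules.additive_def distrib_left)

lemma additive_Sum_any:
  assumes F: "Modules.additive F" and fin: "finite {x. g x \<noteq> 0}"
  shows "F (Sum_any g) = Sum_any (\<lambda>x. F (g x))"
proof -
  have "F (Sum_any g) = F (\<Sum>x | g x \<noteq> 0. g x)"
    by (simp add: Sum_any.expand_set)
  also have "\<dots> = (\<Sum>x | g x \<noteq> 0. F (g x))"
    by (rule Modules.additive.sum[OF F])
  also have "\<dots> = Sum_any (\<lambda>x. F (g x))"
    by (rule Sum_any.expand_superset [symmetric]) (auto simp: fin Modules.additive.zero[OF F])
  finally show ?thesis .
qed

lemma cdo_expand: "(v :: 'n::finite cdo) = (\<Sum>m\<in>Poly_Mapping.keys v. Poly_Mapping.single m (Poly_Mapping.lookup v m))"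
proof (rule poly_mapping_eqI)
  fix m
  show "Poly_Mapping.lookup v m = Poly_Mapping.lookup (\<Sum>m\<in>Poly_Mapping.keys v. Poly_Mapping.single m (Poly_Mapping.lookup v m)) m"
    by (simp add: lookup_sum lookup_single when_def in_keys_iff)
qed

lemma additive_eqI:
  fixes F G :: "('n::finite) cdo \<Rightarrow> 'a::ab_group_add"
  assumes "Modules.additive F" "Modules.additive G" "\<And>m f. F (Poly_Mapping.single m f) = G (Poly_Mapping.single m f)"
  shows "F v = G v"
  by (subst (1 2) cdo_expand) (simp add: Modules.additive.sum[OF assms(1)] Modules.additive.sum[OF assms(2)] assms(3))

lemma fn_add: "fn (f + g) = fn f + fn g"
  by (simp add: fn_def single_add)

lemma fn_mult: "fn (f * g) = fn f * fn g"
  by (simp add: fn_def mult_single)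

lemma fn_1: "fn 1 = 1"
  by (simp add: fn_def)

lemma fn_0: "fn 0 = 0"
  by (simp add: fn_def)

lemma fn_uminus: "fn (- f) = - fn f"
  by (simp add: fn_def single_uminus)

lemma fn_sum: "fn (sum f A) = (\<Sum>x\<in>A. fn (f x))"
  by (induction A rule: infinite_finite_induct) (simp_all add: fn_0 fn_add)

lemma fn_single: "fn f * Poly_Mapping.single m h = Poly_Mapping.single m (f * h)"
  by (simp add: fn_def mult_single)

lemma mvar_single: "mvar x * Poly_Mapping.single m h = Poly_Mapping.single (Poly_Mapping.single x 1 + m) h"
  by (simp add: mvar_def mult_single)

lemma scl_add: "scl c (u + v) = scl c u + scl c v"
  by (simp add: scl_def distrib_left)

lemma scl_0 [simp]: "scl 0 v = 0" "scl c 0 = 0"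
  by (simp_all add: scl_def const_cps_0 fn_0)

lemma scl_1 [simp]: "scl 1 v = v"
  by (simp add: scl_def const_cps_1 fn_1)

lemma additive_scl: "Modules.additive (scl c)"
  by (simp add: Modules.additive_def scl_add)

section \<open>Multiplication by and differentiation in the creation variables\<close>

lemma additive_dvar: "Modules.additive (dvar x)"
proof
  fix u v :: "'a cdo"
  show "dvar x (u + v) = dvar x u + dvar x v"
    unfolding dvar_def
    by (rule setsum_keys_plus_distrib) (simp_all add: single_add distrib_left)
qed

lemma dvar_single:
  "dvar x (Poly_Mapping.single m f)
     = Poly_Mapping.single (m - Poly_Mapping.single x 1) (of_nat (Poly_Mapping.lookup m x) * f)"
  by (simp add: dvar_def)

lemma lookup_diff: "Poly_Mapping.lookup (m - m') x = Poly_Mapping.lookup m x - Poly_Mapping.lookup m' x"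
  for m m' :: "'a \<Rightarrow>\<^sub>0 nat"
  by transfer simp

lemma single_add_diff:
  assumes "Poly_Mapping.lookup m x \<noteq> 0"
  shows "Poly_Mapping.single x 1 + (m - Poly_Mapping.single x (1::nat)) = m"
  by (rule poly_mapping_eqI) (use assms in \<open>auto simp: lookup_add lookup_diff lookup_single when_def\<close>)

lemma dvar_fn_mult: "dvar x (fn f * v) = fn f * dvar x v"
  by (rule additive_eqI[of "\<lambda>v. dvar x (fn f * v)" "\<lambda>v. fn f * dvar x v"])
     (simp_all add: additive_comp[OF additive_dvar additive_mult_left] additive_comp[OF additive_mult_left additive_dvar]
        fn_single dvar_single mult.left_commute)

lemma dvar_mvar_mult_other:
  assumes "x \<noteq> y"
  shows "dvar x (mvar y * v) = mvar y * dvar x v"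
proof (rule additive_eqI[of "\<lambda>v. dvar x (mvar y * v)" "\<lambda>v. mvar y * dvar x v"])
  fix m f
  show "dvar x (mvar y * Poly_Mapping.single m f) = mvar y * dvar x (Poly_Mapping.single m f)"
  proof (cases "Poly_Mapping.lookup m x = 0")
    case True
    with assms show ?thesis by (simp add: mvar_single dvar_single lookup_add lookup_single when_def)
  next
    case False
    have "Poly_Mapping.single y 1 + m - Poly_Mapping.single x 1 = Poly_Mapping.single y 1 + (m - Poly_Mapping.single x (1::nat))"
      by (rule poly_mapping_eqI) (use False assms in \<open>auto simp: lookup_add lookup_diff lookup_single when_def\<close>)
    with assms show ?thesis by (simp add: mvar_single dvar_single lookup_add lookup_single when_def)
  qed
qed (simp_all add: additive_comp[OF additive_dvar additive_mult_left] additive_comp[OF additive_mult_left additive_dvar])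

lemma dvar_mvar_mult_same: "dvar x (mvar x * v) = mvar x * dvar x v + v"
proof (rule additive_eqI[of "\<lambda>v. dvar x (mvar x * v)" "\<lambda>v. mvar x * dvar x v + v"])
  show "Modules.additive (\<lambda>v. mvar x * dvar x v + v)"
    by (simp add: Modules.additive_def distrib_left additiveD[OF additive_dvar])
  fix m :: "'a mode \<Rightarrow>\<^sub>0 nat" and f
  have "Poly_Mapping.single x 1 + m - Poly_Mapping.single x 1 = m"
    by (rule poly_mapping_eqI) (auto simp: lookup_add lookup_diff)
  \<comment> \<open>If x does not occur in m, the truncated subtraction in
    \<open>dvar_single\<close> does not lower the exponent, but the coefficient is 0.\<close>
  moreover have "mvar x * dvar x (Poly_Mapping.single m f) = Poly_Mapping.single m (of_nat (Poly_Mapping.lookup m x) * f)"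
    by (cases "Poly_Mapping.lookup m x = 0") (simp_all add: mvar_single dvar_single single_add_diff del: One_nat_def)
  ultimately show "dvar x (mvar x * Poly_Mapping.single m f) = mvar x * dvar x (Poly_Mapping.single m f) + Poly_Mapping.single m f"
    by (simp add: mvar_single dvar_single lookup_add distrib_right flip: single_add)
       (simp add: add.commute)
qed (simp add: additive_comp[OF additive_dvar additive_mult_left])

lemma dvar_fn [simp]: "dvar x (fn f) = 0"
  by (simp add: fn_def dvar_single)

lemma dvar_commute: "dvar x (dvar y v) = dvar y (dvar x v)"
proof (rule additive_eqI[of "\<lambda>v. dvar x (dvar y v)" "\<lambda>v. dvar y (dvar x v)"])
  fix m :: "'a mode \<Rightarrow>\<^sub>0 nat" and f
  have "m - Poly_Mapping.single x 1 - Poly_Mapping.single y 1 = m - Poly_Mapping.single y 1 - Poly_Mapping.single x (1::nat)"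
    by (rule poly_mapping_eqI) (auto simp: lookup_diff)
  thus "dvar x (dvar y (Poly_Mapping.single m f)) = dvar y (dvar x (Poly_Mapping.single m f))"
    by (cases "x = y") (auto simp: dvar_single lookup_diff lookup_single when_def mult_ac)
qed (simp_all add: additive_comp[OF additive_dvar additive_dvar])

text \<open>\<open>a\<^sup>i\<close> with index \<open>-(k+1)\<close> has weight \<open>k + 2\<close>. With this weight every annihilation operator \<open>b\<^sup>i\<^sub>n\<close>,
  which multiplies \<open>z\<^sup>-\<^sup>n\<close>, lowers the filtration by \<open>n + 1\<close>; so each factor \<open>b(z) - b\<^sub>0\<close> costs
  at least one unit of filtration or of the order in \<open>z\<close>, whence the sum in \<^const>\<open>fn_field\<close> is finite.\<close>

fun mode_wt :: "'n mode \<Rightarrow> nat" where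
  "mode_wt (Amode i k) = k + 2"
| "mode_wt (Bmode i k) = 0"

definition monom_wt :: "('n mode \<Rightarrow>\<^sub>0 nat) \<Rightarrow> nat" where
  "monom_wt m = (\<Sum>x\<in>Poly_Mapping.keys m. Poly_Mapping.lookup m x * mode_wt x)"

text \<open>The index is an integer so that it can be lowered below 0, where only the zero vector
  remains; this is how modes are shown to vanish.\<close>

definition filt :: "int \<Rightarrow> ('n::finite) cdo set" where
  "filt d = {v. \<forall>m\<in>Poly_Mapping.keys v. int (monom_wt m) \<le> d}"

lemma monom_wt_add: "monom_wt (m + m') = monom_wt m + monom_wt m'"
  unfolding monom_wt_def by (rule setsum_keys_plus_distrib) (simp_all add: distrib_right)

lemma monom_wt_single: "monom_wt (Poly_Mapping.single x k) = k * mode_wt x"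
  by (simp add: monom_wt_def)

lemma filt_0 [simp]: "0 \<in> filt d"
  by (simp add: filt_def)

lemma filt_add: "u \<in> filt d \<Longrightarrow> v \<in> filt d \<Longrightarrow> u + v \<in> filt d"
  using Poly_Mapping.keys_add[of u v] by (auto simp: filt_def)

lemma filt_sum: "(\<And>x. x \<in> A \<Longrightarrow> f x \<in> filt d) \<Longrightarrow> sum f A \<in> filt d"
  by (induction A rule: infinite_finite_induct) (auto intro: filt_add)

lemma filt_uminus: "v \<in> filt d \<Longrightarrow> - v \<in> filt d"
  by (simp add: filt_def in_keys_iff)

lemma filt_mono: "v \<in> filt d \<Longrightarrow> d \<le> e \<Longrightarrow> v \<in> filt e"
  by (auto simp: filt_def)

lemma filt_neg: "v \<in> filt d \<Longrightarrow> d < 0 \<Longrightarrow> v = 0"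
  by (rule poly_mapping_eqI) (fastforce simp: filt_def in_keys_iff)

lemma ex_filt: "\<exists>d. v \<in> filt d"
proof
  show "v \<in> filt (\<Sum>m\<in>Poly_Mapping.keys v. int (monom_wt m))"
    by (auto simp: filt_def intro!: member_le_sum)
qed

lemma filt_mult:
  assumes "u \<in> filt d" "v \<in> filt e"
  shows "u * v \<in> filt (d + e)"
  using assms Poly_Mapping.keys_mult[of u v] by (force simp: filt_def monom_wt_add)

lemma fn_filt: "fn f \<in> filt 0"
  by (simp add: filt_def fn_def monom_wt_def)

lemma mvar_filt: "mvar x \<in> filt (int (mode_wt x))"
  by (simp add: filt_def mvar_def monom_wt_single)

lemma fn_mult_filt: "v \<in> filt d \<Longrightarrow> fn f * v \<in> filt d"
  using filt_mult[OF fn_filt] by fastforce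

lemma Bmode_mult_filt: "v \<in> filt d \<Longrightarrow> mvar (Bmode i k) * v \<in> filt d"
  using filt_mult[OF mvar_filt[of "Bmode i k"]] by fastforce

lemma scl_filt: "v \<in> filt d \<Longrightarrow> scl c v \<in> filt d"
  by (simp add: scl_def fn_mult_filt)

lemma dvar_filt:
  assumes "v \<in> filt d"
  shows "dvar x v \<in> filt (d - int (mode_wt x))"
  unfolding dvar_def
proof (rule filt_sum)
  fix m assume m: "m \<in> Poly_Mapping.keys v"
  show "Poly_Mapping.single (m - Poly_Mapping.single x 1) (of_nat (Poly_Mapping.lookup m x) * Poly_Mapping.lookup v m)
    \<in> filt (d - int (mode_wt x))"
  proof (cases "Poly_Mapping.lookup m x = 0")
    case False
    from single_add_diff[OF this] have "monom_wt m = mode_wt x + monom_wt (m - Poly_Mapping.single x 1)"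
      by (metis monom_wt_add monom_wt_single mult_1)
    moreover have "int (monom_wt m) \<le> d" using assms m by (auto simp: filt_def)
    ultimately show ?thesis by (auto simp: filt_def)
  qed simp
qed


section \<open>Fields in the \<open>b\<^sup>i(z)\<close>\<close>

definition b_ops :: "(('n::finite) cdo \<Rightarrow> 'n cdo) set" where
  "b_ops = {\<beta>. (\<exists>f. \<beta> = (\<lambda>v. fn f * v)) \<or> (\<exists>i k. \<beta> = (\<lambda>v. mvar (Bmode i k) * v)) \<or> (\<exists>i k. \<beta> = dvar (Amode i k))}"

text \<open>The bicommutant of the operators \<open>b\<^sup>i\<^sub>n\<close> and \<open>f(b\<^sub>0)\<close>. It is commutative since these operators commute.\<close>

definition b_commutant :: "(('n::finite) cdo \<Rightarrow> 'n cdo) set" where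
  "b_commutant = {\<psi>. Modules.additive \<psi> \<and> (\<forall>\<beta>\<in>b_ops. \<forall>v. \<psi> (\<beta> v) = \<beta> (\<psi> v))}"

definition b_bicommutant :: "(('n::finite) cdo \<Rightarrow> 'n cdo) set" where
  "b_bicommutant = {\<phi>. Modules.additive \<phi> \<and> (\<forall>\<psi>\<in>b_commutant. \<forall>v. \<phi> (\<psi> v) = \<psi> (\<phi> v))}"

lemma b_ops_cases:
  assumes "\<beta> \<in> b_ops"
  obtains f where "\<beta> = (\<lambda>v. fn f * v)" | i k where "\<beta> = (\<lambda>v. mvar (Bmode i k) * v)" | i k where "\<beta> = dvar (Amode i k)"
  using assms by (auto simp: b_ops_def)

text \<open>Only \<open>Amode\<close> variables are differentiated here, and none of the operators
  multiplies by such a variable, so no commutator arises.\<close>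

lemma b_ops_commutant: "b_ops \<subseteq> b_commutant"
proof
  fix \<beta> :: "'a cdo \<Rightarrow> 'a cdo" assume \<beta>: "\<beta> \<in> b_ops"
  have "Modules.additive \<beta>"
    using \<beta> by (cases rule: b_ops_cases) (simp_all add: additive_mult_left additive_dvar)
  moreover have "\<beta> (\<gamma> v) = \<gamma> (\<beta> v)" if \<gamma>: "\<gamma> \<in> b_ops" for \<gamma> v
    using \<beta> by (cases rule: b_ops_cases; use \<gamma> in \<open>cases rule: b_ops_cases\<close>)
      (simp_all add: mult.left_commute dvar_fn_mult dvar_mvar_mult_other dvar_commute)
  ultimately show "\<beta> \<in> b_commutant" by (simp add: b_commutant_def)
qed

lemma b_ops_bicommutant: "b_ops \<subseteq> b_bicommutant"
  using b_ops_commutant by (fastforce simp: b_bicommutant_def b_commutant_def)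

text \<open>A commuting set lies in its commutant, so its bicommutant lies there too, and elements
  of the bicommutant commute with all of the commutant.\<close>

lemma b_bicommutant_commute:
  assumes "\<phi> \<in> b_bicommutant" "\<psi> \<in> b_bicommutant"
  shows "\<phi> (\<psi> v) = \<psi> (\<phi> v)"
proof -
  have "\<psi> \<in> b_commutant"
    using assms(2) b_ops_commutant by (auto simp: b_bicommutant_def b_commutant_def)
  thus ?thesis using assms(1) by (simp add: b_bicommutant_def)
qed

lemma fn_mult_bicommutant: "(\<lambda>v. fn f * v) \<in> b_bicommutant"
  using b_ops_bicommutant by (auto simp: b_ops_def)

lemma b_commutant_fn_mult: "\<psi> \<in> b_commutant \<Longrightarrow> \<psi> (fn f * v) = fn f * \<psi> v"
  by (auto simp: b_commutant_def b_ops_def)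

lemma b_mode_bicommutant: "b_mode i n \<in> b_bicommutant"
proof -
  have 1: "(\<lambda>v. mvar (Bmode i k) * v) \<in> b_bicommutant" "dvar (Amode i k) \<in> b_bicommutant" for k
    by (rule subsetD[OF b_ops_bicommutant], auto simp: b_ops_def)+
  hence "(\<lambda>v. - dvar (Amode i k) v) \<in> b_bicommutant" for k
    by (auto simp: b_bicommutant_def b_commutant_def Modules.additive_def Modules.additive.minus)
  moreover have "b_mode i n = (if n < 0 then (\<lambda>v. mvar (Bmode i (nat (- n - 1))) * v)
      else if n = 0 then (\<lambda>v. fn (var_cps i) * v) else (\<lambda>v. - dvar (Amode i (nat (n - 1))) v))"
    by (simp add: b_mode_def fun_eq_iff)
  ultimately show ?thesis
    using 1 by (simp add: fn_mult_bicommutant)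
qed

text \<open>The operator \<open>X n\<close> accompanies z to the power -n-1. If this exponent falls
  short of k, the deficit is paid by lowering the filtration. The \<open>min\<close> ensures that no
  mode raises the filtration, so that the estimate passes to products.\<close>

definition order_ge :: "int \<Rightarrow> ('n::finite) vfield \<Rightarrow> bool" where
  "order_ge k X \<longleftrightarrow> (\<forall>n d v. v \<in> filt d \<longrightarrow> X n v \<in> filt (min d (d - n - 1 - k)))"

definition is_bfield :: "('n::finite) vfield \<Rightarrow> bool" where
  "is_bfield X \<longleftrightarrow> (\<forall>n. X n \<in> b_bicommutant) \<and> (\<exists>k. order_ge k X)"

lemma order_geD: "order_ge k X \<Longrightarrow> v \<in> filt d \<Longrightarrow> X n v \<in> filt (min d (d - n - 1 - k))"
  by (simp add: order_ge_def)

lemma order_geD1: "order_ge k X \<Longrightarrow> v \<in> filt d \<Longrightarrow> X n v \<in> filt d"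
  by (meson filt_mono min.cobounded1 order_geD)

lemma order_ge_zero: "order_ge k X \<Longrightarrow> v \<in> filt d \<Longrightarrow> d - n - 1 - k < 0 \<Longrightarrow> X n v = 0"
  using order_geD[of k X v d n] filt_neg by fastforce

lemma order_ge_mono: "order_ge k X \<Longrightarrow> l \<le> k \<Longrightarrow> order_ge l X"
  unfolding order_ge_def by (meson diff_left_mono filt_mono min.mono order_refl)

lemma is_bfield_additive: "is_bfield X \<Longrightarrow> Modules.additive (X n)"
  by (simp add: is_bfield_def b_bicommutant_def)

text \<open>High modes of Y kill v, which bounds j from below. All modes of Y keep v in
  \<open>filt d\<close>, so the bound beyond which X vanishes is the same for every j.\<close>

lemma mult_field_support:
  assumes "is_bfield X" "order_ge k X" "order_ge l Y" "v \<in> filt d"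
  shows "{j. X j (Y (n - 1 - j) v) \<noteq> 0} \<subseteq> {n - d + l..d - 1 - k}"
proof
  fix j assume j: "j \<in> {j. X j (Y (n - 1 - j) v) \<noteq> 0}"
  hence "Y (n - 1 - j) v \<noteq> 0" using Modules.additive.zero[OF is_bfield_additive[OF assms(1)]] by auto
  hence "n - d + l \<le> j" using order_ge_zero[OF assms(3,4), of "n - 1 - j"] by linarith
  moreover have "j \<le> d - 1 - k"
    using order_ge_zero[OF assms(2) order_geD1[OF assms(3,4)], of j "n - 1 - j"] j by fastforce
  ultimately show "j \<in> {n - d + l..d - 1 - k}" by simp
qed

lemma mult_field_finite:
  assumes "is_bfield X" "is_bfield Y"
  shows "finite {j. X j (Y (n - 1 - j) v) \<noteq> 0}"
proof -
  obtain k l d where "order_ge k X" "order_ge l Y" "v \<in> filt d"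
    using assms ex_filt[of v] by (auto simp: is_bfield_def)
  from mult_field_support[OF assms(1) this, of n] show ?thesis
    using finite_subset by blast
qed

lemma order_ge_mult:
  assumes "is_bfield X" "is_bfield Y" "order_ge k X" "order_ge l Y"
  shows "order_ge (k + l) (mult_field X Y)"
  unfolding order_ge_def
proof (intro allI impI)
  fix n d and v :: "'a cdo" assume v: "v \<in> filt d"
  show "mult_field X Y n v \<in> filt (min d (d - n - 1 - (k + l)))"
    unfolding mult_field_def Sum_any.expand_set
  proof (rule filt_sum)
    fix j
    show "X j (Y (n - 1 - j) v) \<in> filt (min d (d - n - 1 - (k + l)))"
      by (rule filt_mono[OF order_geD[OF assms(3) order_geD[OF assms(4) v]]]) auto
  qed
qed

lemma is_bfield_mult:
  assumes X: "is_bfield X" and Y: "is_bfield Y"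
  shows "is_bfield (mult_field X Y)"
proof -
  have "mult_field X Y n (u + v) = mult_field X Y n u + mult_field X Y n v" for n u v
    unfolding mult_field_def
    by (subst Sum_any.distrib [symmetric])
       (simp_all add: mult_field_finite[OF X Y] additiveD[OF is_bfield_additive[OF X]] additiveD[OF is_bfield_additive[OF Y]])
  moreover have "mult_field X Y n (\<psi> v) = \<psi> (mult_field X Y n v)" if \<psi>: "\<psi> \<in> b_commutant" for n \<psi> v
  proof -
    have "\<psi> (mult_field X Y n v) = Sum_any (\<lambda>j. \<psi> (X j (Y (n - 1 - j) v)))"
      unfolding mult_field_def using \<psi>
      by (intro additive_Sum_any mult_field_finite X Y) (simp add: b_commutant_def)
    thus ?thesis using X Y \<psi> by (simp add: mult_field_def is_bfield_def b_bicommutant_def)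
  qed
  ultimately show ?thesis
    using order_ge_mult[OF X Y] X Y by (fastforce simp: is_bfield_def b_bicommutant_def Modules.additive_def)
qed

lemma mult_field_assoc:
  assumes X: "is_bfield X" and Y: "is_bfield Y" and Z: "is_bfield Z"
  shows "mult_field (mult_field X Y) Z n v = mult_field X (mult_field Y Z) n v"
proof -
  obtain k l m d where k: "order_ge k X" and l: "order_ge l Y" and m: "order_ge m Z" and d: "v \<in> filt d"
    using X Y Z ex_filt[of v] by (auto simp: is_bfield_def)
  note add0 = Modules.additive.zero[OF is_bfield_additive[OF X]] Modules.additive.zero[OF is_bfield_additive[OF Y]]
  let ?g = "\<lambda>j i. X i (Y (j - 1 - i) (Z (n - 1 - j) v))"
  \<comment> \<open>All nonzero terms of the double sum lie in one finite box, as the exchange of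
    the two sums requires.\<close>
  have supp: "j \<in> {n - d + m..2 * d - 2 - k - l + 1} \<and> i \<in> {n + m + l - 2 * d..d - 1 - k}" if "?g j i \<noteq> 0" for j i
  proof -
    have 1: "Z (n - 1 - j) v \<noteq> 0" and 2: "Y (j - 1 - i) (Z (n - 1 - j) v) \<noteq> 0"
      using that add0 by auto
    have "d - (n - 1 - j) - 1 - m \<ge> 0" "d - (j - 1 - i) - 1 - l \<ge> 0" "d - i - 1 - k \<ge> 0"
      using order_ge_zero[OF m d, of "n - 1 - j"] 1
        order_ge_zero[OF l order_geD1[OF m d], of "j - 1 - i" "n - 1 - j"] 2
        order_ge_zero[OF k order_geD1[OF l order_geD1[OF m d]], of i "j - 1 - i" "n - 1 - j"] that
      by linarith+
    thus ?thesis by auto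
  qed
  have "mult_field (mult_field X Y) Z n v = Sum_any (\<lambda>j. Sum_any (?g j))"
    by (simp add: mult_field_def)
  also have "\<dots> = Sum_any (\<lambda>i. Sum_any (\<lambda>j. ?g j i))"
    by (rule Sum_any.swap[of "{n - d + m..2 * d - 2 - k - l + 1} \<times> {n + m + l - 2 * d..d - 1 - k}"])
       (simp, use supp in blast)
  also have "\<dots> = Sum_any (\<lambda>i. X i (mult_field Y Z (n - 1 - i) v))"
  proof (rule Sum_any.cong)
    fix i
    have "X i (mult_field Y Z (n - 1 - i) v) = Sum_any (\<lambda>j. X i (Y j (Z (n - 1 - i - 1 - j) v)))"
      unfolding mult_field_def
      by (intro additive_Sum_any is_bfield_additive[OF X] mult_field_finite Y Z)
    also have "\<dots> = Sum_any (\<lambda>j. ?g j i)"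
    proof (rule Sum_any.reindex_cong)
      show "bij (\<lambda>j. j - 1 - i)"
        by (rule bij_betw_byWitness[of _ "\<lambda>j. j + 1 + i"]) auto
    qed (auto simp: fun_eq_iff algebra_simps)
    finally show "Sum_any (\<lambda>j. ?g j i) = X i (mult_field Y Z (n - 1 - i) v)" ..
  qed
  finally show ?thesis by (simp add: mult_field_def)
qed

lemma mult_field_commute:
  assumes "is_bfield X" "is_bfield Y"
  shows "mult_field X Y n v = mult_field Y X n v"
  unfolding mult_field_def
proof (rule Sum_any.reindex_cong)
  show "bij (\<lambda>j. n - 1 - j)"
    by (rule bij_betw_byWitness[of _ "\<lambda>j. n - 1 - j"]) auto
  show "(\<lambda>j. X j (Y (n - 1 - j) v)) \<circ> (\<lambda>j. n - 1 - j) = (\<lambda>j. Y j (X (n - 1 - j) v))"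
    using assms by (auto simp: is_bfield_def fun_eq_iff intro: b_bicommutant_commute)
qed

lemma mult_id_field: "mult_field id_field X n v = X n v"
proof -
  have "(\<lambda>j. id_field j (X (n - 1 - j) v)) = (\<lambda>j. if j = -1 then X (n - 1 - j) v else 0)"
    by (auto simp: id_field_def)
  thus ?thesis unfolding mult_field_def by (simp only: Sum_any.delta) simp
qed

lemma order_ge_add:
  "order_ge k X \<Longrightarrow> order_ge k Y \<Longrightarrow> order_ge k (\<lambda>n v. X n v + Y n v)"
  by (simp add: order_ge_def filt_add)

lemma order_ge_uminus: "order_ge k X \<Longrightarrow> order_ge k (\<lambda>n v. - X n v)"
  by (simp add: order_ge_def filt_uminus)

lemma is_bfield_add:
  assumes "is_bfield X" "is_bfield Y"
  shows "is_bfield (\<lambda>n v. X n v + Y n v)"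
proof -
  obtain k l where "order_ge k X" "order_ge l Y" using assms by (auto simp: is_bfield_def)
  hence "order_ge (min k l) (\<lambda>n v. X n v + Y n v)"
    by (intro order_ge_add) (auto intro: order_ge_mono)
  thus ?thesis using assms
    by (auto simp: is_bfield_def b_bicommutant_def b_commutant_def Modules.additive_def)
qed

lemma is_bfield_uminus:
  assumes "is_bfield X"
  shows "is_bfield (\<lambda>n v. - X n v)"
  using assms order_ge_uminus[of _ X]
  by (fastforce simp: is_bfield_def b_bicommutant_def b_commutant_def Modules.additive_def Modules.additive.minus)

definition const_field :: "('n::finite) cps \<Rightarrow> 'n vfield" where
  "const_field f n v = (if n = -1 then fn f * v else 0)"

lemma order_ge_const_field: "order_ge 0 (const_field f)"
  by (auto simp: order_ge_def const_field_def intro: fn_mult_filt)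

lemma zero_bicommutant: "(\<lambda>v. 0) \<in> b_bicommutant"
  by (auto simp: b_bicommutant_def b_commutant_def Modules.additive_def Modules.additive.zero)

lemma is_bfield_const_field: "is_bfield (const_field f)"
proof -
  have "const_field f n \<in> b_bicommutant" for n
    using zero_bicommutant fn_mult_bicommutant[of f] by (cases "n = -1") (simp_all add: const_field_def[abs_def])
  thus ?thesis using order_ge_const_field by (auto simp: is_bfield_def)
qed

lemma id_field_eq_const_field: "id_field = const_field 1"
  by (simp add: fun_eq_iff id_field_def const_field_def fn_1)

text \<open>A type of its own makes these fields an instance of \<open>comm_ring_1\<close>. Taylor
  polynomials in b(z) - b_0 become ordinary ring expressions, and d/dz an instance of
  \<open>derivation\<close>.\<close>

typedef (overloaded) ('n::finite) bfield = "{X :: 'n vfield. is_bfield X}"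
  morphisms fmode Abs_bfield
  using is_bfield_const_field by blast

setup_lifting type_definition_bfield

lemma is_bfield_fmode: "is_bfield (fmode X)"
  using fmode[of X] by simp

lemma bfield_eqI: "(\<And>n v. fmode X n v = fmode Y n v) \<Longrightarrow> X = Y"
  by (simp add: fmode_inject [symmetric] fun_eq_iff)

instantiation bfield :: (finite) comm_ring_1
begin

lift_definition zero_bfield :: "'a bfield" is "\<lambda>n v. 0"
  using zero_bicommutant by (auto simp: is_bfield_def order_ge_def)

lift_definition one_bfield :: "'a bfield" is id_field
  by (simp add: id_field_eq_const_field is_bfield_const_field)

lift_definition plus_bfield :: "'a bfield \<Rightarrow> 'a bfield \<Rightarrow> 'a bfield" is "\<lambda>X Y n v. X n v + Y n v"
  by (rule is_bfield_add)

lift_definition uminus_bfield :: "'a bfield \<Rightarrow> 'a bfield" is "\<lambda>X n v. - X n v"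
  by (rule is_bfield_uminus)

lift_definition minus_bfield :: "'a bfield \<Rightarrow> 'a bfield \<Rightarrow> 'a bfield" is "\<lambda>X Y n v. X n v - Y n v"
  using is_bfield_add[OF _ is_bfield_uminus] by simp

lift_definition times_bfield :: "'a bfield \<Rightarrow> 'a bfield \<Rightarrow> 'a bfield" is mult_field
  by (rule is_bfield_mult)

instance
proof
  fix X Y Z :: "'a bfield"
  show "X + Y + Z = X + (Y + Z)" "X + Y = Y + X" "0 + X = X" "- X + X = 0" "X - Y = X + - Y"
    by (transfer; simp add: fun_eq_iff)+
  have "fmode (0 :: 'a bfield) (-1) 1 \<noteq> fmode 1 (-1) 1"
    by (simp add: zero_bfield.rep_eq one_bfield.rep_eq id_field_def)
  thus "(0 :: 'a bfield) \<noteq> 1" by metis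
  show "X * Y * Z = X * (Y * Z)"
    by transfer (simp add: fun_eq_iff mult_field_assoc)
  show "X * Y = Y * X"
    by transfer (simp add: fun_eq_iff mult_field_commute)
  show "1 * X = X"
    by transfer (simp add: fun_eq_iff mult_id_field)
  show "(X + Y) * Z = X * Z + Y * Z"
    by transfer (simp add: fun_eq_iff mult_field_def Sum_any.distrib mult_field_finite)
qed

end


section \<open>The derivation d/dz on the ring of fields, and its generators\<close>

lemma scl_add_left: "scl (c + d) v = scl c v + scl d v"
  by (simp add: scl_def const_cps_add fn_add distrib_right)

lemma scl_scl: "scl c (scl d v) = scl (c * d) v"
  by (simp add: scl_def const_cps_mult fn_mult mult.assoc)

lemma bicommutant_scl: "\<phi> \<in> b_bicommutant \<Longrightarrow> \<phi> (scl c v) = scl c (\<phi> v)"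
  unfolding scl_def by (rule b_bicommutant_commute[OF _ fn_mult_bicommutant])

lemma bicommutant_comp_scl:
  assumes "\<phi> \<in> b_bicommutant"
  shows "(\<lambda>v. scl c (\<phi> v)) \<in> b_bicommutant"
  using assms
  by (auto simp: b_bicommutant_def scl_def b_commutant_fn_mult Modules.additive_def distrib_left)

lemma fmode_bicommutant: "fmode X n \<in> b_bicommutant"
  using is_bfield_fmode[of X] by (simp add: is_bfield_def)

lemma fmode_additive: "Modules.additive (fmode X n)"
  by (rule is_bfield_additive[OF is_bfield_fmode])

lemma fmode_plus: "fmode (X + Y) n v = fmode X n v + fmode Y n v"
  by (simp add: plus_bfield.rep_eq)

lemma fmode_minus: "fmode (X - Y) n v = fmode X n v - fmode Y n v"
  by (simp add: minus_bfield.rep_eq)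

lemma fmode_0: "fmode 0 n v = 0"
  by (simp add: zero_bfield.rep_eq)

lemma fmode_sum: "fmode (sum f A) n v = (\<Sum>x\<in>A. fmode (f x) n v)"
  by (induction A rule: infinite_finite_induct) (simp_all add: fmode_0 fmode_plus)

lemma order_ge_deriv: "order_ge k X \<Longrightarrow> order_ge (k - 1) (deriv_field X)"
  unfolding order_ge_def deriv_field_def
proof (intro allI impI)
  fix n d and v :: "'a cdo"
  assume *: "\<forall>n d v. v \<in> filt d \<longrightarrow> X n v \<in> filt (min d (d - n - 1 - k))" and v: "v \<in> filt d"
  hence "X (n - 1) v \<in> filt (min d (d - (n - 1) - 1 - k))" by blast
  moreover have "d - (n - 1) - 1 - k = d - n - 1 - (k - 1)" by simp
  ultimately show "scl (- of_int n) (X (n - 1) v) \<in> filt (min d (d - n - 1 - (k - 1)))"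
    by (metis scl_filt)
qed

lift_definition dfield :: "('n::finite) bfield \<Rightarrow> 'n bfield" is deriv_field
proof -
  fix X :: "'n vfield" assume X: "is_bfield X"
  have "deriv_field X n \<in> b_bicommutant" for n
    using X bicommutant_comp_scl[of "X (n - 1)" "- of_int n"]
    unfolding deriv_field_def[abs_def] is_bfield_def by blast
  thus "is_bfield (deriv_field X)"
    using X order_ge_deriv unfolding is_bfield_def by blast
qed

lemma fmode_dfield: "fmode (dfield X) n v = scl (- of_int n) (fmode X (n - 1) v)"
  by (simp add: dfield.rep_eq deriv_field_def)

lemma fmode_times: "fmode (X * Y) n v = Sum_any (\<lambda>j. fmode X j (fmode Y (n - 1 - j) v))"
  by (simp add: times_bfield.rep_eq mult_field_def)

lemma dfield_mult: "dfield (X * Y) = dfield X * Y + X * dfield Y"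
proof (rule bfield_eqI)
  fix n v
  let ?g = "\<lambda>j. fmode X j (fmode Y (n - 1 - 1 - j) v)"
  have fin: "finite {j. ?g j \<noteq> 0}"
    by (rule mult_field_finite) (rule is_bfield_fmode)+
  have fin': "finite {j. scl (c j) (?g j) \<noteq> 0}" for c
    by (rule finite_subset[OF _ fin]) auto
  have "fmode (dfield X * Y) n v = Sum_any (\<lambda>j. scl (- of_int j) (fmode X (j - 1) (fmode Y (n - 1 - j) v)))"
    by (simp add: fmode_times fmode_dfield)
  also have "\<dots> = Sum_any (\<lambda>j. scl (- of_int (j + 1)) (?g j))"
  proof (rule Sum_any.reindex_cong)
    show "bij (\<lambda>j::int. j + 1)"
      by (rule bij_betw_byWitness[of _ "\<lambda>j. j - 1"]) auto
  qed (simp add: fun_eq_iff algebra_simps)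
  finally have 1: "fmode (dfield X * Y) n v = Sum_any (\<lambda>j. scl (- of_int (j + 1)) (?g j))" .
  have 2: "fmode (X * dfield Y) n v = Sum_any (\<lambda>j. scl (- of_int (n - 1 - j)) (?g j))"
    by (simp add: fmode_times fmode_dfield bicommutant_scl[OF fmode_bicommutant] algebra_simps)
  have "fmode (dfield (X * Y)) n v = Sum_any (\<lambda>j. scl (- of_int n) (?g j))"
    unfolding fmode_dfield fmode_times by (rule additive_Sum_any[OF additive_scl fin])
  \<comment> \<open>After the index shift, the factors -(j+1) and -(n-1-j) from the two derivatives
    add up to -n.\<close>
  also have "\<dots> = Sum_any (\<lambda>j. scl (- of_int (j + 1)) (?g j) + scl (- of_int (n - 1 - j)) (?g j))"
    by (simp flip: scl_add_left)
  also have "\<dots> = fmode (dfield X * Y + X * dfield Y) n v"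
    unfolding fmode_plus 1 2 by (rule Sum_any.distrib[OF fin' fin'])
  finally show "fmode (dfield (X * Y)) n v = fmode (dfield X * Y + X * dfield Y) n v" .
qed

interpretation dfield: derivation dfield
  by unfold_locales (auto intro!: bfield_eqI simp: fmode_dfield fmode_plus scl_add dfield_mult)

lift_definition cfield :: "('n::finite) cps \<Rightarrow> 'n bfield" is const_field
  by (rule is_bfield_const_field)

lemma fmode_cfield: "fmode (cfield f) n v = (if n = -1 then fn f * v else 0)"
  by (simp add: cfield.rep_eq const_field_def)

lemma fmode_cfield_mult: "fmode (cfield f * X) n v = fn f * fmode X n v"
proof -
  have "(\<lambda>j. fmode (cfield f) j (fmode X (n - 1 - j) v)) = (\<lambda>j. if j = -1 then fn f * fmode X (n - 1 - j) v else 0)"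
    by (auto simp: fmode_cfield)
  thus ?thesis unfolding fmode_times by (simp only: Sum_any.delta) simp
qed

lemma cfield_1: "cfield 1 = 1"
  by (rule bfield_eqI) (simp add: fmode_cfield one_bfield.rep_eq id_field_def fn_1)

lemma cfield_add: "cfield (f + g) = cfield f + cfield g"
  by (rule bfield_eqI) (simp add: fmode_cfield fmode_plus fn_add distrib_right)

lemma cfield_mult: "cfield (f * g) = cfield f * cfield g"
  by (rule bfield_eqI) (simp add: fmode_cfield fmode_cfield_mult fn_mult mult.assoc)

lemma cfield_0 [simp]: "cfield 0 = 0"
  by (rule bfield_eqI) (simp add: fmode_cfield fmode_0 fn_0)

lemma cfield_of_nat: "cfield (of_nat k) = of_nat k"
  by (induction k) (simp_all add: cfield_add cfield_1)

lemma dfield_cfield [simp]: "dfield (cfield f) = 0"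
  by (rule bfield_eqI) (simp add: fmode_dfield fmode_cfield fmode_0)

text \<open>The removed mode -1 is the only one of order 0. Modes below it carry positive powers of
  z, and for n \<ge> 0 the derivative in \<open>Amode i n\<close> lowers the filtration by n + 2,
  exactly the deficit of the exponent -n-1 from 1.\<close>

lemma order_ge_b_shift: "order_ge 1 (b_shift i)"
  unfolding order_ge_def
proof (intro allI impI)
  fix n d :: int and v :: "'a cdo" assume v: "v \<in> filt d"
  consider "n = -1" | "n < -1" | "n > -1" by linarith
  thus "b_shift i n v \<in> filt (min d (d - n - 1 - 1))"
  proof cases
    case 2
    thus ?thesis using v by (simp add: b_shift_def b_field_def b_mode_def Bmode_mult_filt)
  next
    case 3
    have "dvar (Amode i (nat n)) v \<in> filt (d - n - 2)"
      using dvar_filt[OF v, of "Amode i (nat n)"] 3 by (simp add: algebra_simps)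
    hence "- dvar (Amode i (nat n)) v \<in> filt (min d (d - n - 1 - 1))"
      using 3 by (intro filt_uminus) (auto intro: filt_mono simp: min_def)
    thus ?thesis using 3 by (simp add: b_shift_def b_field_def b_mode_def)
  qed (simp add: b_shift_def)
qed

lift_definition shift :: "'n \<Rightarrow> ('n::finite) bfield" is b_shift
proof -
  fix i :: 'n
  have "b_shift i n \<in> b_bicommutant" for n
    using b_mode_bicommutant[of i "n + 1"] zero_bicommutant
    by (cases "n = -1") (simp_all add: b_shift_def[abs_def] b_field_def)
  thus "is_bfield (b_shift i)"
    using order_ge_b_shift unfolding is_bfield_def by blast
qed

definition coord_field :: "'n \<Rightarrow> ('n::finite) bfield" where
  "coord_field i = cfield (var_cps i) + shift i"

lemma fmode_coord_field: "fmode (coord_field i) = b_field i"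
  by (simp add: fun_eq_iff coord_field_def fmode_plus fmode_cfield shift.rep_eq b_shift_def b_field_def b_mode_def)

lemma dfield_coord_field: "dfield (coord_field i) = dfield (shift i)"
  by (simp add: coord_field_def dfield.add)

section \<open>The order as a measure of approximation\<close>

definition order_b :: "int \<Rightarrow> ('n::finite) bfield \<Rightarrow> bool" where
  "order_b k X \<longleftrightarrow> order_ge k (fmode X)"

lemma order_b_add: "order_b k X \<Longrightarrow> order_b k Y \<Longrightarrow> order_b k (X + Y)"
  by (simp add: order_b_def plus_bfield.rep_eq order_ge_add)

lemma order_b_0: "order_b k 0"
  by (simp add: order_b_def zero_bfield.rep_eq order_ge_def)

lemma order_b_uminus: "order_b k X \<Longrightarrow> order_b k (- X)"
  by (simp add: order_b_def uminus_bfield.rep_eq order_ge_uminus)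

lemma order_b_diff: "order_b k X \<Longrightarrow> order_b k Y \<Longrightarrow> order_b k (X - Y)"
  using order_b_add[of k X "- Y"] by (simp add: order_b_uminus)

lemma order_b_sum: "(\<And>x. x \<in> A \<Longrightarrow> order_b k (f x)) \<Longrightarrow> order_b k (sum f A)"
  by (induction A rule: infinite_finite_induct) (auto intro: order_b_add order_b_0)

lemma order_b_mult: "order_b k X \<Longrightarrow> order_b l Y \<Longrightarrow> order_b (k + l) (X * Y)"
  by (simp add: order_b_def times_bfield.rep_eq order_ge_mult is_bfield_fmode)

lemma order_b_cfield: "order_b 0 (cfield f)"
  by (simp add: order_b_def cfield.rep_eq order_ge_const_field)

lemma order_b_shift: "order_b 1 (shift i)"
  by (simp add: order_b_def shift.rep_eq order_ge_b_shift)

lemma order_b_dfield: "order_b k X \<Longrightarrow> order_b (k - 1) (dfield X)"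
  by (simp add: order_b_def dfield.rep_eq order_ge_deriv)

lemma order_b_power: "order_b k X \<Longrightarrow> order_b (int n * k) (X ^ n)"
proof (induction n)
  case 0
  show ?case using order_b_cfield[of 1] by (simp add: cfield_1)
next
  case (Suc n)
  from order_b_mult[OF Suc.prems Suc.IH[OF Suc.prems]] show ?case
    by (simp add: algebra_simps)
qed

lemma order_b_mono: "order_b k X \<Longrightarrow> l \<le> k \<Longrightarrow> order_b l X"
  by (simp add: order_b_def order_ge_mono)

lemma order_b_zero: "order_b k X \<Longrightarrow> v \<in> filt d \<Longrightarrow> d - n - 1 - k < 0 \<Longrightarrow> fmode X n v = 0"
  unfolding order_b_def by (rule order_ge_zero)

text \<open>On a vector of \<open>filt d\<close> the mode n of a field of order above d-n-1
  vanishes, and every vector lies in some \<open>filt d\<close>. Identities between limits thus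
  follow from approximations to every order.\<close>

lemma bfield_eq_0I:
  fixes X :: "('n::finite) bfield"
  assumes "\<And>k. order_b (int k) X"
  shows "X = 0"
proof (rule bfield_eqI)
  fix n and v :: "'n cdo"
  obtain d where "v \<in> filt d" using ex_filt by blast
  thus "fmode X n v = fmode 0 n v"
    using order_b_zero[OF assms[of "nat (d - n)"], of v d n] by (simp add: fmode_0)
qed


section \<open>The chain rule for \<open>f(b(z))\<close>\<close>

definition shift_power :: "('n \<Rightarrow> nat) \<Rightarrow> ('n::finite) bfield" where
  "shift_power \<alpha> = (\<Prod>i\<in>UNIV. shift i ^ \<alpha> i)"

lemma count_list_of:
  assumes "finite {x. c x \<noteq> 0}"
  shows "count_list (list_of c) x = c x"
proof -
  define M where "M = Abs_multiset c"
  have M: "count M x = c x" for x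
    using assms by (simp add: M_def count_Abs_multiset)
  obtain xs where "mset xs = M" using ex_mset by blast
  hence "\<forall>x. count_list xs x = c x" by (metis M count_mset)
  thus ?thesis
    unfolding list_of_def by (rule someI2) simp
qed

lemma prod_list_count:
  fixes f :: "'i::finite \<Rightarrow> 'a::comm_monoid_mult"
  shows "prod_list (map f xs) = (\<Prod>i\<in>UNIV. f i ^ count_list xs i)"
proof (induction xs)
  case (Cons x xs)
  have "(\<Prod>i\<in>UNIV. f i ^ count_list (x # xs) i) = (\<Prod>i\<in>UNIV. (if i = x then f i else 1) * f i ^ count_list xs i)"
    by (rule prod.cong) auto
  also have "\<dots> = f x * (\<Prod>i\<in>UNIV. f i ^ count_list xs i)"
    by (simp add: prod.distrib)
  finally show ?case by (simp add: Cons)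
qed simp

lemma fmode_shift_power: "fmode (shift_power \<alpha>) = b_shift_power \<alpha>"
proof -
  have "foldr (\<lambda>i. mult_field (b_shift i)) xs id_field = fmode (prod_list (map shift xs))" for xs :: "'a list"
    by (induction xs) (simp_all add: one_bfield.rep_eq times_bfield.rep_eq shift.rep_eq)
  thus ?thesis
    by (simp add: b_shift_power_def shift_power_def prod_list_count count_list_of)
qed

lemma order_b_shift_power: "order_b (int (mdeg \<alpha>)) (shift_power \<alpha>)"
proof -
  have "order_b (\<Sum>i\<in>A. int (\<alpha> i)) (\<Prod>i\<in>A. shift i ^ \<alpha> i)" for A
  proof (induction A rule: infinite_finite_induct)
    case (insert x A)
    from order_b_mult[OF order_b_power[OF order_b_shift, where n = "\<alpha> x"] insert.IH] insert.hyps
    show ?case by simp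
  qed (use order_b_cfield[of 1] in \<open>simp_all add: cfield_1\<close>)
  from this[of UNIV] show ?thesis by (simp add: shift_power_def mdeg_def)
qed

section \<open>Taylor sums and f(b(z)) as their limit\<close>

definition taylor_term :: "('n::finite) cps \<Rightarrow> ('n \<Rightarrow> nat) \<Rightarrow> 'n bfield" where
  "taylor_term f \<alpha> = cfield (const_cps (1 / of_nat (mfact \<alpha>)) * mderiv_cps \<alpha> f) * shift_power \<alpha>"

definition taylor_sum :: "nat \<Rightarrow> ('n::finite) cps \<Rightarrow> 'n bfield" where
  "taylor_sum N f = (\<Sum>\<alpha> | mdeg \<alpha> \<le> N. taylor_term f \<alpha>)"

lemma mdeg_0: "mdeg (\<lambda>_. 0) = 0"
  by (simp add: mdeg_def)

lemma finite_mdeg_le: "finite {\<alpha> :: 'n::finite \<Rightarrow> nat. mdeg \<alpha> \<le> N}"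
proof (rule finite_subset[OF _ finite_le_fun[of "\<lambda>_. N"]], clarify)
  fix \<alpha> :: "'n \<Rightarrow> nat" and i
  assume "mdeg \<alpha> \<le> N"
  moreover have "\<alpha> i \<le> mdeg \<alpha>" unfolding mdeg_def by (rule member_le_sum) auto
  ultimately show "\<alpha> i \<le> N" by linarith
qed

lemma order_b_taylor_term: "order_b (int (mdeg \<alpha>)) (taylor_term f \<alpha>)"
  using order_b_mult[OF order_b_cfield order_b_shift_power] by (simp add: taylor_term_def)

lemma fn_field_eq_Sum_any: "fn_field f n v = Sum_any (\<lambda>\<alpha>. fmode (taylor_term f \<alpha>) n v)"
  by (simp add: fn_field_def taylor_term_def fmode_cfield_mult fmode_shift_power scl_def fn_mult mult.assoc)

text \<open>On \<open>filt d\<close>, the terms of degree above d-n-1 do not contribute to mode n.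
  This shows that \<open>Sum_any\<close> in \<open>fn_field\<close> is a genuine finite sum.\<close>

lemma fn_field_eq_taylor_sum:
  assumes "v \<in> filt d" "d - n - 1 \<le> int N"
  shows "fn_field f n v = fmode (taylor_sum N f) n v"
proof -
  have "fmode (taylor_term f \<alpha>) n v = 0" if "\<not> mdeg \<alpha> \<le> N" for \<alpha>
    by (rule order_b_zero[OF order_b_taylor_term assms(1)]) (use assms(2) that in linarith)
  hence "fn_field f n v = (\<Sum>\<alpha> | mdeg \<alpha> \<le> N. fmode (taylor_term f \<alpha>) n v)"
    unfolding fn_field_eq_Sum_any
    by (intro Sum_any.expand_superset finite_mdeg_le) auto
  thus ?thesis by (simp add: taylor_sum_def fmode_sum)
qed

lemma order_b_taylor_sum: "order_b 0 (taylor_sum N f)"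
  unfolding taylor_sum_def
  by (intro order_b_sum order_b_mono[OF order_b_taylor_term]) simp

lemma is_bfield_fn_field: "is_bfield (fn_field f)"
proof -
  have "fn_field f n (u + v) = fn_field f n u + fn_field f n v" for n u v
  proof -
    \<comment> \<open>A common filtration index lets one Taylor sum represent the mode on u, v and u
      + v simultaneously.\<close>
    obtain d e where "u \<in> filt d" "v \<in> filt e" using ex_filt by blast
    hence "u \<in> filt (max d e)" "v \<in> filt (max d e)" by (auto intro: filt_mono)
    thus ?thesis
      using fn_field_eq_taylor_sum[of _ "max d e" n "nat (max d e - n - 1)" f]
      by (simp add: filt_add additiveD[OF fmode_additive])
  qed
  moreover have "fn_field f n (\<psi> v) = \<psi> (fn_field f n v)" if "\<psi> \<in> b_commutant" for n \<psi> v
  proof -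
    obtain d e where "\<psi> v \<in> filt d" "v \<in> filt e" using ex_filt by blast
    hence "\<psi> v \<in> filt (max d e)" "v \<in> filt (max d e)" by (auto intro: filt_mono)
    thus ?thesis
      using fn_field_eq_taylor_sum[of _ "max d e" n "nat (max d e - n - 1)" f] that
        fmode_bicommutant[of "taylor_sum (nat (max d e - n - 1)) f" n]
      by (simp add: b_bicommutant_def)
  qed
  moreover have "order_ge 0 (fn_field f)"
    unfolding order_ge_def
  proof (intro allI impI)
    fix n d and v :: "'a cdo" assume v: "v \<in> filt d"
    show "fn_field f n v \<in> filt (min d (d - n - 1 - 0))"
      using fn_field_eq_taylor_sum[OF v, of n "nat (d - n - 1)" f]
        order_geD[OF order_b_taylor_sum[unfolded order_b_def] v, of "nat (d - n - 1)" f n] by simp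
  qed
  ultimately show ?thesis
    unfolding is_bfield_def b_bicommutant_def Modules.additive_def by blast
qed

lift_definition subst_field :: "('n::finite) cps \<Rightarrow> 'n bfield" is fn_field
  by (rule is_bfield_fn_field)

lemma order_b_subst_diff: "order_b (int (Suc N)) (subst_field f - taylor_sum N f)"
  unfolding order_b_def order_ge_def
proof (intro allI impI)
  fix n d and v :: "'a cdo" assume v: "v \<in> filt d"
  \<comment> \<open>M is large enough for the Taylor sum to be exact for this mode and vector, and
    at least N, so that only terms of degree above N remain in the difference.\<close>
  define M where "M = max N (nat (d - n - 1))"
  have "taylor_sum M f - taylor_sum N f = (\<Sum>\<alpha>\<in>{\<alpha>. mdeg \<alpha> \<le> M} - {\<alpha>. mdeg \<alpha> \<le> N}. taylor_term f \<alpha>)"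
    unfolding taylor_sum_def by (rule sum_diff [symmetric]) (auto simp: finite_mdeg_le M_def)
  moreover have "order_b (int (Suc N)) (\<Sum>\<alpha>\<in>{\<alpha>. mdeg \<alpha> \<le> M} - {\<alpha>. mdeg \<alpha> \<le> N}. taylor_term f \<alpha>)"
    by (intro order_b_sum order_b_mono[OF order_b_taylor_term]) auto
  ultimately have "order_ge (int (Suc N)) (fmode (taylor_sum M f - taylor_sum N f))"
    by (simp add: order_b_def)
  from order_geD[OF this v, of n]
  have "fmode (taylor_sum M f) n v - fmode (taylor_sum N f) n v \<in> filt (min d (d - n - 1 - int (Suc N)))"
    by (simp add: fmode_minus)
  moreover have "fn_field f n v = fmode (taylor_sum M f) n v"
    by (rule fn_field_eq_taylor_sum[OF v]) (simp add: M_def)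
  ultimately show "fmode (subst_field f - taylor_sum N f) n v \<in> filt (min d (d - n - 1 - int (Suc N)))"
    by (simp add: fmode_minus subst_field.rep_eq)
qed

lemma subst_field_eqI:
  assumes "\<And>N. order_b (int N) (taylor_sum N f - X)"
  shows "subst_field f = X"
proof -
  have "order_b (int N) (subst_field f - X)" for N
  proof -
    have "order_b (int N) (subst_field f - taylor_sum N f)"
      by (rule order_b_mono[OF order_b_subst_diff]) simp
    from order_b_add[OF this assms[of N]] show ?thesis by simp
  qed
  from bfield_eq_0I[OF this] show ?thesis by simp
qed

text \<open>Where \<open>\<alpha> k = 0\<close>, the truncated exponent is accompanied by the
  coefficient 0.\<close>

lemma dfield_shift_power:
  "dfield (shift_power \<alpha>) = (\<Sum>k\<in>UNIV. of_nat (\<alpha> k) * shift_power (\<alpha>(k := \<alpha> k - 1)) * dfield (shift k))"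
proof -
  have "shift k ^ (\<alpha> k - 1) * (\<Prod>i\<in>UNIV - {k}. shift i ^ \<alpha> i) = shift_power (\<alpha>(k := \<alpha> k - 1))" for k
    unfolding shift_power_def by (subst prod.remove[of _ k]) auto
  thus ?thesis
    unfolding shift_power_def[of \<alpha>]
    by (simp add: dfield.prod dfield.power) (simp add: mult_ac)
qed

text \<open>(\<alpha> + e_k)! is (\<alpha>_k + 1) times \<alpha>!. The exponent brought down by d/dz
  therefore turns the shifted Taylor coefficient of f into that of \<partial>_k f.\<close>

lemma taylor_coeff_Suc:
  fixes f :: "('n::finite) cps"
  shows "const_cps (1 / of_nat (mfact (\<alpha>(k := Suc (\<alpha> k))))) * mderiv_cps (\<alpha>(k := Suc (\<alpha> k))) f * of_nat (Suc (\<alpha> k))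
    = const_cps (1 / of_nat (mfact \<alpha>)) * mderiv_cps \<alpha> (pderiv_cps k f)"
proof -
  have "mfact (\<alpha>(k := Suc (\<alpha> k))) = Suc (\<alpha> k) * mfact \<alpha>"
    unfolding mfact_def by (subst (1 2) prod.remove[of _ k]) (simp_all add: algebra_simps)
  hence "1 / of_nat (mfact (\<alpha>(k := Suc (\<alpha> k)))) * of_nat (Suc (\<alpha> k)) = (1 / of_nat (mfact \<alpha>) :: complex)"
    by (simp del: of_nat_Suc mult_Suc)
  hence "const_cps (1 / of_nat (mfact (\<alpha>(k := Suc (\<alpha> k))))) * of_nat (Suc (\<alpha> k)) = (const_cps (1 / of_nat (mfact \<alpha>)) :: 'n cps)"
    by (simp only: const_cps_of_nat [symmetric] const_cps_mult [symmetric])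
  thus ?thesis
    by (simp only: mderiv_Suc mult.assoc mult.commute[of _ "of_nat (Suc (\<alpha> k))"])
       (simp only: mult.assoc [symmetric])
qed

text \<open>The coefficients depend on b_0 alone and are constants for d/dz. Only the powers of the
  shifts are differentiated, which lowers their degree by one and is why \<open>Suc N\<close>
  becomes N.\<close>

lemma dfield_taylor_sum:
  "dfield (taylor_sum (Suc N) f) = (\<Sum>k\<in>UNIV. dfield (shift k) * taylor_sum N (pderiv_cps k f))"
proof -
  let ?c = "\<lambda>f \<alpha>. const_cps (1 / of_nat (mfact \<alpha>)) * mderiv_cps \<alpha> f"
  have md: "mdeg (\<alpha>(k := Suc (\<alpha> k))) = Suc (mdeg \<alpha>)" for \<alpha> :: "'a \<Rightarrow> nat" and k
    unfolding mdeg_def by (subst (1 2) sum.remove[of _ k]) simp_all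
  have "dfield (taylor_sum (Suc N) f) = (\<Sum>\<alpha> | mdeg \<alpha> \<le> Suc N. \<Sum>k\<in>UNIV.
      dfield (shift k) * (cfield (?c f \<alpha> * of_nat (\<alpha> k)) * shift_power (\<alpha>(k := \<alpha> k - 1))))"
    unfolding taylor_sum_def taylor_term_def dfield.sum
    by (simp add: dfield.mult dfield_shift_power sum_distrib_left cfield_mult cfield_of_nat mult_ac)
  also have "\<dots> = (\<Sum>k\<in>UNIV. dfield (shift k) * (\<Sum>\<alpha> | mdeg \<alpha> \<le> Suc N.
      cfield (?c f \<alpha> * of_nat (\<alpha> k)) * shift_power (\<alpha>(k := \<alpha> k - 1))))"
    by (subst sum.swap) (simp add: sum_distrib_left)
  also have "\<dots> = (\<Sum>k\<in>UNIV. dfield (shift k) * taylor_sum N (pderiv_cps k f))"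
  proof (intro sum.cong refl arg_cong[of _ _ "(*) _"])
    fix k
    have "(\<Sum>\<alpha> | mdeg \<alpha> \<le> Suc N. cfield (?c f \<alpha> * of_nat (\<alpha> k)) * shift_power (\<alpha>(k := \<alpha> k - 1)))
        = (\<Sum>\<alpha>\<in>{\<alpha>. mdeg \<alpha> \<le> Suc N \<and> \<alpha> k \<noteq> 0}. cfield (?c f \<alpha> * of_nat (\<alpha> k)) * shift_power (\<alpha>(k := \<alpha> k - 1)))"
      by (intro sum.mono_neutral_right) (auto simp: finite_mdeg_le)
    also have "\<dots> = (\<Sum>\<alpha> | mdeg \<alpha> \<le> N. cfield (?c f (\<alpha>(k := Suc (\<alpha> k))) * of_nat (Suc (\<alpha> k))) * shift_power \<alpha>)"
    proof (rule sum.reindex_bij_witness[of _ "\<lambda>\<alpha>. \<alpha>(k := Suc (\<alpha> k))" "\<lambda>\<alpha>. \<alpha>(k := \<alpha> k - 1)"], goal_cases)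
      case (2 \<alpha>)
      thus ?case using md[of "\<alpha>(k := \<alpha> k - 1)" k] by simp
    next
      case (4 \<alpha>)
      thus ?case by (simp add: md)
    qed (simp_all del: of_nat_Suc)
    finally show "(\<Sum>\<alpha> | mdeg \<alpha> \<le> Suc N. cfield (?c f \<alpha> * of_nat (\<alpha> k)) * shift_power (\<alpha>(k := \<alpha> k - 1)))
        = taylor_sum N (pderiv_cps k f)"
      by (simp only: taylor_coeff_Suc taylor_sum_def taylor_term_def)
  qed
  finally show ?thesis .
qed

lemma dfield_subst_field:
  "dfield (subst_field f) = (\<Sum>k\<in>UNIV. dfield (coord_field k) * subst_field (pderiv_cps k f))"
proof -
  \<comment> \<open>The chain rule is exact on Taylor sums, so only the two remainders are left.
    Differentiation costs a remainder one order, which still leaves order N.\<close>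
  have "order_b (int N) (dfield (subst_field f) - (\<Sum>k\<in>UNIV. dfield (coord_field k) * subst_field (pderiv_cps k f)))" for N
  proof -
    have "dfield (subst_field f) - (\<Sum>k\<in>UNIV. dfield (coord_field k) * subst_field (pderiv_cps k f))
       = dfield (subst_field f - taylor_sum (Suc N) f)
         - (\<Sum>k\<in>UNIV. dfield (shift k) * (subst_field (pderiv_cps k f) - taylor_sum N (pderiv_cps k f)))"
      by (simp add: dfield.diff dfield_taylor_sum dfield_coord_field right_diff_distrib sum_subtractf)
    moreover have "order_b (int N) (dfield (subst_field f - taylor_sum (Suc N) f))"
      by (rule order_b_mono[OF order_b_dfield[OF order_b_subst_diff]]) simp
    moreover have "order_b (int N) (dfield (shift k) * (subst_field h - taylor_sum N h))" for k h
      by (rule order_b_mono[OF order_b_mult[OF order_b_dfield[OF order_b_shift] order_b_subst_diff]]) simp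
    ultimately show ?thesis
      by (simp only:) (intro order_b_diff order_b_sum; simp)
  qed
  from bfield_eq_0I[OF this] show ?thesis by simp
qed

lemma subst_field_add: "subst_field (f + g) = subst_field f + subst_field g"
proof (rule subst_field_eqI)
  fix N
  have "taylor_sum N (f + g) = taylor_sum N f + taylor_sum N g"
    by (simp add: taylor_sum_def taylor_term_def mderiv_add distrib_left distrib_right cfield_add sum.distrib)
  hence "taylor_sum N (f + g) - (subst_field f + subst_field g)
      = - (subst_field f - taylor_sum N f) - (subst_field g - taylor_sum N g)" by simp
  thus "order_b (int N) (taylor_sum N (f + g) - (subst_field f + subst_field g))"
    by (simp only:) (intro order_b_diff order_b_uminus order_b_mono[OF order_b_subst_diff]; simp)
qed

lemma taylor_sum_0: "taylor_sum 0 f = cfield f"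
proof -
  have "{\<alpha> :: 'a \<Rightarrow> nat. mdeg \<alpha> \<le> 0} = {\<lambda>_. 0}"
    by (simp add: mdeg_eq_0_iff)
  thus ?thesis
    by (simp add: taylor_sum_def taylor_term_def mderiv_0 shift_power_def mfact_def const_cps_1)
qed

lemma subst_field_1: "subst_field (1 :: ('n::finite) cps) = 1"
proof (rule subst_field_eqI)
  fix N
  have "taylor_sum N (1 :: 'n cps) = (\<Sum>\<alpha>\<in>{\<lambda>_. 0}. taylor_term 1 \<alpha>)"
    unfolding taylor_sum_def
    by (intro sum.mono_neutral_right) (auto simp: finite_mdeg_le mdeg_0 taylor_term_def mderiv_1)
  also have "\<dots> = 1"
    by (simp add: taylor_term_def mderiv_0 shift_power_def mfact_def const_cps_1 cfield_1)
  finally show "order_b (int N) (taylor_sum N (1 :: 'n cps) - 1)" by (simp add: order_b_0)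
qed

lemma dfield_dfield_subst_field:
  "dfield (dfield (subst_field f)) =
     (\<Sum>k\<in>UNIV. dfield (dfield (coord_field k)) * subst_field (pderiv_cps k f))
     + (\<Sum>k\<in>UNIV. \<Sum>l\<in>UNIV. dfield (coord_field k) * dfield (coord_field l) * subst_field (pderiv_cps l (pderiv_cps k f)))"
  by (simp add: dfield_subst_field dfield.sum dfield.mult sum.distrib sum_distrib_left mult.assoc)


section \<open>Additivity of the state-field correspondence\<close>

text \<open>The general notion of field: it also covers \<open>a_field\<close>, which does not
  belong to the commutative ring. Truncation makes both sums in \<open>nop\<close> finite on each
  vector.\<close>

definition is_field :: "('n::finite) vfield \<Rightarrow> bool" where
  "is_field X \<longleftrightarrow> (\<forall>n. Modules.additive (X n)) \<and> (\<forall>v. \<exists>N. \<forall>n\<ge>N. X n v = 0)"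

lemma is_fieldD: "is_field X \<Longrightarrow> Modules.additive (X n)" "is_field X \<Longrightarrow> X n 0 = 0"
  by (auto simp: is_field_def additive.zero)

lemma is_field_truncated:
  assumes "is_field X"
  shows "\<exists>N::nat. \<forall>n\<ge>int N. X n v = 0"
proof -
  obtain N where "\<forall>n\<ge>N. X n v = 0" using assms unfolding is_field_def by blast
  hence "\<forall>n\<ge>int (nat N). X n v = 0" by auto
  thus ?thesis by blast
qed

lemma is_field_fmode: "is_field (fmode X)"
proof -
  have "\<exists>N. \<forall>n\<ge>N. fmode X n v = 0" for v
  proof -
    obtain k d where k: "order_ge k (fmode X)" and d: "v \<in> filt d"
      using is_bfield_fmode[of X] ex_filt[of v] unfolding is_bfield_def by blast
    have "fmode X n v = 0" if "n \<ge> d - k" for n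
      by (rule order_ge_zero[OF k d]) (use that in linarith)
    thus ?thesis by blast
  qed
  thus ?thesis by (simp add: is_field_def fmode_additive)
qed

lemma additive_map_pderiv: "Modules.additive (Poly_Mapping.map (pderiv_cps (i :: 'n::finite)) :: 'n cdo \<Rightarrow> 'n cdo)"
proof
  fix u v :: "'n cdo"
  show "Poly_Mapping.map (pderiv_cps i) (u + v) = Poly_Mapping.map (pderiv_cps i) u + Poly_Mapping.map (pderiv_cps i) v"
    by (rule poly_mapping_eqI)
       (auto simp: map.rep_eq lookup_add pderiv.add pderiv.zero when_def, metis pderiv.add pderiv.zero)
qed

lemma is_field_a_field: "is_field (a_field i)"
proof -
  have "Modules.additive (a_field i n)" for n
    unfolding a_field_def a_mode_def
    by (cases "n < 0"; cases "n = 0") (simp_all add: additive_mult_left additive_map_pderiv additive_dvar)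
  moreover have "\<exists>N. \<forall>n\<ge>N. a_field i n v = 0" for v
  proof -
    \<comment> \<open>Only finitely many variables occur in v, and differentiation in any other one
      kills v.\<close>
    let ?S = "(\<lambda>k. Bmode i k) -` (\<Union>m\<in>Poly_Mapping.keys v. Poly_Mapping.keys m)"
    have "finite ?S" by (rule finite_vimageI) (auto simp: inj_on_def)
    then obtain K where "\<forall>k\<in>?S. k < K" by (auto simp only: finite_nat_set_iff_bounded)
    hence K: "\<And>k. k \<in> ?S \<Longrightarrow> k < K" by blast
    have "a_field i n v = 0" if "n \<ge> int K + 1" for n
    proof -
      have "\<not> nat (n - 1) < K" using that by linarith
      hence "nat (n - 1) \<notin> ?S" using K by blast
      hence "Poly_Mapping.lookup m (Bmode i (nat (n - 1))) = 0" if "m \<in> Poly_Mapping.keys v" for m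
        using that by (auto simp: in_keys_iff)
      with that show ?thesis by (simp add: a_field_def a_mode_def dvar_def)
    qed
    thus ?thesis by blast
  qed
  ultimately show ?thesis by (simp add: is_field_def)
qed

lemma is_field_scl_field:
  assumes "is_field X"
  shows "is_field (scl_field c X)"
proof -
  have "\<exists>N. \<forall>n\<ge>N. scl_field c X n v = 0" for v
  proof -
    obtain N where "\<forall>n\<ge>N. X n v = 0" using assms unfolding is_field_def by blast
    hence "\<forall>n\<ge>N. scl_field c X n v = 0" by (simp add: scl_field_def)
    thus ?thesis by blast
  qed
  thus ?thesis
    using assms unfolding is_field_def scl_field_def[abs_def] by (simp add: additive_comp[OF additive_scl])
qed

lemma is_field_deriv_field: 
  assumes "is_field X"
  shows "is_field (deriv_field X)"
proof -
  have "\<exists>N. \<forall>n\<ge>N. deriv_field X n v = 0" for v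
  proof -
    obtain N where "\<forall>n\<ge>N. X n v = 0" using assms unfolding is_field_def by blast
    hence "\<forall>n\<ge>N + 1. deriv_field X n v = 0" by (simp add: deriv_field_def)
    thus ?thesis by blast
  qed
  thus ?thesis
    using assms unfolding is_field_def deriv_field_def[abs_def] by (simp add: additive_comp[OF additive_scl])
qed

lemma is_field_funpow_deriv: "is_field X \<Longrightarrow> is_field ((deriv_field ^^ k) X)"
  by (induction k) (auto intro: is_field_deriv_field)

lemma nop_finite:
  assumes X: "is_field X" and Y: "is_field Y"
  shows "finite {k::nat. X (- 1 - int k) (Y (n + int k) v) \<noteq> 0}"
    and "finite {k::nat. Y (n - 1 - int k) (X (int k) v) \<noteq> 0}"
proof -
  obtain N where N: "\<And>m. m \<ge> int N \<Longrightarrow> Y m v = 0" using is_field_truncated[OF Y, of v] by blast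
  have "Y (n + int k) v = 0" if "k \<ge> N + nat (- n)" for k
    by (rule N) (use that in linarith)
  hence "{k::nat. X (- 1 - int k) (Y (n + int k) v) \<noteq> 0} \<subseteq> {..<N + nat (- n)}"
    using is_fieldD(2)[OF X] by (force simp: not_less[symmetric])
  thus "finite {k::nat. X (- 1 - int k) (Y (n + int k) v) \<noteq> 0}" by (rule finite_subset) simp
  obtain M where M: "\<And>m. m \<ge> int M \<Longrightarrow> X m v = 0" using is_field_truncated[OF X, of v] by blast
  have "{k::nat. Y (n - 1 - int k) (X (int k) v) \<noteq> 0} \<subseteq> {..<M}"
  proof
    fix k assume "k \<in> {k::nat. Y (n - 1 - int k) (X (int k) v) \<noteq> 0}"
    hence "X (int k) v \<noteq> 0" using is_fieldD(2)[OF Y] by auto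
    thus "k \<in> {..<M}" using M[of "int k"] by force
  qed
  thus "finite {k::nat. Y (n - 1 - int k) (X (int k) v) \<noteq> 0}" by (rule finite_subset) simp
qed

lemma nop_eq_sums:
  assumes X: "is_field X" and Y: "is_field Y"
  shows "nop X Y n v = Sum_any (\<lambda>k::nat. X (- 1 - int k) (Y (n + int k) v)) + Sum_any (\<lambda>k::nat. Y (n - 1 - int k) (X (int k) v))"
  unfolding nop_def by (rule Sum_any.distrib) (rule nop_finite[OF X Y])+

lemma is_field_nop:
  assumes X: "is_field X" and Y: "is_field Y"
  shows "is_field (nop X Y)"
proof -
  note fin = nop_finite[OF X Y]
  have "nop X Y n (u + v) = nop X Y n u + nop X Y n v" for n u v
    unfolding nop_eq_sums[OF X Y]
    by (simp add: additiveD[OF is_fieldD(1)[OF X]] additiveD[OF is_fieldD(1)[OF Y]] Sum_any.distrib fin)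
  moreover have "\<exists>N. \<forall>n\<ge>N. nop X Y n v = 0" for v
  proof -
    obtain N where N: "\<And>m. m \<ge> int N \<Longrightarrow> Y m v = 0" using is_field_truncated[OF Y, of v] by blast
    obtain M where M: "\<And>m. m \<ge> int M \<Longrightarrow> X m v = 0" using is_field_truncated[OF X, of v] by blast
    have "\<forall>k. \<exists>P::nat. \<forall>m\<ge>int P. Y m (X (int k) v) = 0"
      using is_field_truncated[OF Y] by metis
    then obtain P :: "nat \<Rightarrow> nat" where P: "\<And>k m. m \<ge> int (P k) \<Longrightarrow> Y m (X (int k) v) = 0"
      by metis
    \<comment> \<open>S dominates the truncation bounds of Y on the finitely many nonzero vectors
      \<open>X (int k) v\<close>; the extra M + 1 below pays for the shift of the mode by k +
      1.\<close>
    define S where "S = (\<Sum>k<M. P k)"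
    have "nop X Y n v = 0" if n: "n \<ge> int (N + S + M + 1)" for n
    proof -
      have "Y (n + int k) v = 0" for k
        using N n by simp
      moreover have "Y (n - 1 - int k) (X (int k) v) = 0" for k
      proof (cases "k < M")
        case True
        have "P k \<le> S" using True unfolding S_def by (intro member_le_sum) auto
        thus ?thesis using n True by (intro P) linarith
      qed (simp add: M is_fieldD(2)[OF Y])
      ultimately show ?thesis by (simp add: nop_def is_fieldD(2)[OF X])
    qed
    thus ?thesis by blast
  qed
  ultimately show ?thesis by (simp add: is_field_def Modules.additive_def)
qed

lemma nop_add_right:
  assumes X: "is_field X" and Y: "is_field Y" and Z: "is_field Z"
  shows "nop X (\<lambda>n v. Y n v + Z n v) = (\<lambda>n v. nop X Y n v + nop X Z n v)"
proof (intro ext)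
  fix n v
  have "nop X (\<lambda>n v. Y n v + Z n v) n v =
      Sum_any (\<lambda>k::nat. (X (- 1 - int k) (Y (n + int k) v) + Y (n - 1 - int k) (X (int k) v))
        + (X (- 1 - int k) (Z (n + int k) v) + Z (n - 1 - int k) (X (int k) v)))"
    unfolding nop_def by (simp add: additiveD[OF is_fieldD(1)[OF X]] algebra_simps)
  also have "\<dots> = nop X Y n v + nop X Z n v"
    unfolding nop_def
  proof (rule Sum_any.distrib)
    have fin: "finite {k. X (- 1 - int k) (Y (n + int k) v) + Y (n - 1 - int k) (X (int k) v) \<noteq> 0}" if Y: "is_field Y" for Y
      by (rule finite_subset[OF _ finite_UnI[OF nop_finite[OF X Y, of n v]]]) auto
    from fin[OF Y] fin[OF Z]
    show "finite {k. X (- 1 - int k) (Y (n + int k) v) + Y (n - 1 - int k) (X (int k) v) \<noteq> 0}"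
      "finite {k. X (- 1 - int k) (Z (n + int k) v) + Z (n - 1 - int k) (X (int k) v) \<noteq> 0}" .
  qed
  finally show "nop X (\<lambda>n v. Y n v + Z n v) n v = nop X Y n v + nop X Z n v" .
qed

lemma is_field_mode_field: "is_field (mode_field x)"
proof (cases x)
  case (Bmode i k)
  have "is_field (b_field i)" using is_field_fmode[of "coord_field i"] by (simp add: fmode_coord_field)
  with Bmode show ?thesis
    by (simp only: mode_field.simps) (intro is_field_scl_field is_field_funpow_deriv)
qed (simp add: is_field_scl_field is_field_funpow_deriv is_field_a_field)

lemma foldr_nop_add:
  assumes "\<And>x. is_field (F x)" "is_field Y" "is_field Z"
  shows "foldr (\<lambda>x. nop (F x)) xs (\<lambda>n v. Y n v + Z n v)
      = (\<lambda>n v. foldr (\<lambda>x. nop (F x)) xs Y n v + foldr (\<lambda>x. nop (F x)) xs Z n v)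
    \<and> is_field (foldr (\<lambda>x. nop (F x)) xs Y) \<and> is_field (foldr (\<lambda>x. nop (F x)) xs Z)"
  by (induction xs) (simp_all add: assms nop_add_right is_field_nop)

lemma is_field_fn_field: "is_field (fn_field f)"
  using is_field_fmode[of "subst_field f"] by (simp add: subst_field.rep_eq)

text \<open>Adding states adds the coefficients of equal monomials, so additivity of
  \<open>state_field\<close> needs additivity in the coefficient. This passes from the innermost
  factor \<open>fn_field\<close> outwards through the normally ordered products.\<close>

lemma monom_field_add: "monom_field m (f + g) n w = monom_field m f n w + monom_field m g n w"
proof -
  have 1: "fn_field (f + g) = (\<lambda>n v. fn_field f n v + fn_field g n v)"
    by (simp add: fun_eq_iff subst_field_add fmode_plus flip: subst_field.rep_eq)
  have 2: "is_field ((\<lambda>(i, k). mode_field (Bmode i k)) x)" "is_field ((\<lambda>(i, k). mode_field (Amode i k)) x)" for x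
    by (cases x; simp only: case_prod_conv is_field_mode_field)+
  have 3: "(\<lambda>(i, k). nop (mode_field (C i k))) = (\<lambda>x. nop ((\<lambda>(i, k). mode_field (C i k)) x))" for C :: "'a \<Rightarrow> nat \<Rightarrow> 'a mode"
    by auto
  note 4 = foldr_nop_add[where F = "\<lambda>(i, k). mode_field (Bmode i k)", OF 2(1) is_field_fn_field is_field_fn_field]
  note 5 = foldr_nop_add[where F = "\<lambda>(i, k). mode_field (Amode i k)", OF 2(2)]
  show ?thesis
    unfolding monom_field_def 1 3
    by (simp only: conjunct1[OF 4] conjunct1[OF 5[OF conjunct1[OF conjunct2[OF 4]] conjunct2[OF conjunct2[OF 4]]]])
qed

lemma monom_field_0: "monom_field m 0 n w = 0"
  using monom_field_add[of m 0 0 n w] by simp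

lemma state_field_add: "state_field (u + v) n w = state_field u n w + state_field v n w"
  unfolding state_field_def
  by (rule setsum_keys_plus_distrib) (simp_all add: monom_field_0 monom_field_add)

lemma additive_state_field: "Modules.additive (\<lambda>u. state_field u n w)"
  by (simp add: Modules.additive_def state_field_add)

lemma state_field_single: "state_field (Poly_Mapping.single m f) n w = monom_field m f n w"
  by (simp add: state_field_def monom_field_0)


section \<open>The fields of some states\<close>

text \<open>Since the coefficients commute, the two parts of \<open>nop\<close> are the halves j < 0
  and j \<ge> 0 of the sum defining the product. A common cutoff is used because paired terms could
  cancel without vanishing separately.\<close>

lemma nop_bfield: "nop (fmode X) (fmode Y) = fmode (X * Y)"
proof (intro ext)
  fix n v
  let ?h = "\<lambda>j. fmode X j (fmode Y (n - 1 - j) v)"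
  have "finite {j. ?h j \<noteq> 0}"
    by (rule mult_field_finite) (rule is_bfield_fmode)+
  then obtain M where M: "\<And>j. ?h j \<noteq> 0 \<Longrightarrow> nat \<bar>j\<bar> \<le> M"
    using finite_nat_set_iff_bounded_le[of "(\<lambda>j. nat \<bar>j\<bar>) ` {j. ?h j \<noteq> 0}"] by auto
  have "nop (fmode X) (fmode Y) n v = Sum_any (\<lambda>k::nat. ?h (- 1 - int k) + ?h (int k))"
    by (simp add: nop_def b_bicommutant_commute[OF fmode_bicommutant[of Y] fmode_bicommutant[of X]] algebra_simps)
  also have "\<dots> = (\<Sum>k\<le>M. ?h (- 1 - int k) + ?h (int k))"
  proof (rule Sum_any.expand_superset)
    show "{k. ?h (- 1 - int k) + ?h (int k) \<noteq> 0} \<subseteq> {..M}"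
    proof
      fix k assume "k \<in> {k. ?h (- 1 - int k) + ?h (int k) \<noteq> 0}"
      hence "?h (- 1 - int k) \<noteq> 0 \<or> ?h (int k) \<noteq> 0" by force
      thus "k \<in> {..M}" using M[of "- 1 - int k"] M[of "int k"] by auto
    qed
  qed simp
  also have "\<dots> = (\<Sum>j\<in>{- 1 - int M..-1}. ?h j) + (\<Sum>j\<in>{0..int M}. ?h j)"
    unfolding sum.distrib
  proof (rule arg_cong2[of _ _ _ _ "(+)"])
    show "(\<Sum>k\<le>M. ?h (- 1 - int k)) = (\<Sum>j\<in>{- 1 - int M..-1}. ?h j)"
      by (rule sum.reindex_bij_witness[of _ "\<lambda>j. nat (- 1 - j)" "\<lambda>k. - 1 - int k"]) auto
    show "(\<Sum>k\<le>M. ?h (int k)) = (\<Sum>j\<in>{0..int M}. ?h j)"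
      by (rule sum.reindex_bij_witness[of _ nat int]) auto
  qed
  also have "\<dots> = (\<Sum>j\<in>{- 1 - int M..-1} \<union> {0..int M}. ?h j)"
    by (rule sum.union_disjoint [symmetric]) auto
  also have "\<dots> = Sum_any ?h"
  proof (rule Sum_any.expand_superset [symmetric])
    show "{j. ?h j \<noteq> 0} \<subseteq> {- 1 - int M..-1} \<union> {0..int M}"
    proof
      fix j assume "j \<in> {j. ?h j \<noteq> 0}"
      thus "j \<in> {- 1 - int M..-1} \<union> {0..int M}" using M[of j] by auto
    qed
  qed simp
  finally show "nop (fmode X) (fmode Y) n v = fmode (X * Y) n v" by (simp add: fmode_times)
qed

lemma nop_id_field:
  assumes X: "is_field X"
  shows "nop X id_field = X"
proof (intro ext)
  fix n v
  \<comment> \<open>The identity has only the mode -1: for n < 0 it is met in the first part of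
    \<open>nop\<close>, at k = -1-n, and for n \<ge> 0 in the second, at k = n.\<close>
  have "nop X id_field n v = Sum_any (\<lambda>k::nat. if k = nat (if n < 0 then - 1 - n else n) then X n v else 0)"
    unfolding nop_def
    by (rule Sum_any.cong) (auto simp: id_field_def is_fieldD(2)[OF X])
  thus "nop X id_field n v = X n v" by simp
qed

lemma scl_field_1: "scl_field 1 X = X"
  by (simp add: fun_eq_iff scl_field_def)

definition Bmode_field :: "'n \<times> nat \<Rightarrow> ('n::finite) bfield" where
  "Bmode_field = (\<lambda>(i, k). cfield (const_cps (1 / fact (k + 1))) * (dfield ^^ (k + 1)) (coord_field i))"

lemma fmode_scl: "fmode (cfield (const_cps c) * X) = scl_field c (fmode X)"
  by (simp add: fun_eq_iff scl_field_def fmode_cfield_mult scl_def)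

lemma fmode_Bmode_field: "fmode (Bmode_field (i, k)) = mode_field (Bmode i k)"
proof -
  have "fmode ((dfield ^^ m) X) = (deriv_field ^^ m) (fmode X)" for m :: nat and X :: "'a bfield"
    by (induction m) (simp_all add: dfield.rep_eq)
  thus ?thesis
    by (simp only: Bmode_field_def case_prod_conv fmode_scl mode_field.simps fmode_coord_field)
qed

lemma mset_list_of:
  assumes "\<And>x. c x = count M x"
  shows "mset (list_of c) = M"
proof (rule multiset_eqI)
  fix x
  have "finite {x. c x \<noteq> 0}" by (simp add: assms)
  from count_list_of[OF this, of x] have "count (mset (list_of c)) x = c x"
    by (simp only: count_mset)
  thus "count (mset (list_of c)) x = count M x" by (simp only: assms)
qed

text \<open>All factors lie in the commutative ring, so the nested normally ordered product is a
  ring product over a multiset, independent of the list chosen by \<open>list_of\<close>.\<close>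

lemma B_part:
  fixes m :: "('n::finite) mode \<Rightarrow>\<^sub>0 nat"
  assumes "\<And>i k. Poly_Mapping.lookup m (Bmode i k) = count M (i, k)"
  shows "foldr (\<lambda>(i, k). nop (mode_field (Bmode i k))) (list_of (\<lambda>(i, k). Poly_Mapping.lookup m (Bmode i k))) (fn_field f)
     = fmode (prod_mset (image_mset Bmode_field M) * subst_field f)"
proof -
  have "foldr (\<lambda>(i, k). nop (mode_field (Bmode i k))) xs (fmode Y) = fmode (prod_list (map Bmode_field xs) * Y)"
    for xs and Y :: "'n bfield"
  proof (induction xs)
    case (Cons x xs)
    obtain i k where x: "x = (i, k)" by (cases x)
    have "foldr (\<lambda>(i, k). nop (mode_field (Bmode i k))) (x # xs) (fmode Y)
        = nop (fmode (Bmode_field x)) (foldr (\<lambda>(i, k). nop (mode_field (Bmode i k))) xs (fmode Y))"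
      by (simp only: x fmode_Bmode_field foldr_Cons o_apply case_prod_conv)
    also have "\<dots> = fmode (prod_list (map Bmode_field (x # xs)) * Y)"
      by (simp only: Cons.IH nop_bfield list.map prod_list.Cons mult.assoc)
    finally show ?case .
  qed simp
  moreover have "mset (list_of (\<lambda>(i, k). Poly_Mapping.lookup m (Bmode i k))) = M"
    by (rule mset_list_of) (auto simp: assms)
  moreover have "prod_list (map Bmode_field xs) = prod_mset (image_mset Bmode_field (mset xs))" for xs :: "('n \<times> nat) list"
    by (simp flip: prod_mset_prod_list)
  ultimately show ?thesis
    by (simp only: subst_field.rep_eq [symmetric])
qed

lemma state_field_B_monomial:
  assumes "\<And>i k. Poly_Mapping.lookup m (Amode i k) = 0" "\<And>i k. Poly_Mapping.lookup m (Bmode i k) = count M (i, k)"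
  shows "state_field (Poly_Mapping.single m f) n w = fmode (prod_mset (image_mset Bmode_field M) * subst_field f) n w"
proof -
  have "list_of (\<lambda>(i, k). Poly_Mapping.lookup m (Amode i k)) = []"
    using mset_list_of[of "\<lambda>(i, k). Poly_Mapping.lookup m (Amode i k)" "{#}"] by (auto simp: assms)
  thus ?thesis
    by (simp only: state_field_single monom_field_def B_part[OF assms(2)] foldr_Nil id_apply)
qed

lemma state_field_A_B_monomial:
  assumes "\<And>i k. Poly_Mapping.lookup m (Amode i k) = (if (i, k) = (j, 0) then 1 else 0)"
    "\<And>i k. Poly_Mapping.lookup m (Bmode i k) = count M (i, k)"
  shows "state_field (Poly_Mapping.single m f) n w
    = nop (a_field j) (fmode (prod_mset (image_mset Bmode_field M) * subst_field f)) n w"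
proof -
  have "mset (list_of (\<lambda>(i, k). Poly_Mapping.lookup m (Amode i k))) = {#(j, 0)#}"
    by (rule mset_list_of) (auto simp: assms split: if_splits)
  hence "list_of (\<lambda>(i, k). Poly_Mapping.lookup m (Amode i k)) = [(j, 0)]" by simp
  moreover have "mode_field (Amode j 0) = a_field j" by (simp add: scl_field_1)
  ultimately show ?thesis
    by (simp only: state_field_single monom_field_def B_part[OF assms(2)] foldr_Nil id_apply foldr_Cons o_apply case_prod_conv)
qed

lemma mvar_fn: "mvar x * fn f = Poly_Mapping.single (Poly_Mapping.single x 1) f"
  by (simp add: fn_def mvar_single)

lemma Bmode_field_0: "Bmode_field (i, 0) = dfield (coord_field i)"
  by (simp add: Bmode_field_def const_cps_1 cfield_1)

lemma Bmode_field_1: "Bmode_field (i, 1) = cfield (const_cps (1/2)) * dfield (dfield (coord_field i))"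
  by (simp add: Bmode_field_def)

lemma state_field_fn: "state_field (fn f) = fn_field f"
  by (intro ext, unfold fn_def, subst state_field_B_monomial[where M = "{#}"]) (simp_all add: subst_field.rep_eq)

lemma state_field_B0: "state_field (mvar (Bmode k 0) * fn f) n w = fmode (dfield (coord_field k) * subst_field f) n w"
  unfolding mvar_fn
  by (subst state_field_B_monomial[where M = "{#(k, 0)#}"])
     (auto simp: lookup_single when_def Bmode_field_0)

lemma state_field_B1:
  "state_field (mvar (Bmode k 1) * fn f) n w
    = fmode (cfield (const_cps (1/2)) * dfield (dfield (coord_field k)) * subst_field f) n w"
  unfolding mvar_fn
  by (subst state_field_B_monomial[where M = "{#(k, 1)#}"])
     (auto simp: lookup_single when_def Bmode_field_1 simp del: One_nat_def)

lemma state_field_B0_B0: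
  "state_field (mvar (Bmode k 0) * (mvar (Bmode l 0) * fn f)) n w
    = fmode (dfield (coord_field k) * dfield (coord_field l) * subst_field f) n w"
  unfolding mvar_fn mvar_single
  by (subst state_field_B_monomial[where M = "{#(k, 0), (l, 0)#}"])
     (auto simp: lookup_single lookup_add when_def Bmode_field_0 mult.assoc)

lemma state_field_A: "state_field (mvar (Amode j 0) * fn f) = nop (a_field j) (fn_field f)"
  unfolding mvar_fn
  by (intro ext, subst state_field_A_B_monomial[where M = "{#}" and j = j])
     (auto simp: lookup_single when_def subst_field.rep_eq)

lemma state_field_A_1: "state_field (mvar (Amode j 0)) = a_field j"
proof -
  have "fn_field (1 :: 'a cps) = id_field"
    using subst_field_1 subst_field.rep_eq one_bfield.rep_eq by metis
  thus ?thesis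
    using state_field_A[of j 1] by (simp add: fn_1 nop_id_field is_field_a_field)
qed

lemma state_field_A_B:
  "state_field (mvar (Amode i 0) * mvar (Bmode i 0)) n w = nop (a_field i) (deriv_field (b_field i)) n w"
proof -
  have "mvar (Amode i 0) * mvar (Bmode i 0)
      = Poly_Mapping.single (Poly_Mapping.single (Amode i 0) 1 + Poly_Mapping.single (Bmode i 0) 1) 1"
    by (simp add: mvar_def mult_single)
  thus ?thesis
    by (simp only:) (subst state_field_A_B_monomial[where M = "{#(i, 0)#}" and j = i],
      auto simp: lookup_single lookup_add when_def Bmode_field_0 subst_field_1 dfield.rep_eq fmode_coord_field)
qed

lemma state_field_virasoro: "state_field virasoro_state = virasoro_field"
  by (simp add: fun_eq_iff virasoro_state_def virasoro_field_def additive.sum[OF additive_state_field] state_field_A_B)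


section \<open>The identities for the coordinate change\<close>

lemma sum_rotate: "(\<Sum>i\<in>A. \<Sum>j\<in>B. \<Sum>l\<in>C. F i j l) = (\<Sum>l\<in>C. \<Sum>i\<in>A. \<Sum>j\<in>B. F i j l)"
  by (rule trans[OF sum.cong[OF refl sum.swap] sum.swap])

lemma sum_swap_pairs:
  "(\<Sum>i\<in>A. \<Sum>j\<in>B. \<Sum>l\<in>C. \<Sum>k\<in>E. F i j l k) = (\<Sum>l\<in>C. \<Sum>k\<in>E. \<Sum>i\<in>A. \<Sum>j\<in>B. F i j l k)"
  by (rule trans[OF sum_rotate sum.cong[OF refl sum_rotate]])

lemma matrix_inv_eqI:
  fixes A :: "'a::semiring_1^'n^'n"
  assumes "A ** B = mat 1" "B ** A = mat 1"
  shows "matrix_inv A = B"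
proof -
  have "invertible A" using assms unfolding invertible_def by blast
  from matrix_inv_both[OF this] have "matrix_inv A ** (A ** B) = B"
    by (simp add: matrix_mul_assoc)
  thus ?thesis by (simp add: assms)
qed

text \<open>Taking the constant term is a ring homomorphism. Nondegeneracy of the Jacobian at 0
  thereby makes its determinant a unit.\<close>

lemma coeff_0_det: "coeff (det A) (\<lambda>_. 0) = det (\<chi> i j. coeff (A $ i $ j) (\<lambda>_. 0))"
  for A :: "('n::finite) cps ^ 'n ^ 'n"
proof -
  have "coeff (\<Prod>i\<in>I. f i) (\<lambda>_. 0) = (\<Prod>i\<in>I. coeff (f i) (\<lambda>_. 0))" for I :: "'n set" and f :: "'n \<Rightarrow> 'n cps"
    by (induction I rule: infinite_finite_induct) (simp_all add: coeff_1 coeff_mult_0)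
  moreover have "coeff (of_int (sign p) :: 'n cps) (\<lambda>_. 0) = of_int (sign p)" for p :: "'n \<Rightarrow> 'n"
    by (simp add: sign_def coeff_1)
  ultimately show ?thesis
    by (simp add: det_def coeff_sum coeff_mult_0)
qed

context
  fixes g :: "('n::finite) cps ^ 'n"
  assumes g: "coordinate_change g"
begin

lemma det_jac_0: "coeff (det (jac g)) (\<lambda>_. 0) \<noteq> 0"
  using g by (simp add: coordinate_change_def coeff_0_det)

lemma jac_inverse: "jac g ** matrix_inv (jac g) = mat 1" "matrix_inv (jac g) ** jac g = mat 1"
  using cps_unit[OF det_jac_0] invertible_of_det_unit[of "jac g"] matrix_inv_both[of "jac g"] by blast+

lemma phi_jac: "(\<Sum>i\<in>UNIV. phi g $ j $ i * pderiv_cps k (g $ i)) = (if j = k then 1 else 0)"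
proof -
  have "(\<Sum>i\<in>UNIV. phi g $ j $ i * pderiv_cps k (g $ i)) = (jac g ** matrix_inv (jac g)) $ k $ j"
    by (simp add: matrix_matrix_mult_def phi_def transpose_def jac_def mult.commute)
  thus ?thesis by (auto simp: jac_inverse mat_def)
qed

lemma jac_phi: "(\<Sum>r\<in>UNIV. phi g $ r $ i * pderiv_cps r (g $ s)) = (if i = s then 1 else 0)"
proof -
  have "(\<Sum>r\<in>UNIV. phi g $ r $ i * pderiv_cps r (g $ s)) = (matrix_inv (jac g) ** jac g) $ i $ s"
    by (simp add: matrix_matrix_mult_def phi_def transpose_def jac_def)
  thus ?thesis by (simp add: jac_inverse mat_def)
qed

lemma pderiv_phi_jac:
  "(\<Sum>i\<in>UNIV. pderiv_cps l (phi g $ j $ i) * pderiv_cps k (g $ i))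
    = - (\<Sum>i\<in>UNIV. phi g $ j $ i * pderiv_cps l (pderiv_cps k (g $ i)))"
proof -
  have "pderiv_cps l (\<Sum>i\<in>UNIV. phi g $ j $ i * pderiv_cps k (g $ i)) = 0"
    by (simp add: phi_jac pderiv.zero)
  thus ?thesis
    by (simp add: pderiv.sum pderiv_mult sum.distrib eq_neg_iff_add_eq_0)
qed

text \<open>Jacobi's formula gives the trace of \<phi>^t with the derivative of \<partial>g.
  Differentiating the inverse relation moves the derivative onto \<phi>, the form in which the
  contraction with a_1 produces it.\<close>

lemma pderiv_log_det:
  "pderiv_cps l (ln_cps (det (jac g))) = - (\<Sum>j\<in>UNIV. \<Sum>i\<in>UNIV. pderiv_cps l (phi g $ j $ i) * pderiv_cps j (g $ i))"
proof -
  obtain u where u: "det (jac g) * u = 1" using cps_unit[OF det_jac_0] by blast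
  let ?S = "\<Sum>j\<in>UNIV. \<Sum>i\<in>UNIV. phi g $ j $ i * pderiv_cps l (pderiv_cps j (g $ i))"
  have "pderiv_cps l (ln_cps (det (jac g))) * det (jac g) = det (jac g) * ?S"
    unfolding pderiv_ln[OF det_jac_0] pderiv.det_log[OF jac_inverse(2)]
    by (simp add: phi_def transpose_def jac_def mult.commute)
  hence "pderiv_cps l (ln_cps (det (jac g))) * det (jac g) * u = ?S * det (jac g) * u"
    by (simp only: mult.commute[of "det (jac g)"])
  hence "pderiv_cps l (ln_cps (det (jac g))) = ?S"
    by (simp add: mult.assoc u)
  thus ?thesis by (simp add: pderiv_phi_jac sum_negf)
qed

lemma hmat_jac:
  "(\<Sum>i\<in>UNIV. hmat g $ l $ i * pderiv_cps k (g $ i))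
    = - (const_cps (1/2) * (\<Sum>j\<in>UNIV. \<Sum>i\<in>UNIV. pderiv_cps l (phi g $ j $ i) * pderiv_cps k (pderiv_cps j (g $ i))))"
proof -
  let ?d = "\<lambda>r l p. \<Sum>s\<in>UNIV. pderiv_cps r (phi g $ p $ s) * pderiv_cps l (g $ s)"
  have "matrix_inv (transpose (phi g)) = jac g"
    by (rule matrix_inv_eqI) (simp_all add: phi_def jac_inverse)
  hence h: "hmat g $ l $ i = const_cps (1/2) * (\<Sum>s\<in>UNIV. \<Sum>r\<in>UNIV. \<Sum>p\<in>UNIV.
      pderiv_cps l (g $ s) * (pderiv_cps r (phi g $ p $ s) * pderiv_cps p (phi g $ r $ i)))" for i
    by (simp add: hmat_def matrix_matrix_mult_def jac_def psi_def sum_distrib_left)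
  have "(\<Sum>i\<in>UNIV. hmat g $ l $ i * pderiv_cps k (g $ i))
      = const_cps (1/2) * (\<Sum>i\<in>UNIV. \<Sum>s\<in>UNIV. \<Sum>r\<in>UNIV. \<Sum>p\<in>UNIV.
          (pderiv_cps r (phi g $ p $ s) * pderiv_cps l (g $ s)) * (pderiv_cps p (phi g $ r $ i) * pderiv_cps k (g $ i)))"
    unfolding h by (simp add: sum_distrib_left sum_distrib_right mult_ac)
  also have "(\<Sum>i\<in>UNIV. \<Sum>s\<in>UNIV. \<Sum>r\<in>UNIV. \<Sum>p\<in>UNIV.
          (pderiv_cps r (phi g $ p $ s) * pderiv_cps l (g $ s)) * (pderiv_cps p (phi g $ r $ i) * pderiv_cps k (g $ i)))
     = (\<Sum>r\<in>UNIV. \<Sum>p\<in>UNIV. \<Sum>i\<in>UNIV. \<Sum>s\<in>UNIV.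
          (pderiv_cps r (phi g $ p $ s) * pderiv_cps l (g $ s)) * (pderiv_cps p (phi g $ r $ i) * pderiv_cps k (g $ i)))"
    by (rule sum_swap_pairs)
  also have "\<dots> = (\<Sum>r\<in>UNIV. \<Sum>p\<in>UNIV. ?d r l p * ?d p k r)"
    unfolding sum_product by (intro sum.cong refl sum.swap)
  \<comment> \<open>By \<open>pderiv_phi_jac\<close> and symmetry of second derivatives,
    \<open>?d\<close> is symmetric in its first two arguments. Exchanging them puts r on a first
    derivative of g, which can then cancel against the \<phi> exposed in the other factor.\<close>
  also have "\<dots> = (\<Sum>r\<in>UNIV. \<Sum>p\<in>UNIV. ?d l r p * - (\<Sum>i\<in>UNIV. phi g $ r $ i * pderiv_cps k (pderiv_cps p (g $ i))))"
    by (simp only: pderiv_phi_jac pderiv_commute[of l] pderiv_commute[of k])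
  also have "\<dots> = - (\<Sum>r\<in>UNIV. \<Sum>p\<in>UNIV. \<Sum>s\<in>UNIV. \<Sum>i\<in>UNIV.
      (pderiv_cps l (phi g $ p $ s) * pderiv_cps k (pderiv_cps p (g $ i))) * (phi g $ r $ i * pderiv_cps r (g $ s)))"
    by (simp add: sum_product sum_negf mult_ac)
  also have "(\<Sum>r\<in>UNIV. \<Sum>p\<in>UNIV. \<Sum>s\<in>UNIV. \<Sum>i\<in>UNIV.
      (pderiv_cps l (phi g $ p $ s) * pderiv_cps k (pderiv_cps p (g $ i))) * (phi g $ r $ i * pderiv_cps r (g $ s)))
     = (\<Sum>p\<in>UNIV. \<Sum>s\<in>UNIV. \<Sum>i\<in>UNIV. (pderiv_cps l (phi g $ p $ s) * pderiv_cps k (pderiv_cps p (g $ i)))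
          * (\<Sum>r\<in>UNIV. phi g $ r $ i * pderiv_cps r (g $ s)))"
    unfolding sum_distrib_left
    by (rule trans[OF sum.swap sum.cong[OF refl trans[OF sum.swap sum.cong[OF refl sum.swap]]]])
  also have "\<dots> = (\<Sum>j\<in>UNIV. \<Sum>i\<in>UNIV. pderiv_cps l (phi g $ j $ i) * pderiv_cps k (pderiv_cps j (g $ i)))"
    by (simp add: jac_phi if_distrib[of "\<lambda>x. _ * x"] cong: if_cong)
  finally show ?thesis by simp
qed

text \<open>With P and Q as in the proof, the three terms are P, Q/2 and, by
  \<open>hmat_jac\<close>, -P/2, while the second derivative of log det is -(P + Q).\<close>

lemma quadratic_coeff:
  "(\<Sum>i\<in>UNIV. \<Sum>j\<in>UNIV. pderiv_cps l (phi g $ j $ i) * pderiv_cps j (pderiv_cps k (g $ i)))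
   + const_cps (1/2) * (\<Sum>i\<in>UNIV. \<Sum>j\<in>UNIV. pderiv_cps k (pderiv_cps l (phi g $ j $ i)) * pderiv_cps j (g $ i))
   + (\<Sum>i\<in>UNIV. hmat g $ l $ i * pderiv_cps k (g $ i))
   = - (const_cps (1/2) * pderiv_cps k (pderiv_cps l (ln_cps (det (jac g)))))"
proof -
  let ?P = "\<Sum>j\<in>UNIV. \<Sum>i\<in>UNIV. pderiv_cps l (phi g $ j $ i) * pderiv_cps k (pderiv_cps j (g $ i))"
  let ?Q = "\<Sum>j\<in>UNIV. \<Sum>i\<in>UNIV. pderiv_cps k (pderiv_cps l (phi g $ j $ i)) * pderiv_cps j (g $ i)"
  have 1: "pderiv_cps k (pderiv_cps l (ln_cps (det (jac g)))) = - (?Q + ?P)"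
    by (simp add: pderiv_log_det pderiv.minus pderiv.sum pderiv_mult sum.distrib)
  have 2: "(\<Sum>i\<in>UNIV. \<Sum>j\<in>UNIV. pderiv_cps l (phi g $ j $ i) * pderiv_cps j (pderiv_cps k (g $ i))) = ?P"
    by (subst sum.swap) (simp add: pderiv_commute[of k])
  have 3: "(\<Sum>i\<in>UNIV. \<Sum>j\<in>UNIV. pderiv_cps k (pderiv_cps l (phi g $ j $ i)) * pderiv_cps j (g $ i)) = ?Q"
    by (rule sum.swap)
  have "const_cps (1/2) * ?P + const_cps (1/2) * ?P = ?P"
    by (simp add: const_cps_1 flip: distrib_right const_cps_add)
  thus ?thesis unfolding 1 2 3 hmat_jac by (simp add: algebra_simps)
qed

end


section \<open>Evaluation on states without \<open>a\<close>-modes\<close>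

lemma order_b_subst_field: "order_b 0 (subst_field f)"
proof -
  have "order_b 0 (subst_field f - cfield f)"
    using order_b_mono[OF order_b_subst_diff[of 0 f], of 0] by (simp add: taylor_sum_0)
  from order_b_add[OF this order_b_cfield[of f]] show ?thesis by simp
qed

lemma order_b_dfield_coord: "order_b 0 (dfield (coord_field i))"
  using order_b_dfield[OF order_b_shift[of i]] by (simp add: dfield_coord_field)

text \<open>States in \<open>filt 0\<close> contain no \<open>Amode\<close> variable. Fields of
  order 0 are power series in z there, and their first coefficients multiply like Taylor
  coefficients.\<close>

lemma fmode_times_filt_0:
  assumes "order_b 0 X" "order_b 0 Y" "w \<in> filt 0"
  shows "fmode (X * Y) (-1) w = fmode X (-1) (fmode Y (-1) w)"
    and "fmode (X * Y) (-2) w = fmode X (-2) (fmode Y (-1) w) + fmode X (-1) (fmode Y (-2) w)"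
proof -
  have "{j. fmode X j (fmode Y (n - 1 - j) w) \<noteq> 0} \<subseteq> {n..-1}" for n
    using mult_field_support[where X = "fmode X" and Y = "fmode Y" and k = 0 and l = 0 and v = w and d = 0 and n = n] assms
    by (simp add: order_b_def is_bfield_fmode)
  hence 1: "fmode (X * Y) n w = (\<Sum>j\<in>{n..-1}. fmode X j (fmode Y (n - 1 - j) w))" for n
    unfolding fmode_times by (intro Sum_any.expand_superset) auto
  have "{-1..-1} = {-1::int}" "{-2..-1} = {-2, -1::int}" by auto
  with 1[of "-1"] 1[of "-2"] show "fmode (X * Y) (-1) w = fmode X (-1) (fmode Y (-1) w)"
    "fmode (X * Y) (-2) w = fmode X (-2) (fmode Y (-1) w) + fmode X (-1) (fmode Y (-2) w)"
    by simp_all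
qed

lemma fmode_dfield_coord:
  "fmode (dfield (coord_field i)) (-1) w = mvar (Bmode i 0) * w"
  "fmode (dfield (coord_field i)) (-2) w = scl 2 (mvar (Bmode i 1) * w)"
  by (simp_all add: fmode_dfield fmode_coord_field b_field_def b_mode_def)

text \<open>The coefficients of z and z^2 are read off from the chain rule: in the derivative they
  appear multiplied by 1 and 2. The 2 cancels against the one in front of b_{-2} but leaves 1/2 on
  the quadratic part.\<close>

lemma subst_field_filt_0:
  assumes w: "w \<in> filt 0"
  shows "n \<ge> 0 \<Longrightarrow> fmode (subst_field f) n w = 0"
    and "fmode (subst_field f) (-1) w = fn f * w"
    and "fmode (subst_field f) (-2) w = (\<Sum>k\<in>UNIV. mvar (Bmode k 0) * (fn (pderiv_cps k f) * w))"
    and "fmode (subst_field f) (-3) w = (\<Sum>k\<in>UNIV. mvar (Bmode k 1) * (fn (pderiv_cps k f) * w))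
      + scl (1/2) (\<Sum>k\<in>UNIV. \<Sum>l\<in>UNIV. mvar (Bmode k 0) * (mvar (Bmode l 0) * (fn (pderiv_cps l (pderiv_cps k f)) * w)))"
proof -
  show "fmode (subst_field f) n w = 0" if "n \<ge> 0"
    by (rule order_b_zero[OF order_b_subst_field w]) (use that in simp)
  have top: "fmode (subst_field f) (-1) w = fn f * w" for f
    using order_b_zero[OF order_b_subst_diff[of 0 f] w, of "-1"]
    by (simp add: fmode_minus taylor_sum_0 fmode_cfield)
  thus "fmode (subst_field f) (-1) w = fn f * w" .
  note ev = fmode_times_filt_0[OF order_b_dfield_coord order_b_subst_field w]
  have second: "fmode (subst_field f) (-2) w = (\<Sum>k\<in>UNIV. mvar (Bmode k 0) * (fn (pderiv_cps k f) * w))" for f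
  proof -
    have "fmode (subst_field f) (-2) w = fmode (dfield (subst_field f)) (-1) w"
      by (simp add: fmode_dfield)
    thus ?thesis by (simp add: dfield_subst_field fmode_sum ev fmode_dfield_coord top)
  qed
  thus "fmode (subst_field f) (-2) w = (\<Sum>k\<in>UNIV. mvar (Bmode k 0) * (fn (pderiv_cps k f) * w))" .
  have "scl 2 (fmode (subst_field f) (-3) w) = fmode (dfield (subst_field f)) (-2) w"
    by (simp add: fmode_dfield)
  also have "\<dots> = (\<Sum>k\<in>UNIV. scl 2 (mvar (Bmode k 1) * (fn (pderiv_cps k f) * w)))
      + (\<Sum>k\<in>UNIV. \<Sum>l\<in>UNIV. mvar (Bmode k 0) * (mvar (Bmode l 0) * (fn (pderiv_cps l (pderiv_cps k f)) * w)))"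
    by (simp add: dfield_subst_field fmode_sum ev fmode_dfield_coord top second sum.distrib sum_distrib_left)
  finally have "scl (1/2) (scl 2 (fmode (subst_field f) (-3) w)) = scl (1/2) (\<dots>)" by simp
  thus "fmode (subst_field f) (-3) w = (\<Sum>k\<in>UNIV. mvar (Bmode k 1) * (fn (pderiv_cps k f) * w))
      + scl (1/2) (\<Sum>k\<in>UNIV. \<Sum>l\<in>UNIV. mvar (Bmode k 0) * (mvar (Bmode l 0) * (fn (pderiv_cps l (pderiv_cps k f)) * w)))"
    by (simp add: scl_add scl_scl additive.sum[OF additive_scl])
qed

lemma one_filt: "1 \<in> filt 0"
  using fn_filt[of 1] by (simp add: fn_1)

text \<open>The shape of the image of b^i_{-1}, where c is the gradient of g^i.\<close>

definition b_linear :: "('n \<Rightarrow> ('n::finite) cps) \<Rightarrow> 'n cdo" where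
  "b_linear c = (\<Sum>k\<in>UNIV. mvar (Bmode k 0) * fn (c k))"

lemma b_linear_filt: "b_linear c \<in> filt 0"
  unfolding b_linear_def by (intro filt_sum Bmode_mult_filt fn_filt)

lemma dvar_b_linear: "dvar (Bmode j k) (b_linear c) = (if k = 0 then fn (c j) else 0)"
proof -
  have "dvar (Bmode j k) (mvar (Bmode l 0) * fn f) = (if l = j \<and> k = 0 then fn f else 0)" for l f
    by (cases "l = j \<and> k = 0") (auto simp: dvar_mvar_mult_same dvar_mvar_mult_other)
  thus ?thesis
    by (cases "k = 0") (simp_all add: b_linear_def additive.sum[OF additive_dvar])
qed

lemma map_b_linear: "Poly_Mapping.map (pderiv_cps j) (b_linear c) = b_linear (\<lambda>k. pderiv_cps j (c k))"
  by (simp add: b_linear_def additive.sum[OF additive_map_pderiv] mvar_fn map_single pderiv.zero)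

text \<open>The first term has no contraction, the second comes from a_0 differentiating c, and the
  last two from a_1 removing a variable b_{-1} in front of the coefficient of z^2 in f(b(z)). All
  other modes vanish: a_n with n \<ge> 2 finds no variable to remove, and nonnegative modes of f
  kill \<open>filt 0\<close>.\<close>

lemma nop_a_field_b_linear:
  "nop (a_field j) (fn_field f) (-1) (b_linear c) =
     mvar (Amode j 0) * (fn f * b_linear c)
     + (\<Sum>l\<in>UNIV. \<Sum>k\<in>UNIV. mvar (Bmode l 0) * (mvar (Bmode k 0) * fn (pderiv_cps l f * pderiv_cps j (c k))))
     + (\<Sum>l\<in>UNIV. mvar (Bmode l 1) * fn (pderiv_cps l f * c j))
     + (\<Sum>l\<in>UNIV. \<Sum>k\<in>UNIV. mvar (Bmode l 0) * (mvar (Bmode k 0) * fn (const_cps (1/2) * (pderiv_cps k (pderiv_cps l f) * c j))))"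
proof -
  let ?w = "b_linear c"
  let ?s = "\<lambda>k::nat. a_field j (- 1 - int k) (fn_field f (- 1 + int k) ?w) + fn_field f (- 1 - 1 - int k) (a_field j (int k) ?w)"
  note add0 = additive.zero[OF is_fieldD(1)[OF is_field_a_field]] additive.zero[OF is_fieldD(1)[OF is_field_fn_field]]
  have sub: "fn_field f = fmode (subst_field f)" by (simp add: subst_field.rep_eq)
  have sk: "?s k = 0" if "k \<ge> 2" for k
  proof -
    have "a_field j (int k) ?w = 0"
      using that by (simp add: a_field_def a_mode_def dvar_b_linear)
    moreover have "fn_field f (- 1 + int k) ?w = 0"
      unfolding sub by (rule subst_field_filt_0(1)[OF b_linear_filt]) (use that in simp)
    ultimately show ?thesis by (simp add: add0)
  qed
  have "nop (a_field j) (fn_field f) (-1) ?w = (\<Sum>k\<in>{0, 1}. ?s k)"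
    unfolding nop_def
  proof (rule Sum_any.expand_superset)
    show "{k. ?s k \<noteq> 0} \<subseteq> {0, 1}"
    proof
      fix k assume "k \<in> {k. ?s k \<noteq> 0}"
      hence "\<not> k \<ge> 2" using sk by blast
      thus "k \<in> {0, 1}" by auto
    qed
  qed simp
  also have "\<dots> = ?s 0 + ?s 1" by simp
  also have "?s 0 = mvar (Amode j 0) * (fn f * ?w)
      + (\<Sum>l\<in>UNIV. \<Sum>k\<in>UNIV. mvar (Bmode l 0) * (mvar (Bmode k 0) * fn (pderiv_cps l f * pderiv_cps j (c k))))"
    unfolding sub
    by (simp add: subst_field_filt_0 b_linear_filt a_field_def a_mode_def map_b_linear)
       (simp add: b_linear_def sum_distrib_left fn_mult mult_ac)
  also have "?s 1 = fmode (subst_field f) (-3) (fn (c j))"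
    unfolding sub
    by (simp add: subst_field_filt_0 b_linear_filt a_field_def a_mode_def dvar_b_linear)
  also have "\<dots> = (\<Sum>l\<in>UNIV. mvar (Bmode l 1) * fn (pderiv_cps l f * c j))
     + (\<Sum>l\<in>UNIV. \<Sum>k\<in>UNIV. mvar (Bmode l 0) * (mvar (Bmode k 0) * fn (const_cps (1/2) * (pderiv_cps k (pderiv_cps l f) * c j))))"
    by (simp add: subst_field_filt_0(4)[OF fn_filt] scl_def sum_distrib_left fn_mult mult_ac)
  finally show ?thesis by (simp add: add.assoc)
qed


section \<open>The transformation of the Virasoro field\<close>

lemma mderiv_const_mult: "mderiv_cps \<alpha> (const_cps c * f) = const_cps c * mderiv_cps \<alpha> f"
  by (rule cps_eqI) (simp add: coeff_mderiv coeff_const_mult)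

lemma subst_field_const_mult: "subst_field (const_cps c * f) = cfield (const_cps c) * subst_field f"
proof (rule subst_field_eqI)
  fix N
  have "taylor_sum N (const_cps c * f) = cfield (const_cps c) * taylor_sum N f"
    by (simp add: taylor_sum_def taylor_term_def mderiv_const_mult sum_distrib_left cfield_mult)
       (simp only: mult_ac)
  hence "taylor_sum N (const_cps c * f) - cfield (const_cps c) * subst_field f
      = - (cfield (const_cps c) * (subst_field f - taylor_sum N f))"
    by (simp add: algebra_simps)
  moreover have "order_b (int N) (cfield (const_cps c) * (subst_field f - taylor_sum N f))"
    by (rule order_b_mono[OF order_b_mult[OF order_b_cfield order_b_subst_diff]]) simp
  ultimately show "order_b (int N) (taylor_sum N (const_cps c * f) - cfield (const_cps c) * subst_field f)"
    by (simp only: order_b_uminus)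
qed

text \<open>The state is the coefficient of z^2 of f(b(z)) on the vacuum, whence the factor
  1/2.\<close>

lemma state_field_second_derivative:
  "state_field ((\<Sum>l\<in>UNIV. mvar (Bmode l 1) * fn (pderiv_cps l f))
     + (\<Sum>l\<in>UNIV. \<Sum>k\<in>UNIV. mvar (Bmode l 0) * (mvar (Bmode k 0) * fn (const_cps (1/2) * pderiv_cps k (pderiv_cps l f))))) n v
   = scl (1/2) (deriv_field (deriv_field (state_field (fn f))) n v)"
proof -
  have "scl (1/2) (deriv_field (deriv_field (state_field (fn f))) n v)
      = fmode (cfield (const_cps (1/2)) * dfield (dfield (subst_field f))) n v"
    by (simp add: fmode_scl scl_field_def state_field_fn dfield.rep_eq subst_field.rep_eq)
  also have "cfield (const_cps (1/2)) * dfield (dfield (subst_field f)) =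
     (\<Sum>l\<in>UNIV. cfield (const_cps (1/2)) * dfield (dfield (coord_field l)) * subst_field (pderiv_cps l f))
     + (\<Sum>l\<in>UNIV. \<Sum>k\<in>UNIV. dfield (coord_field l) * dfield (coord_field k) * subst_field (const_cps (1/2) * pderiv_cps k (pderiv_cps l f)))"
    by (simp add: dfield_dfield_subst_field subst_field_const_mult distrib_left sum_distrib_left)
       (simp only: mult_ac)
  finally show ?thesis
    by (simp add: state_field_add additive.sum[OF additive_state_field] state_field_B1 state_field_B0_B0
          fmode_plus fmode_sum del: One_nat_def)
qed

lemma transformed_virasoro_state:
  assumes g: "coordinate_change g" and T: "lifts_coordinate_change g T"
  shows "T virasoro_state = virasoro_state
    - ((\<Sum>l\<in>UNIV. mvar (Bmode l 1) * fn (pderiv_cps l (ln_cps (det (jac g)))))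
      + (\<Sum>l\<in>UNIV. \<Sum>k\<in>UNIV. mvar (Bmode l 0) * (mvar (Bmode k 0) *
          fn (const_cps (1/2) * pderiv_cps k (pderiv_cps l (ln_cps (det (jac g))))))))"
proof -
  have T_add: "Modules.additive T" and T_1: "T 1 = 1"
    and T_field: "T (state_field u n v) = state_field (T u) n (T v)" for u n v
    using T by (auto simp: lifts_coordinate_change_def vertex_automorphism_def Modules.additive_def)
  have T_var: "T (fn (var_cps i)) = fn (g $ i)" for i
    using T by (simp add: lifts_coordinate_change_def)
  have T_A: "T (mvar (Amode i 0)) = (\<Sum>j\<in>UNIV. mvar (Amode j 0) * fn (phi g $ j $ i))
      + (\<Sum>k\<in>UNIV. mvar (Bmode k 0) * fn (hmat g $ k $ i))" for i
    using T by (simp add: lifts_coordinate_change_def)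
  let ?c = "\<lambda>i k. pderiv_cps k (g $ i)"
  \<comment> \<open>Mode -2 on the vacuum expresses b^i_{-1} through the state b^i_0, on which T is
    prescribed.\<close>
  have B_eq: "state_field (fn f) (-2) 1 = b_linear (\<lambda>k. pderiv_cps k f)" for f
    using subst_field_filt_0(3)[OF one_filt] by (simp add: state_field_fn subst_field.rep_eq b_linear_def)
  have B_var: "b_linear (\<lambda>k. pderiv_cps k (var_cps i)) = mvar (Bmode i 0)" for i
  proof -
    have "mvar (Bmode k 0) * fn (if k = i then 1 else 0) = (if k = i then mvar (Bmode k 0) else 0)" for k
      by (simp add: fn_1 fn_0)
    thus ?thesis by (simp add: b_linear_def pderiv_var)
  qed
  have T_B: "T (mvar (Bmode i 0)) = b_linear (?c i)" for i
    using T_field[of "fn (var_cps i)" "-2" 1] by (simp add: B_eq B_var T_var T_1)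
  have T_AB: "T (mvar (Amode i 0) * mvar (Bmode i 0)) =
      (\<Sum>j\<in>UNIV. nop (a_field j) (fn_field (phi g $ j $ i)) (-1) (b_linear (?c i)))
      + (\<Sum>l\<in>UNIV. \<Sum>k\<in>UNIV. mvar (Bmode l 0) * (mvar (Bmode k 0) * fn (hmat g $ l $ i * ?c i k)))" for i
  proof -
    \<comment> \<open>Mode -1 of a^i(z) multiplies by \<open>Amode i 0\<close>, so T can be applied
      to both arguments of the product separately.\<close>
    have "mvar (Amode i 0) * mvar (Bmode i 0) = state_field (mvar (Amode i 0)) (-1) (mvar (Bmode i 0))"
      by (simp add: state_field_A_1 a_field_def a_mode_def)
    hence "T (mvar (Amode i 0) * mvar (Bmode i 0)) = state_field (T (mvar (Amode i 0))) (-1) (b_linear (?c i))"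
      by (simp add: T_field T_B)
    moreover have "fmode (dfield (coord_field l) * subst_field h) (-1) (b_linear c)
        = (\<Sum>k\<in>UNIV. mvar (Bmode l 0) * (mvar (Bmode k 0) * fn (h * c k)))" for l h and c :: "'a \<Rightarrow> 'a cps"
      by (simp add: fmode_times_filt_0[OF order_b_dfield_coord order_b_subst_field b_linear_filt]
            fmode_dfield_coord subst_field_filt_0(2)[OF b_linear_filt])
         (simp add: b_linear_def sum_distrib_left fn_mult mult_ac)
    ultimately show ?thesis
      by (simp add: T_A state_field_add additive.sum[OF additive_state_field] state_field_A state_field_B0)
  qed
  let ?A = "\<lambda>j. mvar (Amode j 0)" and ?B = "\<lambda>l. mvar (Bmode l 0)"
  \<comment> \<open>The terms without contraction: \<phi> cancels \<partial>g and the original state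
    reappears.\<close>
  have S1: "(\<Sum>i\<in>UNIV. \<Sum>j\<in>UNIV. ?A j * (fn (phi g $ j $ i) * b_linear (?c i))) = virasoro_state"
  proof -
    have "(\<Sum>i\<in>UNIV. \<Sum>j\<in>UNIV. ?A j * (fn (phi g $ j $ i) * b_linear (?c i)))
        = (\<Sum>i\<in>UNIV. \<Sum>j\<in>UNIV. \<Sum>k\<in>UNIV. ?A j * (?B k * fn (phi g $ j $ i * ?c i k)))"
      by (simp add: b_linear_def sum_distrib_left fn_mult mult_ac)
    also have "\<dots> = (\<Sum>j\<in>UNIV. \<Sum>k\<in>UNIV. \<Sum>i\<in>UNIV. ?A j * (?B k * fn (phi g $ j $ i * ?c i k)))"
      by (subst sum.swap) (intro sum.cong refl sum.swap)
    also have "\<dots> = (\<Sum>j\<in>UNIV. \<Sum>k\<in>UNIV. ?A j * (?B k * fn (\<Sum>i\<in>UNIV. phi g $ j $ i * ?c i k)))"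
      by (simp add: fn_sum sum_distrib_left)
    also have "\<dots> = (\<Sum>j\<in>UNIV. \<Sum>k\<in>UNIV. if j = k then ?A j * ?B k else 0)"
      by (intro sum.cong refl) (simp add: phi_jac[OF g] fn_1 fn_0)
    finally show ?thesis by (simp add: virasoro_state_def)
  qed
  have S2: "(\<Sum>i\<in>UNIV. \<Sum>j\<in>UNIV. \<Sum>l\<in>UNIV. mvar (Bmode l 1) * fn (pderiv_cps l (phi g $ j $ i) * ?c i j))
      = (\<Sum>l\<in>UNIV. mvar (Bmode l 1) * fn (- pderiv_cps l (ln_cps (det (jac g)))))"
  proof -
    have "(\<Sum>i\<in>UNIV. \<Sum>j\<in>UNIV. \<Sum>l\<in>UNIV. mvar (Bmode l 1) * fn (pderiv_cps l (phi g $ j $ i) * ?c i j))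
       = (\<Sum>l\<in>UNIV. \<Sum>j\<in>UNIV. \<Sum>i\<in>UNIV. mvar (Bmode l 1) * fn (pderiv_cps l (phi g $ j $ i) * ?c i j))"
      by (rule trans[OF sum_rotate sum.cong[OF refl sum.swap]])
    thus ?thesis by (simp add: pderiv_log_det[OF g] fn_sum sum_distrib_left del: One_nat_def)
  qed
  have S3: "(\<Sum>i\<in>UNIV. \<Sum>j\<in>UNIV. \<Sum>l\<in>UNIV. \<Sum>k\<in>UNIV. ?B l * (?B k * fn (F i j l k)))
      = (\<Sum>l\<in>UNIV. \<Sum>k\<in>UNIV. ?B l * (?B k * fn (\<Sum>i\<in>UNIV. \<Sum>j\<in>UNIV. F i j l k)))" for F
    by (subst sum_swap_pairs) (simp add: fn_sum sum_distrib_left)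
  have S4: "(\<Sum>i\<in>UNIV. \<Sum>l\<in>UNIV. \<Sum>k\<in>UNIV. ?B l * (?B k * fn (F i l k)))
      = (\<Sum>l\<in>UNIV. \<Sum>k\<in>UNIV. ?B l * (?B k * fn (\<Sum>i\<in>UNIV. F i l k)))" for F
    by (subst sum.swap, intro sum.cong refl, subst sum.swap) (simp add: fn_sum sum_distrib_left)
  have "T virasoro_state = (\<Sum>i\<in>UNIV. T (?A i * ?B i))"
    by (simp add: virasoro_state_def additive.sum[OF T_add])
  also have "\<dots> = virasoro_state
      + (\<Sum>l\<in>UNIV. \<Sum>k\<in>UNIV. ?B l * (?B k * fn (\<Sum>i\<in>UNIV. \<Sum>j\<in>UNIV. pderiv_cps l (phi g $ j $ i) * pderiv_cps j (?c i k))))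
      + (\<Sum>l\<in>UNIV. mvar (Bmode l 1) * fn (- pderiv_cps l (ln_cps (det (jac g)))))
      + (\<Sum>l\<in>UNIV. \<Sum>k\<in>UNIV. ?B l * (?B k * fn (\<Sum>i\<in>UNIV. \<Sum>j\<in>UNIV. const_cps (1/2) * (pderiv_cps k (pderiv_cps l (phi g $ j $ i)) * ?c i j))))
      + (\<Sum>l\<in>UNIV. \<Sum>k\<in>UNIV. ?B l * (?B k * fn (\<Sum>i\<in>UNIV. hmat g $ l $ i * ?c i k)))"
    unfolding T_AB nop_a_field_b_linear sum.distrib S1 S2 S3 S4 ..
  also have "\<dots> = virasoro_state + (\<Sum>l\<in>UNIV. mvar (Bmode l 1) * fn (- pderiv_cps l (ln_cps (det (jac g)))))
      + (\<Sum>l\<in>UNIV. \<Sum>k\<in>UNIV. ?B l * (?B k * fn (- (const_cps (1/2) * pderiv_cps k (pderiv_cps l (ln_cps (det (jac g))))))))"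
    \<comment> \<open>Read from right to left: the coefficient on the right is split into the
      contributions of a_0, of a_1 and of h.\<close>
    unfolding quadratic_coeff[OF g, symmetric] fn_add distrib_left sum.distrib sum_distrib_left
    by (simp only: ac_simps)
  finally show ?thesis
    by (simp add: fn_uminus sum_negf)
qed

theorem theorem9p1:
  fixes g :: "('n::finite) cps ^ 'n" and T :: "'n cdo \<Rightarrow> 'n cdo"
  assumes "coordinate_change g"
    and "lifts_coordinate_change g T"
  shows "state_field (T virasoro_state) n v =
    virasoro_field n v
      - scl (1/2) (deriv_field (deriv_field (state_field (fn (ln_cps (det (jac g)))))) n v)"
  unfolding transformed_virasoro_state[OF assms]
  by (simp add: additive.diff[OF additive_state_field] state_field_second_derivative state_field_virasoro del: One_nat_def)

end
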